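(* Let $n\ge 3$, $0<\sigma<1$, and let $\alpha_1,\alpha_2,\beta$ be positive constants. Let $u,v\in C^2(\mathbb{R}^n\setminus\{0\})\cap L_\sigma(\mathbb{R}^n)$, $u,v>0$, satisfy $$(-\Delta)^{\sigma}u=\alpha_1u^{\frac{n+2\sigma}{n-2\sigma}}+\beta u^{\frac{2\sigma}{n-2\sigma}}v^{\frac{n}{n-2\sigma}},\qquad (-\Delta)^{\sigma}v=\alpha_2v^{\frac{n+2\sigma}{n-2\sigma}}+\beta v^{\frac{2\sigma}{n-2\sigma}}u^{\frac{n}{n-2\sigma}}\qquad\text{in }\mathbb{R}^n\setminus\{0\},$$ and suppose that $(u,v)$ is singular, that is, $\limsup_{x\to0}u(x)+\limsup_{x\to0}v(x)=\infty$. Then both $u$ and $v$ are radially symmetric (about the origin) and monotonically decreasing radially, i.e. each is a non-increasing function of $|x|$ on $\mathbb{R}^n\setminus\{0\}$.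
   Context: $L_\sigma(\mathbb{R}^n)=\{u\in L^1_{\rm loc}(\mathbb{R}^n):\int_{\mathbb{R}^n}\frac{|u(x)|}{1+|x|^{n+2\sigma}}dx<\infty\}$. The fractional Laplacian is understood in the classical (pointwise) sense: $(-\Delta)^{\sigma}u(x)=C_{n,\sigma}\lim_{\varepsilon\to0^+}\int_{\mathbb{R}^n\setminus B_\varepsilon(x)}\frac{u(x)-u(y)}{|x-y|^{n+2\sigma}}dy$ with $C_{n,\sigma}=\frac{2^{2\sigma}\sigma\Gamma(\frac n2+\sigma)}{\pi^{n/2}\Gamma(1-\sigma)}$. *)

theory Defs
  imports "HOL-Analysis.Analysis"
begin

text \<open>Twice continuous (Frechet) differentiability, meant for open \<open>S\<close>; the values of \<open>u\<close>
  outside \<open>S\<close> are irrelevant. The first derivative takes values in the normed space of bounded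
  linear functionals; its continuity follows from its differentiability.\<close>

definition C2_on :: "'a::euclidean_space set \<Rightarrow> ('a \<Rightarrow> real) \<Rightarrow> bool" where
  "C2_on S u \<longleftrightarrow>
     (\<exists>(Du :: 'a \<Rightarrow> 'a \<Rightarrow>\<^sub>L real) (D2u :: 'a \<Rightarrow> 'a \<Rightarrow>\<^sub>L 'a \<Rightarrow>\<^sub>L real).
        (\<forall>x\<in>S. (u has_derivative blinfun_apply (Du x)) (at x)) \<and>
        (\<forall>x\<in>S. (Du has_derivative blinfun_apply (D2u x)) (at x)) \<and>
        continuous_on S D2u)"

definition L1_loc :: "(real ^ 'n \<Rightarrow> real) set" where
  "L1_loc = {u. \<forall>K. compact K \<longrightarrow> u absolutely_integrable_on K}"

definition L_sigma :: "real \<Rightarrow> (real ^ 'n \<Rightarrow> real) set" where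
  "L_sigma \<sigma> = {u \<in> L1_loc.
     integrable lebesgue (\<lambda>x. \<bar>u x\<bar> / (1 + norm x powr (real CARD('n) + 2 * \<sigma>)))}"

definition frac_const :: "nat \<Rightarrow> real \<Rightarrow> real" where
  "frac_const n \<sigma> =
     2 powr (2 * \<sigma>) * \<sigma> * Gamma (real n / 2 + \<sigma>) / (pi powr (real n / 2) * Gamma (1 - \<sigma>))"

text \<open>\<open>has_frac_laplacian \<sigma> u x L\<close> says that the principal value defining
  \<open>(-\<Delta>)\<^sup>\<sigma> u(x)\<close> exists and equals \<open>L\<close>. It is meant for \<open>u \<in> L_sigma \<sigma>\<close> with \<open>\<sigma> > 0\<close>,
  for which all the truncated integrals converge absolutely.\<close>

definition has_frac_laplacian ::
    "real \<Rightarrow> (real ^ 'n \<Rightarrow> real) \<Rightarrow> real ^ 'n \<Rightarrow> real \<Rightarrow> bool" where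
  "has_frac_laplacian \<sigma> u x L \<longleftrightarrow>
     ((\<lambda>\<epsilon>. frac_const CARD('n) \<sigma> *
         (LINT y:UNIV - ball x \<epsilon>|lebesgue.
            (u x - u y) / norm (x - y) powr (real CARD('n) + 2 * \<sigma>)))
       \<longlongrightarrow> L) (at_right 0)"

definition radially_symmetric :: "(real ^ 'n \<Rightarrow> real) \<Rightarrow> bool" where
  "radially_symmetric u \<longleftrightarrow>
     (\<forall>x y. x \<noteq> 0 \<longrightarrow> y \<noteq> 0 \<longrightarrow> norm x = norm y \<longrightarrow> u x = u y)"

definition radially_nonincreasing :: "(real ^ 'n \<Rightarrow> real) \<Rightarrow> bool" where
  "radially_nonincreasing u \<longleftrightarrow>
     (\<forall>x y. x \<noteq> 0 \<longrightarrow> y \<noteq> 0 \<longrightarrow> norm x \<le> norm y \<longrightarrow> u y \<le> u x)"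

end

theory Submission imports Defs begin

text \<open>The method of moving spheres, carried out directly with the pointwise principal values. For a
  centre \<open>x \<noteq> 0\<close> and a radius \<open>0 < \<lambda> < |x|\<close>, \<open>u\<close> and \<open>v\<close> are compared in the ball with their Kelvin
  transforms, which solve the same conformally invariant system there and are singular only at the
  centre and at the mirror image of the origin. The difference \<open>W\<close> is antisymmetric under the inversion,
  so at a negative minimum the principal value can be written with the kernel minus its reflection,
  which is positive, plus \<open>W\<close> times the mass of the kernel outside the ball; near the sphere that mass
  blows up and excludes negative minima. At the isolated singularities a small multiple of the
  fundamental solution \<open>|z|\<^sup>2\<^sup>\<sigma>\<^sup>-\<^sup>n\<close> forces a minimum to be attained and gives a positive lower bound
  for \<open>W\<close>. Hence the set of admissible radii is all of \<open>(0, |x|)\<close>, equality being excluded because it would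
  bound \<open>u\<close> and \<open>v\<close> near the origin. Given \<open>|y\<^sub>1| \<le> |y\<^sub>2|\<close>, there are such spheres exchanging \<open>y\<^sub>1\<close>
  and \<open>y\<^sub>2\<close> with centres tending to infinity, and in the limit \<open>u y\<^sub>2 \<le> u y\<^sub>1\<close>.\<close>

text \<open>The singularity of \<open>u\<close> and \<open>v\<close> has unknown strength, so a
  minimum of the difference need not be attained and the Kelvin transforms have no upper bound. Two
  choices leave only regular quantities to be controlled. The nonlinearity is monotone and
  homogeneous, and the tangent of a power at 1 yields a one-sided Lipschitz bound whose coefficient
  involves \<open>u\<close> and \<open>v\<close> in the ball but not their Kelvin transforms. For a
  sphere of radius \<lambda>, points are labelled so that the outer point is
  \<open>inversion z\<close> and its mirror image \<lambda>^2 z: the singular values then form a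
  term independent of \<lambda>, and only a regular term moves. Principal values are transformed by
  a change of variables in the truncated integrals. The inversion distorts the excluded ball, which
  is negligible for an integrand vanishing to first order at the centre. The same comparison
  evaluates the operator on the fundamental solution: \<open>1 - fund\<close> is odd under the
  Kelvin transform, so its principal value at a point of the unit sphere equals its own negative.
  The coupling is handled by minimising over both differences at once.\<close>

section \<open>Inversion and change of variables\<close>

text \<open>The change of variables theorem of the library requires a well-ordered index type;
  \<open>ord_index\<close> provides one of the same cardinality for an arbitrary finite index type.\<close>

typedef ('n::finite) ord_index = "{..<CARD('n)}"
  morphisms idx_nat nat_idx
  by (rule exI[of _ 0]) (simp add: zero_less_card_finite)

instance ord_index :: (finite) finite
proof
  have "(UNIV :: 'a ord_index set) = nat_idx ` {..<CARD('a)}"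
    by (metis type_definition.Abs_image type_definition_ord_index)
  then show "finite (UNIV :: 'a ord_index set)"
    by (metis finite_imageI finite_lessThan)
qed

instantiation ord_index :: (finite) wellorder
begin

definition "less_eq_ord_index (x :: 'a ord_index) (y :: 'a ord_index) \<longleftrightarrow> idx_nat x \<le> idx_nat y"
definition "less_ord_index (x :: 'a ord_index) (y :: 'a ord_index) \<longleftrightarrow> idx_nat x < idx_nat y"

instance
proof
  fix P :: "'a ord_index \<Rightarrow> bool" and a
  assume *: "\<And>x. (\<And>y. y < x \<Longrightarrow> P y) \<Longrightarrow> P x"
  show "P a"
    by (induction a rule: measure_induct_rule[of idx_nat]) (use * in \<open>auto simp: less_ord_index_def\<close>)
qed (auto simp: less_eq_ord_index_def less_ord_index_def idx_nat_inject)

end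

lemma card_ord_index: "CARD('n::finite ord_index) = CARD('n)"
  by (metis card_lessThan type_definition.card type_definition_ord_index)

definition reindex :: "('m::finite \<Rightarrow> 'n::finite) \<Rightarrow> real ^ 'n \<Rightarrow> real ^ 'm" where
  "reindex h x = (\<chi> i. x $ h i)"

lemma reindex_nth [simp]: "reindex h x $ i = x $ h i"
  by (simp add: reindex_def)

lemma linear_reindex: "linear (reindex h)"
  by (rule linearI) (auto simp: vec_eq_iff)

lemma measurable_reindex [measurable]: "reindex h \<in> borel_measurable borel"
  by (intro borel_measurable_continuous_onI linear_continuous_on linear_reindex
        linear_conv_bounded_linear[THEN iffD1])

lemma reindex_scaleR: "reindex h (c *\<^sub>R x) = c *\<^sub>R reindex h x"
  by (simp add: vec_eq_iff)

lemma norm_reindex: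
  assumes "bij h"
  shows "norm (reindex h x) = norm x"
proof -
  have "(\<Sum>i\<in>UNIV. (x $ h i)\<^sup>2) = (\<Sum>i\<in>UNIV. (x $ i)\<^sup>2)"
    using assms by (intro sum.reindex_bij_betw) (simp add: bij_betw_def)
  then show ?thesis
    by (simp add: norm_vec_def L2_set_def)
qed

lemma prod_Basis_cart: "(\<Prod>b\<in>Basis. (v :: real ^ 'k) \<bullet> b) = (\<Prod>i\<in>UNIV. v $ i)"
proof -
  have inj: "inj (\<lambda>i::'k. axis i (1::real))"
    by (auto simp: inj_on_def axis_eq_axis)
  have "(Basis :: (real ^ 'k) set) = range (\<lambda>i::'k. axis i (1::real))"
    by (auto simp: Basis_vec_def)
  then have "(\<Prod>b\<in>Basis. v \<bullet> b) = (\<Prod>b\<in>range (\<lambda>i::'k. axis i (1::real)). v \<bullet> b)"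
    by simp
  also have "\<dots> = (\<Prod>i\<in>UNIV. v \<bullet> axis i 1)"
    by (subst prod.reindex[OF inj]) (simp add: o_def)
  finally show ?thesis
    by (simp add: inner_axis)
qed

text \<open>Permuting coordinates maps boxes to boxes with the same side lengths, and boxes
  determine Lebesgue measure.\<close>

lemma distr_lborel_reindex:
  fixes h :: "'m::finite \<Rightarrow> 'n::finite"
  assumes h: "bij h"
  shows "distr lborel borel (reindex h) = lborel"
proof (rule sym, rule lborel_eqI)
  fix l u :: "real ^ 'm"
  assume le: "\<And>b. b \<in> Basis \<Longrightarrow> l \<bullet> b \<le> u \<bullet> b"
  define g where "g = inv h"
  have gh: "g (h i) = i" "h (g j) = j" for i j
    using h by (auto simp: g_def bij_is_inj bij_is_surj surj_f_inv_f)
  have le': "l $ i \<le> u $ i" for i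
    using le[of "axis i 1"] by (simp add: inner_axis axis_in_Basis_iff)
  have eq: "reindex h -` box l u = box (reindex g l) (reindex g u)"
    unfolding set_eq_iff vimage_eq mem_box_cart using gh unfolding reindex_nth by metis
  note prd = prod_Basis_cart
  have leg: "\<forall>b\<in>Basis. reindex g l \<bullet> b \<le> reindex g u \<bullet> b"
    using le' by (auto simp: Basis_vec_def inner_axis)
  have "emeasure (distr lborel borel (reindex h)) (box l u) = emeasure lborel (box (reindex g l) (reindex g u))"
    by (simp add: emeasure_distr eq)
  also have "\<dots> = (\<Prod>b\<in>Basis. (reindex g u - reindex g l) \<bullet> b)"
    using leg by (simp add: emeasure_lborel_box_eq)
  also have "(\<Prod>b\<in>Basis. (reindex g u - reindex g l) \<bullet> b) = (\<Prod>i\<in>UNIV. (u - l) $ g i)"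
    unfolding prd by simp
  also have "\<dots> = (\<Prod>i\<in>UNIV. (u - l) $ i)"
    by (rule prod.reindex_bij_betw) (use h in \<open>simp add: g_def bij_imp_bij_inv bij_betw_def[symmetric]\<close>)
  finally show "emeasure (distr lborel borel (reindex h)) (box l u) = (\<Prod>b\<in>Basis. (u - l) \<bullet> b)"
    unfolding prd .
qed simp

section \<open>Inversion in the unit sphere and its Jacobian\<close>

definition inversion :: "'a::real_inner \<Rightarrow> 'a" where
  "inversion x = x /\<^sub>R (norm x)\<^sup>2"

lemma inversion_0 [simp]: "inversion 0 = 0"
  by (simp add: inversion_def)

lemma norm_inversion [simp]: "norm (inversion x) = 1 / norm x"
  by (simp add: inversion_def power2_eq_square field_simps)

lemma inversion_eq_0_iff [simp]: "inversion x = 0 \<longleftrightarrow> x = 0"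
  by (auto simp: inversion_def)

lemma inversion_inversion [simp]: "inversion (inversion x) = x"
  by (cases "x = 0") (auto simp: inversion_def power2_eq_square field_simps)

lemma inversion_eq_iff: "inversion x = y \<longleftrightarrow> x = inversion y"
  by auto

lemma measurable_inversion [measurable]: "inversion \<in> borel_measurable (borel :: 'a::euclidean_space measure)"
  unfolding inversion_def by measurable

text \<open>This identity is the source of conformal covariance: it turns the kernel of order
  \<open>s\<close> at two inverted points into |x|^s |y|^s times the kernel at the original
  points.\<close>

lemma dist_inversion:
  assumes "x \<noteq> 0" "y \<noteq> 0"
  shows "norm (inversion x - inversion y) = norm (x - y) / (norm x * norm y)"
proof -
  have "(norm (inversion x - inversion y))\<^sup>2 = (norm (x - y) / (norm x * norm y))\<^sup>2"
  proof -
    have "(norm (inversion x - inversion y))\<^sup>2 =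
        inverse (x \<bullet> x) * inverse (x \<bullet> x) * (x \<bullet> x) - 2 * (inverse (x \<bullet> x) * inverse (y \<bullet> y) * (x \<bullet> y))
        + inverse (y \<bullet> y) * inverse (y \<bullet> y) * (y \<bullet> y)"
      by (simp add: inversion_def power2_norm_eq_inner inner_diff_left inner_diff_right inner_commute algebra_simps)
    also have "\<dots> = inverse (x \<bullet> x) * inverse (y \<bullet> y) * ((y \<bullet> y) - 2 * (x \<bullet> y) + (x \<bullet> x))"
      using assms by (simp add: field_simps)
    also have "(y \<bullet> y) - 2 * (x \<bullet> y) + (x \<bullet> x) = (norm (x - y))\<^sup>2"
      by (simp add: power2_norm_eq_inner inner_diff_left inner_diff_right inner_commute)
    finally show ?thesis
      by (simp add: power_divide power_mult_distrib power2_norm_eq_inner divide_inverse power_inverse)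
  qed
  then show ?thesis
    by (simp add: power2_eq_iff_nonneg)
qed

lemma inversion_has_derivative:
  fixes x :: "'a::real_inner"
  assumes "x \<noteq> 0"
  shows "(inversion has_derivative (\<lambda>h. (h - (2 * (x \<bullet> h) / (norm x)\<^sup>2) *\<^sub>R x) /\<^sub>R (norm x)\<^sup>2)) (at x within S)"
proof -
  have x: "x \<bullet> x \<noteq> 0"
    using assms by simp
  have "((\<lambda>x. inverse (x \<bullet> x) *\<^sub>R x) has_derivative
     (\<lambda>h. inverse (x \<bullet> x) *\<^sub>R h + (- (inverse (x \<bullet> x) * (x \<bullet> h + h \<bullet> x) * inverse (x \<bullet> x))) *\<^sub>R x)) (at x within S)"
    using x by (auto intro!: derivative_eq_intros)
  moreover have "(\<lambda>h. inverse (x \<bullet> x) *\<^sub>R h + (- (inverse (x \<bullet> x) * (x \<bullet> h + h \<bullet> x) * inverse (x \<bullet> x))) *\<^sub>R x) =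
     (\<lambda>h. (h - (2 * (x \<bullet> h) / (norm x)\<^sup>2) *\<^sub>R x) /\<^sub>R (norm x)\<^sup>2)"
    using x by (auto simp: fun_eq_iff power2_norm_eq_inner inner_commute algebra_simps divide_inverse)
  moreover have "(\<lambda>x::'a. inverse (x \<bullet> x) *\<^sub>R x) = inversion"
    by (auto simp: inversion_def power2_norm_eq_inner)
  ultimately show ?thesis by simp
qed

text \<open>The derivative is a reflection in the hyperplane orthogonal to \<open>x\<close>, divided
  by |x|^2. The reflection has determinant of modulus 1, so only the n-th power of the scalar
  remains.\<close>

lemma det_inversion_derivative:
  fixes x :: "real ^ 'n"
  assumes "x \<noteq> 0"
  shows "\<bar>det (matrix (\<lambda>h. (h - (2 * (x \<bullet> h) / (norm x)\<^sup>2) *\<^sub>R x) /\<^sub>R (norm x)\<^sup>2))\<bar> =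
         norm x powr (- 2 * real CARD('n))"
proof -
  define R where "R h = h - (2 * (x \<bullet> h) / (norm x)\<^sup>2) *\<^sub>R x" for h
  have x: "x \<bullet> x \<noteq> 0"
    using assms by simp
  have R: "orthogonal_transformation R"
    unfolding orthogonal_transformation_def
  proof (intro conjI allI)
    show "linear R"
      unfolding R_def by (rule linearI) (auto simp: algebra_simps inner_add_right add_divide_distrib)
    show "R v \<bullet> R w = v \<bullet> w" for v w
      using x by (simp add: R_def inner_diff_left inner_diff_right power2_norm_eq_inner inner_commute)
  qed
  have "(\<lambda>h. (h - (2 * (x \<bullet> h) / (norm x)\<^sup>2) *\<^sub>R x) /\<^sub>R (norm x)\<^sup>2) = (*\<^sub>R) (inverse ((norm x)\<^sup>2)) \<circ> R"
    by (rule ext) (simp add: R_def)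
  moreover have "matrix ((*\<^sub>R) (inverse ((norm x)\<^sup>2)) \<circ> R) = matrix ((*\<^sub>R) (inverse ((norm x)\<^sup>2))) ** matrix R"
    using R by (intro matrix_compose orthogonal_transformation_linear linearI) (simp_all add: algebra_simps)
  ultimately have "\<bar>det (matrix (\<lambda>h. (h - (2 * (x \<bullet> h) / (norm x)\<^sup>2) *\<^sub>R x) /\<^sub>R (norm x)\<^sup>2))\<bar>
       = \<bar>inverse ((norm x)\<^sup>2) ^ CARD('n)\<bar>"
    using orthogonal_transformation_det[OF R] by (simp only: det_mul det_matrix_scaleR abs_mult mult_1_right)
  also have "\<dots> = norm x powr (- 2 * real CARD('n))"
  proof -
    have "norm x powr (- 2 * real CARD('n)) = (norm x powr (- 2)) powr real CARD('n)"
      by (simp add: powr_powr)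
    also have "norm x powr (- 2) = inverse ((norm x)\<^sup>2)"
      using assms by (simp add: powr_minus)
    also have "inverse ((norm x)\<^sup>2) powr real CARD('n) = inverse ((norm x)\<^sup>2) ^ CARD('n)"
      using assms by (intro powr_realpow) simp
    finally show ?thesis
      using assms by simp
  qed
  finally show ?thesis .
qed


text \<open>Phrased as an equality of measures, so that integrability and values of integrals
  transform together for every Borel function. Boxes suffice; the origin, where the inversion is not
  differentiable, is removed as a null set.\<close>

lemma distr_lborel_inversion_wellorder:
  "distr (density lborel (\<lambda>z. ennreal (norm z powr (- 2 * real CARD('n))))) borel inversion
   = (lborel :: (real ^ 'n::{finite,wellorder}) measure)"
proof (rule sym, rule lborel_eqI)
  fix l u :: "real ^ 'n::_"
  assume le: "\<And>b. b \<in> Basis \<Longrightarrow> l \<bullet> b \<le> u \<bullet> b"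
  define S where "S = (inversion -` box l u) - {0}"
  have S_eq: "S = inversion ` (box l u - {0})"
  proof (intro set_eqI iffI)
    fix x assume "x \<in> S"
    then have "inversion x \<in> box l u - {0}" "x = inversion (inversion x)"
      by (auto simp: S_def)
    then show "x \<in> inversion ` (box l u - {0})"
      by blast
  qed (auto simp: S_def)
  have img: "inversion ` S = box l u - {0}"
    unfolding S_eq image_image by simp
  have S_borel: "S \<in> sets borel"
  proof -
    have "inversion -` box l u \<in> sets (borel :: (real ^ 'n::_) measure)"
      using measurable_sets[OF measurable_inversion, of "box l u"] by simp
    then show ?thesis
      unfolding S_def by auto
  qed
  define f where "f z = norm z powr (- 2 * real CARD('n))" for z :: "real ^ 'n::_"
  have "((\<lambda>x. \<bar>det (matrix (\<lambda>h. (h - (2 * (x \<bullet> h) / (norm x)\<^sup>2) *\<^sub>R x) /\<^sub>R (norm x)\<^sup>2))\<bar>)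
     has_integral measure lebesgue (box l u - {0})) S"
  proof (subst has_measure_differentiable_image[symmetric])
    show "S \<in> sets lebesgue"
      using S_borel by simp
    show "inj_on inversion S"
      by (metis inj_onI inversion_inversion)
    show "inversion ` S \<in> lmeasurable \<and> measure lebesgue (inversion ` S) = measure lebesgue (box l u - {0})"
      unfolding img by (simp add: bounded_set_imp_lmeasurable bounded_diff)
    show "(inversion has_derivative (\<lambda>h. (h - (2 * (x \<bullet> h) / (norm x)\<^sup>2) *\<^sub>R x) /\<^sub>R (norm x)\<^sup>2)) (at x within S)"
      if "x \<in> S" for x
      using that by (intro inversion_has_derivative) (auto simp: S_def)
  qed
  then have "(f has_integral measure lebesgue (box l u - {0})) S"
    by (rule has_integral_eq[rotated]) (auto simp: S_def f_def det_inversion_derivative)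
  moreover have "measure lebesgue (box l u - {0}) = (\<Prod>b\<in>Basis. (u - l) \<bullet> b)"
    using le by (simp add: measure_Diff_null_set measure_lborel_box_eq)
  ultimately have "((\<lambda>x. if x \<in> S then f x else 0) has_integral (\<Prod>b\<in>Basis. (u - l) \<bullet> b)) UNIV"
    by (simp add: has_integral_restrict_UNIV)
  moreover have "(\<lambda>x. if x \<in> S then f x else 0) \<in> borel_measurable borel"
    using S_borel unfolding f_def by measurable
  ultimately have *: "(\<integral>\<^sup>+ x. ennreal (if x \<in> S then f x else 0) \<partial>lborel) = (\<Prod>b\<in>Basis. (u - l) \<bullet> b)"
    by (intro nn_integral_has_integral_lborel) (auto simp: f_def)
  have "emeasure (distr (density lborel (\<lambda>z. ennreal (f z))) borel inversion) (box l u)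
     = (\<integral>\<^sup>+ x. ennreal (f x) * indicator (inversion -` box l u) x \<partial>lborel)"
    using measurable_sets[OF measurable_inversion, of "box l u"]
    unfolding f_def by (subst emeasure_distr) (auto simp: emeasure_density)
  also have "\<dots> = (\<integral>\<^sup>+ x. ennreal (if x \<in> S then f x else 0) \<partial>lborel)"
  proof (rule nn_integral_cong_AE)
    show "AE x in lborel. ennreal (f x) * indicator (inversion -` box l u) x = ennreal (if x \<in> S then f x else 0)"
      using AE_lborel_singleton[of 0] by eventually_elim (auto simp: S_def indicator_def)
  qed
  finally show "emeasure (distr (density lborel (\<lambda>z. ennreal (norm z powr (- 2 * real CARD('n))))) borel inversion) (box l u)
     = (\<Prod>b\<in>Basis. (u - l) \<bullet> b)"
    using * by (simp add: f_def)
qed simp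

text \<open>Reindexing along a bijection is a linear isometry and hence commutes with the inversion,
  which carries the well-ordered case over to every finite index type.\<close>

lemma distr_lborel_inversion:
  "distr (density lborel (\<lambda>z. ennreal (norm z powr (- 2 * real CARD('n))))) borel inversion
   = (lborel :: (real ^ 'n) measure)"
proof (rule measure_eqI)
  obtain h :: "'n \<Rightarrow> 'n ord_index" where h: "bij h"
    using finite_same_card_bij[of "UNIV :: 'n set" "UNIV :: 'n ord_index set"] by (auto simp: card_ord_index)
  let ?T = "reindex h"
  have inv: "inversion (?T w) = ?T (inversion w)" for w
    by (simp add: inversion_def norm_reindex[OF h] reindex_scaleR)
  fix A
  assume "A \<in> sets (distr (density lborel (\<lambda>z. ennreal (norm z powr (- 2 * real CARD('n))))) borel (inversion :: real ^ 'n \<Rightarrow> _))"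
  then have A [measurable]: "A \<in> sets borel"
    by simp
  let ?f = "\<lambda>z. ennreal (norm z powr (- 2 * real CARD('n)))"
  have "emeasure (distr (density lborel ?f) borel inversion) A
      = (\<integral>\<^sup>+ x. ?f x * indicator A (inversion x) \<partial>lborel)"
    using measurable_sets[OF measurable_inversion A]
    by (subst emeasure_distr) (auto simp: emeasure_density intro!: nn_integral_cong split: split_indicator)
  also have "\<dots> = (\<integral>\<^sup>+ x. ?f x * indicator A (inversion x) \<partial>distr lborel borel ?T)"
    by (simp add: distr_lborel_reindex[OF h])
  also have "\<dots> = (\<integral>\<^sup>+ w. ennreal (norm w powr (- 2 * real CARD('n ord_index))) * indicator (?T -` A) (inversion w) \<partial>lborel)"
    by (subst nn_integral_distr)
       (auto simp: norm_reindex[OF h] inv card_ord_index intro!: nn_integral_cong split: split_indicator)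
  also have "\<dots> = emeasure (distr (density lborel (\<lambda>z. ennreal (norm z powr (- 2 * real CARD('n ord_index))))) borel inversion) (?T -` A)"
    using measurable_sets[OF measurable_reindex[of h] A]
      measurable_sets[OF measurable_inversion measurable_sets[OF measurable_reindex[of h] A, simplified]]
    by (subst emeasure_distr) (auto simp: emeasure_density intro!: nn_integral_cong split: split_indicator)
  also have "\<dots> = emeasure (distr lborel borel ?T) A"
    unfolding distr_lborel_inversion_wellorder by (subst emeasure_distr) auto
  finally show "emeasure (distr (density lborel ?f) borel inversion) A = emeasure lborel A"
    by (simp add: distr_lborel_reindex[OF h])
qed simp

lemma integrable_inversion_iff:
  fixes f :: "real ^ 'n \<Rightarrow> real"
  assumes [measurable]: "f \<in> borel_measurable borel"
  shows "integrable lborel (\<lambda>z. norm z powr (- 2 * real CARD('n)) * f (inversion z)) \<longleftrightarrow> integrable lborel f"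
  by (subst (2) distr_lborel_inversion[symmetric]) (simp add: integrable_distr_eq integrable_density)

lemma integral_inversion:
  fixes f :: "real ^ 'n \<Rightarrow> real"
  assumes [measurable]: "f \<in> borel_measurable borel"
  shows "(\<integral>z. norm z powr (- 2 * real CARD('n)) * f (inversion z) \<partial>lborel) = (\<integral>z. f z \<partial>lborel)"
  by (subst (2) distr_lborel_inversion[symmetric]) (simp add: integral_distr integral_density)

section \<open>Affine changes of variables and integrability of the weight\<close>

lemma integrable_affine_iff:
  fixes f :: "'a::euclidean_space \<Rightarrow> real"
  assumes [measurable]: "f \<in> borel_measurable borel" and c: "c > 0"
  shows "integrable lborel (\<lambda>z. f (t + c *\<^sub>R z)) \<longleftrightarrow> integrable lborel f"
  using c by (subst (2) lborel_affine[of c t])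
    (auto simp: integrable_distr_eq integrable_density)

lemma integral_affine:
  fixes f :: "'a::euclidean_space \<Rightarrow> real"
  assumes [measurable]: "f \<in> borel_measurable borel" and c: "c > 0"
  shows "(\<integral>z. f z \<partial>lborel) = c ^ DIM('a) * (\<integral>z. f (t + c *\<^sub>R z) \<partial>lborel)"
  using c by (subst lborel_affine[of c t]) (auto simp: integral_distr integral_density)

text \<open>The function is dominated by a series of multiples of indicators of the balls of radius
  2^k. If k > 0 is the first index whose ball contains \<open>z\<close>, then |z| is at least
  2^(k-1), which explains the factor \<open>2 powr s\<close>. The integrals form a geometric series
  of ratio 2^(n-s) < 1.\<close>

lemma integrable_decay:
  fixes s :: real
  assumes s: "s > real DIM('a::euclidean_space)"
  shows "integrable lborel (\<lambda>z::'a. 1 / (1 + norm z powr s))"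
proof -
  define n where "n = DIM('a)"
  define f where "f k z = 2 powr s * 2 powr (- s * real k) * indicat_real (ball 0 (2 ^ k)) z" for k and z :: 'a
  have bound: "f k z \<le> 2 powr s * (2 powr - s) ^ k" for k z
    by (simp add: f_def indicator_def powr_powr flip: powr_realpow)
  have "s > 0"
    using s by (rule le_less_trans[rotated]) simp
  have "2 powr - s < (1::real)"
    using \<open>s > 0\<close> by (simp add: powr_less_one)
  then have summ: "summable (\<lambda>k. norm (f k z))" for z
    by (intro summable_comparison_test[OF _ summable_mult[OF summable_geometric[of "2 powr - s"], of "2 powr s"]])
       (use bound in \<open>auto simp: f_def abs_mult\<close>)
  have int: "(\<integral>z. norm (f k z) \<partial>lborel) = 2 powr s * unit_ball_vol n * (2 powr (n - s)) ^ k" for k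
  proof -
    have "(\<integral>z. norm (f k z) \<partial>lborel) = (\<integral>z. 2 powr s * 2 powr (- s * real k) * indicat_real (ball 0 (2 ^ k)) z \<partial>(lborel :: 'a measure))"
      by (simp add: f_def abs_mult)
    also have "\<dots> = 2 powr s * 2 powr (- s * real k) * (unit_ball_vol n * (2 ^ k) ^ n)"
      by (simp add: content_ball n_def)
    also have "(2 ^ k) ^ n = (2::real) powr (real k * real n)"
      by (simp add: powr_realpow powr_powr flip: powr_realpow)
    also have "2 powr s * 2 powr (- s * real k) * (unit_ball_vol n * 2 powr (real k * real n))
       = 2 powr s * unit_ball_vol n * (2 powr (n - s)) ^ k"
      by (simp add: powr_powr powr_add[symmetric] algebra_simps flip: powr_realpow)
    finally show ?thesis .
  qed
  have "2 powr (n - s) < (1::real)"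
    using s by (simp add: n_def powr_less_one)
  then have summ': "summable (\<lambda>k. \<integral>z. norm (f k z) \<partial>lborel)"
    unfolding int by (intro summable_mult summable_geometric) auto
  have "integrable lborel (\<lambda>z. \<Sum>k. f k z)"
    by (rule integrable_suminf)
      (use summ summ' in \<open>auto simp: f_def emeasure_ball intro!: integrable_real_indicator\<close>)
  then show ?thesis
  proof (rule Bochner_Integration.integrable_bound)
    show "AE z in lborel. norm (1 / (1 + norm z powr s)) \<le> norm (\<Sum>k. f k z)"
    proof (intro AE_I2)
      fix z :: 'a
      have ex: "\<exists>k. norm z < 2 ^ k"
        by (metis one_less_numeral_iff real_arch_pow semiring_norm(76))
      define k where "k = (LEAST k. norm z < 2 ^ k)"
      have k: "norm z < 2 ^ k"
        unfolding k_def using ex by (rule LeastI_ex)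
      have "1 / (1 + norm z powr s) \<le> f k z"
      proof (cases k)
        case 0
        have "1 / (1 + norm z powr s) \<le> 1 / 1"
          by (intro divide_left_mono) (auto intro!: add_pos_nonneg)
        also have "1 / 1 \<le> 2 powr s"
          using \<open>s > 0\<close> by (simp add: ge_one_powr_ge_zero)
        finally show ?thesis
          using 0 k by (simp add: f_def)
      next
        case (Suc j)
        then have "norm z \<ge> 2 ^ j"
          using not_less_Least[of j "\<lambda>k. norm z < 2 ^ k"] by (auto simp: k_def[symmetric])
        then have "norm z powr s \<ge> (2 ^ j) powr s"
          using \<open>s > 0\<close> by (intro powr_mono2) auto
        moreover have "(2 ^ j) powr s = 2 powr (real j * s)"
          by (simp add: powr_powr flip: powr_realpow)
        ultimately have "1 / (1 + norm z powr s) \<le> 1 / 2 powr (real j * s)"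
          by (intro divide_left_mono) (auto intro!: add_nonneg_pos mult_pos_pos)
        also have "\<dots> = 2 powr s * 2 powr (- s * real k)"
          by (simp add: Suc powr_minus_divide[symmetric] powr_add[symmetric] algebra_simps)
        finally show ?thesis
          using k by (simp add: f_def)
      qed
      also have "f k z \<le> (\<Sum>k. f k z)"
      proof -
        have nn: "f k z \<ge> 0" for k
          by (simp add: f_def)
        then have "sum (\<lambda>k. f k z) {k} \<le> (\<Sum>k. f k z)"
          using summ[of z] by (intro sum_le_suminf) auto
        then show ?thesis
          by simp
      qed
      finally show "norm (1 / (1 + norm z powr s)) \<le> norm (\<Sum>k. f k z)"
        by simp
    qed
  qed simp
qed

section \<open>Truncated singular integrals\<close>

lemma frac_const_pos:
  assumes "0 < \<sigma>" "\<sigma> < 1"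
  shows "frac_const k \<sigma> > 0"
  using assms unfolding frac_const_def
  by (intro divide_pos_pos mult_pos_pos Gamma_real_pos) (auto intro: add_nonneg_pos)

text \<open>\<open>s\<close> is the order of the singular kernel and \<open>a\<close> the decay
  exponent of the fundamental solution. The relation a + s = 2n matches them with the Jacobian
  |z|^(-2n) of the inversion. \<open>dim\<close> ties both to the dimension given by a type.\<close>

locale frac =
  fixes \<sigma> a s :: real and dim :: "'n::finite itself"
  assumes \<sigma>: "0 < \<sigma>" "\<sigma> < 1"
    and card_ge: "CARD('n) \<ge> 3"
    and a_def: "a = real CARD('n) - 2 * \<sigma>"
    and s_def: "s = real CARD('n) + 2 * \<sigma>"
begin

lemma a_pos: "a > 0"
  using \<sigma> card_ge by (simp add: a_def)

lemma s_pos: "s > 0"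
  using \<sigma> by (simp add: s_def add_nonneg_pos)

lemma s_gt: "s > real CARD('n)"
  using \<sigma> by (simp add: s_def)

lemma a_plus_s: "2 * real CARD('n) = a + s"
  by (simp add: a_def s_def)

lemma a_lt_s: "a < s"
  using \<sigma> by (simp add: a_def s_def)

text \<open>The Borel counterpart of \<open>L_sigma\<close>: integrability over
  \<open>lborel\<close> includes the Borel measurability that the change of variables formulas ask
  for.\<close>

definition Lint :: "(real ^ 'n \<Rightarrow> real) \<Rightarrow> bool" where
  "Lint w \<longleftrightarrow> integrable lborel (\<lambda>z. w z / (1 + norm z powr s))"

lemma weight_pos: "1 + norm z powr s > 0"
  by (intro add_pos_nonneg) auto

lemma Lint_measurable:
  assumes "Lint w"
  shows "w \<in> borel_measurable borel"
proof -
  have "(\<lambda>z. w z / (1 + norm z powr s)) \<in> borel_measurable lborel"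
    using assms unfolding Lint_def by (rule borel_measurable_integrable)
  then have "(\<lambda>z. (w z / (1 + norm z powr s)) * (1 + norm z powr s)) \<in> borel_measurable borel"
    by (intro borel_measurable_times) (simp, measurable)
  moreover have "(w z / (1 + norm z powr s)) * (1 + norm z powr s) = w z" for z
    using weight_pos[of z] by simp
  ultimately show ?thesis by simp
qed

lemma Lint_const: "Lint (\<lambda>z. c)"
proof -
  have "integrable lborel (\<lambda>z::real ^ 'n. c * (1 / (1 + norm z powr s)))"
    using s_gt by (intro integrable_mult_right integrable_decay) simp
  then show ?thesis
    by (simp add: Lint_def)
qed

lemma Lint_add: "Lint u \<Longrightarrow> Lint v \<Longrightarrow> Lint (\<lambda>z. u z + v z)"
  unfolding Lint_def add_divide_distrib by (rule Bochner_Integration.integrable_add)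

lemma Lint_diff: "Lint u \<Longrightarrow> Lint v \<Longrightarrow> Lint (\<lambda>z. u z - v z)"
  unfolding Lint_def diff_divide_distrib by (rule Bochner_Integration.integrable_diff)

lemma Lint_cmult: "Lint u \<Longrightarrow> Lint (\<lambda>z. c * u z)"
  unfolding Lint_def times_divide_eq_right[symmetric] by (rule integrable_mult_right)

lemma Lint_mult_bounded:
  assumes w: "Lint w" and k: "k \<in> borel_measurable borel"
    and bound: "\<And>z. \<bar>k z\<bar> \<le> C / (1 + norm z powr s)"
  shows "integrable lborel (\<lambda>z. w z * k z)"
proof -
  note [measurable] = Lint_measurable[OF w] k
  have "integrable lborel (\<lambda>z. C * (w z / (1 + norm z powr s)))"
    using w unfolding Lint_def by (rule integrable_mult_right)
  then show ?thesis
  proof (rule Bochner_Integration.integrable_bound)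
    show "AE z in lborel. norm (w z * k z) \<le> norm (C * (w z / (1 + norm z powr s)))"
    proof (intro AE_I2)
      fix z
      have "\<bar>w z\<bar> * \<bar>k z\<bar> \<le> \<bar>w z\<bar> * (C / (1 + norm z powr s))"
        by (intro mult_left_mono bound) auto
      also have "\<dots> \<le> \<bar>C * (w z / (1 + norm z powr s))\<bar>"
        using weight_pos[of z] by (simp add: abs_mult mult.commute mult_right_mono divide_right_mono)
      finally show "norm (w z * k z) \<le> norm (C * (w z / (1 + norm z powr s)))"
        by (simp add: abs_mult)
    qed
  qed measurable
qed

text \<open>On the diagonal the value is 0, by the convention for \<open>powr\<close> at base
  0.\<close>

abbreviation ker :: "real ^ 'n \<Rightarrow> real ^ 'n \<Rightarrow> real" where
  "ker y z \<equiv> norm (y - z) powr - s"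

text \<open>At distance at least \<open>e\<close> from \<open>y\<close>, both 1 and |z| are bounded
  by constants times |y - z|; the two summands of the constant come from these two bounds.\<close>

lemma ker_le_weight:
  assumes "e > 0" "norm (y - z) \<ge> e"
  shows "ker y z \<le> ((1 / e) powr s + (norm y / e + 1) powr s) / (1 + norm z powr s)"
proof -
  let ?d = "norm (y - z)"
  have d: "?d > 0"
    using assms by linarith
  have "1 \<le> (1 / e) * ?d"
    using assms by (simp add: field_simps)
  then have "1 powr s \<le> ((1 / e) * ?d) powr s"
    using s_pos by (intro powr_mono2) auto
  then have 1: "1 \<le> (1 / e) powr s * ?d powr s"
    by (simp only: powr_mult powr_one_eq_one)
  have "norm z \<le> norm y + ?d"
    by (metis norm_triangle_sub norm_minus_commute)
  also have "\<dots> \<le> (norm y / e) * ?d + ?d"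
    using mult_left_mono[of e ?d "norm y"] assms by (simp add: field_simps)
  finally have "norm z \<le> (norm y / e + 1) * ?d"
    by (simp add: algebra_simps)
  then have "norm z powr s \<le> ((norm y / e + 1) * ?d) powr s"
    using s_pos by (intro powr_mono2) auto
  also have "\<dots> = (norm y / e + 1) powr s * ?d powr s"
    using assms by (intro powr_mult) 
  finally have 2: "norm z powr s \<le> (norm y / e + 1) powr s * ?d powr s" .
  have "1 + norm z powr s \<le> ((1 / e) powr s + (norm y / e + 1) powr s) * ?d powr s"
    using 1 2 by (simp add: algebra_simps)
  then show ?thesis
    using weight_pos[of z] d by (simp add: powr_minus field_simps)
qed

lemma Lint_mult_ker:
  assumes w: "Lint w" and S: "S \<in> sets borel" and "e > 0" and "\<And>z. z \<in> S \<Longrightarrow> norm (y - z) \<ge> e"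
  shows "integrable lborel (\<lambda>z. indicator S z * (w z * ker y z))"
proof -
  have "integrable lborel (\<lambda>z. w z * (indicator S z * ker y z))"
  proof (rule Lint_mult_bounded[OF w])
    show "(\<lambda>z. indicator S z * ker y z) \<in> borel_measurable borel"
      using S by measurable
    fix z
    show "\<bar>indicator S z * ker y z\<bar> \<le> ((1 / e) powr s + (norm y / e + 1) powr s) / (1 + norm z powr s)"
      using ker_le_weight[OF \<open>e > 0\<close>, of y z] assms(4)[of z] weight_pos[of z]
      by (auto simp: indicator_def abs_mult)
  qed
  then show ?thesis
    by (simp add: ac_simps)
qed

definition trunc :: "(real ^ 'n \<Rightarrow> real) \<Rightarrow> real ^ 'n \<Rightarrow> real \<Rightarrow> real" where
  "trunc g y e = (\<integral>z. indicator (- ball y e) z * (g z * ker y z) \<partial>lborel)"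

text \<open>The factor \<open>frac_const\<close> is left out here; it is later absorbed into the
  coefficients of the system.\<close>

definition PV :: "(real ^ 'n \<Rightarrow> real) \<Rightarrow> real ^ 'n \<Rightarrow> real \<Rightarrow> bool" where
  "PV g y l \<longleftrightarrow> (trunc g y \<longlongrightarrow> l) (at_right 0)"

lemma integrable_trunc:
  assumes "Lint w" "e > 0"
  shows "integrable lborel (\<lambda>z. indicator (- ball y e) z * (w z * ker y z))"
  by (rule Lint_mult_ker[OF assms(1) _ assms(2)]) (auto simp: dist_norm)

lemma trunc_add:
  assumes "Lint g" "Lint h" "e > 0"
  shows "trunc (\<lambda>z. g z + h z) y e = trunc g y e + trunc h y e"
  unfolding trunc_def distrib_left distrib_right
  by (intro Bochner_Integration.integral_add integrable_trunc assms)

lemma trunc_cmult: "trunc (\<lambda>z. c * g z) y e = c * trunc g y e"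
proof -
  have "trunc (\<lambda>z. c * g z) y e = (\<integral>z. c * (indicator (- ball y e) z * (g z * ker y z)) \<partial>lborel)"
    unfolding trunc_def by (simp add: ac_simps)
  then show ?thesis
    by (simp add: trunc_def)
qed

lemma PV_cmult: "PV g y l \<Longrightarrow> PV (\<lambda>z. c * g z) y (c * l)"
  unfolding PV_def trunc_cmult by (rule tendsto_mult_left)

lemma PV_add:
  assumes "PV g y l" "PV h y m" "Lint g" "Lint h"
  shows "PV (\<lambda>z. g z + h z) y (l + m)"
proof -
  have "((\<lambda>e. trunc g y e + trunc h y e) \<longlongrightarrow> l + m) (at_right 0)"
    using assms unfolding PV_def by (intro tendsto_add) auto
  moreover have "\<forall>\<^sub>F e in at_right 0. trunc g y e + trunc h y e = trunc (\<lambda>z. g z + h z) y e"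
    using trunc_add[OF assms(3,4)] by (auto simp: eventually_at_filter)
  ultimately show ?thesis
    unfolding PV_def by (rule Lim_transform_eventually)
qed

lemma has_frac_iff_PV:
  assumes u: "Lint u"
  shows "has_frac_laplacian \<sigma> u y L \<longleftrightarrow> PV (\<lambda>z. u y - u z) y (L / frac_const CARD('n) \<sigma>)"
proof -
  let ?c = "frac_const CARD('n) \<sigma>"
  note [measurable] = Lint_measurable[OF u]
  have c: "?c > 0"
    by (rule frac_const_pos[OF \<sigma>])
  have eq: "(LINT z:UNIV - ball y e|lebesgue. (u y - u z) / norm (y - z) powr (real CARD('n) + 2 * \<sigma>))
      = trunc (\<lambda>z. u y - u z) y e" for e
  proof -
    have [measurable]: "UNIV - ball y e \<in> sets borel"
      by auto
    have "(\<lambda>z. indicator (UNIV - ball y e) z *\<^sub>R ((u y - u z) / norm (y - z) powr s)) \<in> borel_measurable lborel"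
      by measurable
    then show ?thesis
      unfolding set_lebesgue_integral_def trunc_def s_def[symmetric] Compl_eq_Diff_UNIV
      by (subst integral_completion) (simp_all add: powr_minus divide_inverse)
  qed
  have "((\<lambda>e. ?c * trunc (\<lambda>z. u y - u z) y e) \<longlongrightarrow> L) (at_right 0) \<longleftrightarrow>
        ((\<lambda>e. trunc (\<lambda>z. u y - u z) y e) \<longlongrightarrow> L / ?c) (at_right 0)"
  proof
    assume "((\<lambda>e. ?c * trunc (\<lambda>z. u y - u z) y e) \<longlongrightarrow> L) (at_right 0)"
    then have "((\<lambda>e. (1 / ?c) * (?c * trunc (\<lambda>z. u y - u z) y e)) \<longlongrightarrow> (1 / ?c) * L) (at_right 0)"
      by (rule tendsto_mult_left)
    then show "((\<lambda>e. trunc (\<lambda>z. u y - u z) y e) \<longlongrightarrow> L / ?c) (at_right 0)"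
      using c by simp
  next
    assume "((\<lambda>e. trunc (\<lambda>z. u y - u z) y e) \<longlongrightarrow> L / ?c) (at_right 0)"
    then have "((\<lambda>e. ?c * trunc (\<lambda>z. u y - u z) y e) \<longlongrightarrow> ?c * (L / ?c)) (at_right 0)"
      by (rule tendsto_mult_left)
    then show "((\<lambda>e. ?c * trunc (\<lambda>z. u y - u z) y e) \<longlongrightarrow> L) (at_right 0)"
      using c by simp
  qed
  then show ?thesis
    unfolding has_frac_laplacian_def eq PV_def .
qed

text \<open>Only the unit sphere occurs; other centres and radii are reduced to it by affine maps.
  At the origin the value is 0, again by the convention for \<open>powr\<close>.\<close>

definition kelvin :: "(real ^ 'n \<Rightarrow> real) \<Rightarrow> real ^ 'n \<Rightarrow> real" where
  "kelvin u z = norm z powr (- a) * u (inversion z)"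

text \<open>The weighted space is invariant because |z|^(-2n) = |z|^(-a) |z|^(-s): the first factor
  builds the Kelvin transform, the second turns the inverted weight back into the weight
  itself.\<close>

lemma Lint_kelvin:
  assumes u: "Lint u"
  shows "Lint (kelvin u)"
proof -
  note [measurable] = Lint_measurable[OF u]
  have "norm z powr (- 2 * real CARD('n)) * (u (inversion z) / (1 + norm (inversion z) powr s)) =
        kelvin u z / (1 + norm z powr s)" for z :: "real ^ 'n"
  proof (cases "z = 0")
    case False
    then have "1 + norm (inversion z) powr s = norm z powr - s * (1 + norm z powr s)"
      by (simp add: powr_divide powr_minus field_simps)
    moreover have "norm z powr (- 2 * real CARD('n)) = norm z powr - a * norm z powr - s"
      using a_plus_s by (simp add: powr_add[symmetric])
    ultimately show ?thesis
      using False by (simp add: kelvin_def)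
  qed (simp add: kelvin_def)
  then show ?thesis
    using u integrable_inversion_iff[of "\<lambda>z. u z / (1 + norm z powr s)"] by (simp add: Lint_def)
qed

end

section \<open>Kelvin transform and fundamental solution\<close>

text \<open>The preimage under the inversion of a ball about \<open>inversion y\<close>. It is what
  a truncation at the inverted point excludes, and it is in general not centred at
  \<open>y\<close>.\<close>

abbreviation inv_ball :: "'a::real_inner \<Rightarrow> real \<Rightarrow> 'a set" where
  "inv_ball y r \<equiv> {z. norm (inversion y - inversion z) < r}"

text \<open>A bound with one endpoint fixed at \<open>y\<close>; it makes two slightly different
  truncations about \<open>y\<close> comparable.\<close>

definition lipschitz_at :: "('a::real_normed_vector \<Rightarrow> real) \<Rightarrow> 'a \<Rightarrow> bool" where
  "lipschitz_at g y \<longleftrightarrow> (\<exists>C r. r > 0 \<and> (\<forall>z. norm (z - y) < r \<longrightarrow> \<bar>g z - g y\<bar> \<le> C * norm (z - y)))"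

lemma differentiable_imp_lipschitz_at:
  fixes g :: "'a::real_normed_vector \<Rightarrow> real"
  assumes "g differentiable (at y)"
  shows "lipschitz_at g y"
proof -
  obtain g' where g': "(g has_derivative g') (at y)"
    using assms by (auto simp: differentiable_def)
  then obtain K where K: "\<And>h. norm (g' h) \<le> norm h * K"
    using bounded_linear.bounded[OF has_derivative_bounded_linear] by blast
  obtain d where d: "d > 0" "\<And>z. norm (z - y) < d \<Longrightarrow> norm (g z - g y - g' (z - y)) \<le> 1 * norm (z - y)"
    using g' unfolding has_derivative_at_alt by (metis zero_less_one)
  have "\<bar>g z - g y\<bar> \<le> (1 + K) * norm (z - y)" if "norm (z - y) < d" for z
    using d(2)[OF that] K[of "z - y"] by (simp add: algebra_simps)
  then show ?thesis
    unfolding lipschitz_at_def using d(1) by blast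
qed

context frac
begin

lemma annulus_volume:
  assumes "0 \<le> r" "r \<le> R"
  shows "(\<integral>z. indicator (ball y R - ball y r) z \<partial>(lborel :: (real ^ 'n) measure))
       = unit_ball_vol (real CARD('n)) * (R ^ CARD('n) - r ^ CARD('n))"
proof -
  have "measure lborel (ball y R - ball y r) = measure lborel (ball y R) - measure lborel (ball y r)"
    using assms by (intro measure_Diff) (auto simp: emeasure_ball)
  then show ?thesis
    using assms by (simp add: content_ball algebra_simps)
qed

text \<open>The two excluded neighbourhoods differ by a set of measure \<open>O(\<epsilon>\<^sup>n\<^sup>+\<^sup>1)\<close>, on which the integrand is
  \<open>O(\<epsilon>\<^sup>1\<^sup>-\<^sup>s)\<close>, so that the truncated integrals differ by \<open>O(\<epsilon>\<^sup>2\<^sup>-\<^sup>2\<^sup>\<sigma>)\<close>.\<close>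

lemma trunc_domain:
  fixes D :: "real \<Rightarrow> (real ^ 'n) set"
  assumes g: "Lint g" "g y = 0" "lipschitz_at g y"
    and k: "k \<ge> 0"
    and D: "\<And>\<epsilon>. D \<epsilon> \<in> sets borel"
    and inner: "\<forall>\<^sub>F \<epsilon> in at_right 0. ball y (\<epsilon> / (1 + k * \<epsilon>)) \<subseteq> D \<epsilon>"
    and outer: "\<forall>\<^sub>F \<epsilon> in at_right 0. D \<epsilon> \<subseteq> ball y (\<epsilon> / (1 - k * \<epsilon>))"
  shows "((\<lambda>\<epsilon>. (\<integral>z. indicator (- D \<epsilon>) z * (g z * ker y z) \<partial>lborel) - trunc g y \<epsilon>) \<longlongrightarrow> 0) (at_right 0)"
proof -
  obtain C r where r: "r > 0" and C': "\<And>z. norm (z - y) < r \<Longrightarrow> \<bar>g z\<bar> \<le> C * norm (z - y)"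
    using g(2,3) unfolding lipschitz_at_def by auto
  define n where "n = CARD('n)"
  define \<omega> where "\<omega> = unit_ball_vol (real n)"
  define C1 where "C1 = max C 0"
  have C: "\<bar>g z\<bar> \<le> C1 * norm (z - y)" if "norm (z - y) < r" for z
    using C'[OF that] mult_right_mono[of C C1 "norm (z - y)"] by (auto simp: C1_def)
  \<comment> \<open>\<epsilon>^n times \<open>Q \<epsilon>\<close> is the difference of the n-th
    powers of the two radii. \<open>Q\<close> vanishes at 0 with derivative 2nk, and this is the
    extra power of \<epsilon> that makes the error vanish.\<close>
  define Q where "Q \<epsilon> = (1 / (1 - k * \<epsilon>)) ^ n - (1 / (1 + k * \<epsilon>)) ^ n" for \<epsilon> :: real
  have Q': "(Q has_real_derivative 2 * real n * k) (at 0)"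
    unfolding Q_def by (auto intro!: derivative_eq_intros)
  then have "((\<lambda>\<epsilon>. Q \<epsilon> / \<epsilon>) \<longlongrightarrow> 2 * real n * k) (at 0)"
    unfolding has_field_derivative_iff by (simp add: Q_def)
  then have Qlim: "((\<lambda>\<epsilon>. Q \<epsilon> / \<epsilon>) \<longlongrightarrow> 2 * real n * k) (at_right 0)"
    by (rule filterlim_mono) (auto simp: at_le)
  have pw: "((\<lambda>\<epsilon>. \<epsilon> powr (2 - 2 * \<sigma>)) \<longlongrightarrow> 0) (at_right 0)"
    using \<sigma> by (intro tendsto_eq_intros | simp add: eventually_at_filter)+
  define R where "R \<epsilon> = C1 * 2 * 2 powr s * \<omega> * (\<epsilon> powr (2 - 2 * \<sigma>) * (Q \<epsilon> / \<epsilon>))" for \<epsilon>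
  have Rlim: "(R \<longlongrightarrow> 0) (at_right 0)"
    unfolding R_def using tendsto_mult_left[OF tendsto_mult[OF pw Qlim], of "C1 * 2 * 2 powr s * \<omega>"] by simp
  \<comment> \<open>The condition \<open>k * \<epsilon> \<le> 1 / 2\<close> keeps both radii between
    \<epsilon>/2 and 2\<epsilon>, and \<open>2 * \<epsilon> < r\<close> keeps the shell inside the
    range of the Lipschitz bound.\<close>
  have small: "\<forall>\<^sub>F \<epsilon> in at_right 0. 0 < \<epsilon> \<and> k * \<epsilon> \<le> 1 / 2 \<and> 2 * \<epsilon> < r"
  proof -
    define e0 where "e0 = min (1 / (2 * (k + 1))) (r / 2)"
    have "e0 > 0"
      using r k by (simp add: e0_def)
    then show ?thesis
      unfolding eventually_at_right_field
    proof (intro exI[of _ e0] conjI allI impI)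
      fix \<epsilon> assume e: "0 < \<epsilon>" "\<epsilon> < e0"
      have "k * \<epsilon> \<le> (k + 1) * (1 / (2 * (k + 1)))"
        using k e by (intro mult_mono) (auto simp: e0_def)
      also have "\<dots> = 1 / 2"
        using k by (simp add: field_simps)
      finally show "k * \<epsilon> \<le> 1 / 2" .
      show "2 * \<epsilon> < r"
        using e by (simp add: e0_def)
    qed auto
  qed
  show ?thesis
  proof (rule Lim_null_comparison[OF _ Rlim])
    show "\<forall>\<^sub>F \<epsilon> in at_right 0.
       norm ((\<integral>z. indicator (- D \<epsilon>) z * (g z * ker y z) \<partial>lborel) - trunc g y \<epsilon>) \<le> R \<epsilon>"
      using small inner outer
    proof eventually_elim
      case (elim \<epsilon>)
      then have e: "0 < \<epsilon>" "k * \<epsilon> \<le> 1 / 2" "2 * \<epsilon> < r"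
        and DI: "ball y (\<epsilon> / (1 + k * \<epsilon>)) \<subseteq> D \<epsilon>" and DO: "D \<epsilon> \<subseteq> ball y (\<epsilon> / (1 - k * \<epsilon>))"
        by auto
      define ri where "ri = \<epsilon> / (1 + k * \<epsilon>)"
      define ro where "ro = \<epsilon> / (1 - k * \<epsilon>)"
      have ke: "k * \<epsilon> \<ge> 0"
        using k e by simp
      have ri: "\<epsilon> / 2 \<le> ri" "ri \<le> \<epsilon>"
        using e ke by (auto simp: ri_def field_simps)
      have ro: "\<epsilon> \<le> ro" "ro \<le> 2 * \<epsilon>"
        using e ke by (auto simp: ro_def field_simps)
      have int1: "integrable lborel (\<lambda>z. indicator (- D \<epsilon>) z * (g z * ker y z))"
        using DI D ri e by (intro Lint_mult_ker[OF g(1), where e=ri])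
           (auto simp: ri_def[symmetric] dist_norm subset_iff not_less)
      have int2: "integrable lborel (\<lambda>z. indicator (- ball y \<epsilon>) z * (g z * ker y z))"
        using g(1) e(1) by (rule integrable_trunc)
      define M where "M = C1 * (2 * \<epsilon>) * (\<epsilon> / 2) powr - s"
      have bound: "\<bar>indicator (- D \<epsilon>) z * (g z * ker y z) - indicator (- ball y \<epsilon>) z * (g z * ker y z)\<bar>
          \<le> M * indicator (ball y ro - ball y ri) z" for z
      proof (cases "z \<in> ball y ro - ball y ri")
        case True
        then have d: "norm (y - z) < ro" "ri \<le> norm (y - z)"
          by (auto simp: dist_norm)
        have "\<bar>indicator (- D \<epsilon>) z * (g z * ker y z) - indicator (- ball y \<epsilon>) z * (g z * ker y z)\<bar> \<le> \<bar>g z\<bar> * ker y z"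
          by (auto simp: indicator_def abs_mult)
        also have "\<dots> \<le> (C1 * (2 * \<epsilon>)) * (\<epsilon> / 2) powr - s"
        proof (rule mult_mono)
          have "\<bar>g z\<bar> \<le> C1 * norm (z - y)"
            using d ro e by (intro C) (auto simp: norm_minus_commute)
          also have "\<dots> \<le> C1 * (2 * \<epsilon>)"
            using d ro by (intro mult_left_mono) (auto simp: norm_minus_commute C1_def)
          finally show "\<bar>g z\<bar> \<le> C1 * (2 * \<epsilon>)" .
          show "ker y z \<le> (\<epsilon> / 2) powr - s"
            using d ri e s_pos by (intro powr_mono2') auto
        qed (use e in \<open>auto simp: C1_def\<close>)
        finally show ?thesis
          using True by (simp add: M_def)
      next
        case False
        then have "z \<in> D \<epsilon> \<longleftrightarrow> z \<in> ball y \<epsilon>"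
          using DI DO ri ro by (auto simp: ri_def[symmetric] ro_def[symmetric])
        then show ?thesis
          using False by (auto simp: indicator_def)
      qed
      have intM: "integrable lborel (\<lambda>z. M * indicat_real (ball y ro - ball y ri) z)"
      proof -
        have "emeasure lborel (ball y ro - ball y ri) \<le> emeasure lborel (ball y ro)"
          by (intro emeasure_mono) auto
        also have "\<dots> < \<infinity>"
          using ro e by (subst emeasure_ball) auto
        finally show ?thesis
          by (intro integrable_mult_right integrable_real_indicator) auto
      qed
      have "norm ((\<integral>z. indicator (- D \<epsilon>) z * (g z * ker y z) \<partial>lborel) - trunc g y \<epsilon>)
         = norm (\<integral>z. indicator (- D \<epsilon>) z * (g z * ker y z) - indicator (- ball y \<epsilon>) z * (g z * ker y z) \<partial>lborel)"
        unfolding trunc_def using int1 int2 by simp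
      also have "\<dots> \<le> (\<integral>z. M * indicat_real (ball y ro - ball y ri) z \<partial>lborel)"
        using int1 int2 intM bound
        by (intro order_trans[OF integral_norm_bound integral_mono]) (auto simp del: mult_eq_0_iff)
      also have "\<dots> = M * (\<omega> * (ro ^ n - ri ^ n))"
        using ri ro e annulus_volume[of ri ro y] by (simp add: \<omega>_def n_def)
      also have "\<dots> = R \<epsilon>"
      proof -
        have q1: "ro ^ n - ri ^ n = \<epsilon> ^ n * Q \<epsilon>"
          by (simp add: ro_def ri_def Q_def power_divide algebra_simps)
        have q2: "(\<epsilon> / 2) powr - s = 2 powr s * \<epsilon> powr - s"
          using e by (simp add: powr_divide powr_minus field_simps)
        have q3: "\<epsilon> * \<epsilon> powr - s * \<epsilon> ^ n = \<epsilon> powr (2 - 2 * \<sigma>) / \<epsilon>"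
          using e by (simp add: s_def n_def powr_diff powr_minus powr_add powr_realpow power2_eq_square field_simps)
        have "M * (\<omega> * (ro ^ n - ri ^ n)) = C1 * 2 * 2 powr s * \<omega> * Q \<epsilon> * (\<epsilon> * \<epsilon> powr - s * \<epsilon> ^ n)"
          unfolding M_def q1 q2 by (simp only: mult_ac)
        then show ?thesis
          unfolding q3 by (simp add: R_def)
      qed
      finally show ?case .
    qed
  qed
qed

text \<open>Exact for every truncation; only the excluded set changes shape. The Jacobian |z|^(-2n)
  and the factor |z|^s from the kernel combine to |z|^(-a), the factor of the Kelvin
  transform.\<close>

lemma trunc_inversion:
  assumes h: "Lint h" and y: "y \<noteq> 0"
  shows "trunc h (inversion y) \<epsilon> = norm y powr s *
     (\<integral>z. indicator (- inv_ball y \<epsilon>) z * (kelvin h z * ker y z) \<partial>lborel)"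
proof -
  note [measurable] = Lint_measurable[OF h]
  let ?f = "\<lambda>z. indicator (- ball (inversion y) \<epsilon>) z * (h z * ker (inversion y) z)"
  have "trunc h (inversion y) \<epsilon> = (\<integral>z. norm z powr (- 2 * real CARD('n)) * ?f (inversion z) \<partial>lborel)"
    unfolding trunc_def by (rule integral_inversion[symmetric]) measurable
  also have "(\<lambda>z. norm z powr (- 2 * real CARD('n)) * ?f (inversion z)) =
     (\<lambda>z. norm y powr s * (indicator (- inv_ball y \<epsilon>) z * (kelvin h z * ker y z)))"
  proof
    fix z :: "real ^ 'n"
    show "norm z powr (- 2 * real CARD('n)) * ?f (inversion z) =
       norm y powr s * (indicator (- inv_ball y \<epsilon>) z * (kelvin h z * ker y z))"
    proof (cases "z = 0")
      case False
      have "ker (inversion y) (inversion z) = norm y powr s * norm z powr s * ker y z"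
        using y False by (simp add: dist_inversion powr_divide powr_mult powr_minus field_simps)
      moreover have "norm z powr (- 2 * real CARD('n)) * norm z powr s = norm z powr - a"
        using False a_plus_s by (simp add: powr_add[symmetric])
      ultimately show ?thesis
        by (auto simp: kelvin_def dist_norm indicator_def)
    qed (simp add: kelvin_def)
  qed
  finally show ?thesis by simp
qed

text \<open>The inversion scales |y - z| by 1/(|y| |z|), and |z| differs from |y| by at most |y -
  z|. Hence a ball of radius \<epsilon>/|y|^2 about \<open>inversion y\<close> corresponds to radius
  \<epsilon> about \<open>y\<close> up to a relative error governed by \<epsilon>/|y|. This and the
  outer inclusion feed \<open>trunc_domain\<close> with k = 1/|y|.\<close>

lemma inversion_ball_inner:
  assumes y: "y \<noteq> 0" and e: "0 < \<epsilon>" "\<epsilon> < norm y"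
  shows "ball y (\<epsilon> / (1 + 1 / norm y * \<epsilon>)) \<subseteq> inv_ball y (\<epsilon> / (norm y)\<^sup>2)"
proof
  fix z assume "z \<in> ball y (\<epsilon> / (1 + 1 / norm y * \<epsilon>))"
  then have "norm (y - z) < \<epsilon> / (1 + 1 / norm y * \<epsilon>)"
    by (simp add: dist_norm)
  moreover have "1 + 1 / norm y * \<epsilon> > 0"
    using y e by (intro add_pos_nonneg) auto
  ultimately have *: "norm (y - z) * (1 + \<epsilon> / norm y) < \<epsilon>"
    by (simp add: field_simps)
  have "norm (y - z) * 1 \<le> norm (y - z) * (1 + \<epsilon> / norm y)"
    using e by (intro mult_left_mono) auto
  then have lt: "norm (y - z) < norm y"
    using * e by linarith
  then have z: "z \<noteq> 0" by auto
  have "norm (y - z) * norm y < \<epsilon> * (norm y - norm (y - z))"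
    using * y by (simp add: field_simps)
  also have "\<dots> \<le> \<epsilon> * norm z"
    using e norm_triangle_ineq[of "y - z" z] by (intro mult_left_mono) auto
  finally show "z \<in> inv_ball y (\<epsilon> / (norm y)\<^sup>2)"
    using y z by (simp add: dist_inversion power2_eq_square field_simps)
qed

lemma inversion_ball_outer:
  assumes y: "y \<noteq> 0" and e: "0 < \<epsilon>" "\<epsilon> < norm y"
  shows "inv_ball y (\<epsilon> / (norm y)\<^sup>2) \<subseteq> ball y (\<epsilon> / (1 - 1 / norm y * \<epsilon>))"
proof
  fix z assume *: "z \<in> inv_ball y (\<epsilon> / (norm y)\<^sup>2)"
  have z: "z \<noteq> 0"
  proof
    assume "z = 0"
    then have "1 / norm y < \<epsilon> / (norm y)\<^sup>2"
      using * by simp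
    then show False
      using e y by (simp add: power2_eq_square field_simps)
  qed
  have "norm (y - z) * norm y < \<epsilon> * norm z"
    using * y z by (simp add: dist_inversion power2_eq_square field_simps)
  also have "\<dots> \<le> \<epsilon> * (norm y + norm (y - z))"
    using e norm_triangle_ineq4[of y "y - z"] by (intro mult_left_mono) auto
  finally have "norm (y - z) * (norm y - \<epsilon>) < \<epsilon> * norm y"
    by (simp add: algebra_simps)
  then show "z \<in> ball y (\<epsilon> / (1 - 1 / norm y * \<epsilon>))"
    using e y by (simp add: dist_norm field_simps)
qed

lemma trunc_inversion_tendsto:
  assumes g: "Lint g" "g y = 0" "lipschitz_at g y" and y: "y \<noteq> 0"
  shows "((\<lambda>\<epsilon>. (\<integral>z. indicator (- inv_ball y (\<epsilon> / (norm y)\<^sup>2)) z * (g z * ker y z) \<partial>lborel)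
     - trunc g y \<epsilon>) \<longlongrightarrow> 0) (at_right 0)"
proof (rule trunc_domain[OF g, where k = "1 / norm y"])
  have ev: "\<forall>\<^sub>F \<epsilon> in at_right 0. 0 < \<epsilon> \<and> \<epsilon> < norm y"
    using y by (auto simp: eventually_at_right_field intro!: exI[of _ "norm y"])
  show "\<forall>\<^sub>F \<epsilon> in at_right 0. ball y (\<epsilon> / (1 + 1 / norm y * \<epsilon>)) \<subseteq> inv_ball y (\<epsilon> / (norm y)\<^sup>2)"
    using ev by eventually_elim (use y inversion_ball_inner in blast)
  show "\<forall>\<^sub>F \<epsilon> in at_right 0. inv_ball y (\<epsilon> / (norm y)\<^sup>2) \<subseteq> ball y (\<epsilon> / (1 - 1 / norm y * \<epsilon>))"
    using ev by eventually_elim (use y inversion_ball_outer in blast)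
qed (use y in auto)

lemma filterlim_scale_at_right:
  "c > 0 \<Longrightarrow> filterlim (\<lambda>\<epsilon>. c * \<epsilon>) (at_right 0) (at_right (0::real))"
  using filterlim_times_pos[OF filterlim_ident, of c 0 0] by simp

text \<open>Restricted to functions vanishing at the inverted point, so that the distortion of the
  excluded ball is negligible. Running the truncation radius as \<epsilon>/|y|^2 makes the distorted
  ball comparable to the ball of radius \<epsilon> about \<open>y\<close>.\<close>

lemma PV_kelvin:
  assumes h: "Lint h" "PV h (inversion y) l" "h (inversion y) = 0" "lipschitz_at (kelvin h) y" and y: "y \<noteq> 0"
  shows "PV (kelvin h) y (norm y powr - s * l)"
proof -
  let ?I = "\<lambda>\<epsilon>. (\<integral>z. indicator (- inv_ball y (\<epsilon> / (norm y)\<^sup>2)) z * (kelvin h z * ker y z) \<partial>lborel)"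
  have "((\<lambda>\<epsilon>. trunc h (inversion y) (1 / (norm y)\<^sup>2 * \<epsilon>)) \<longlongrightarrow> l) (at_right 0)"
    using h(2) unfolding PV_def
    by (rule filterlim_compose) (use y in \<open>intro filterlim_scale_at_right, auto\<close>)
  then have "((\<lambda>\<epsilon>. norm y powr - s * trunc h (inversion y) (1 / (norm y)\<^sup>2 * \<epsilon>)) \<longlongrightarrow> norm y powr - s * l) (at_right 0)"
    by (rule tendsto_mult_left)
  moreover have "norm y powr - s * trunc h (inversion y) (1 / (norm y)\<^sup>2 * \<epsilon>) = ?I \<epsilon>" for \<epsilon>
    using y by (subst trunc_inversion[OF h(1) y]) (simp add: powr_minus)
  ultimately have "(?I \<longlongrightarrow> norm y powr - s * l) (at_right 0)"
    by simp
  moreover have "((\<lambda>\<epsilon>. ?I \<epsilon> - trunc (kelvin h) y \<epsilon>) \<longlongrightarrow> 0) (at_right 0)"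
  proof (intro trunc_inversion_tendsto Lint_kelvin h y)
    show "kelvin h y = 0"
      using h(3) by (simp add: kelvin_def)
  qed
  ultimately have "((\<lambda>\<epsilon>. ?I \<epsilon> - (?I \<epsilon> - trunc (kelvin h) y \<epsilon>)) \<longlongrightarrow> norm y powr - s * l - 0) (at_right 0)"
    by (rule tendsto_diff)
  then show ?thesis
    by (simp add: PV_def)
qed

section \<open>Principal values under translations and dilations\<close>

lemma trunc_affine:
  assumes h: "Lint h" and c: "c > 0"
  shows "trunc h (x + c *\<^sub>R y) (c * \<epsilon>) = c powr (- 2 * \<sigma>) * trunc (\<lambda>z. h (x + c *\<^sub>R z)) y \<epsilon>"
proof -
  note [measurable] = Lint_measurable[OF h]
  let ?f = "\<lambda>z. indicator (- ball (x + c *\<^sub>R y) (c * \<epsilon>)) z * (h z * ker (x + c *\<^sub>R y) z)"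
  have nrm: "norm (x + c *\<^sub>R y - (x + c *\<^sub>R z)) = c * norm (y - z)" for z
    using c by (simp add: algebra_simps flip: scaleR_diff_right)
  have "trunc h (x + c *\<^sub>R y) (c * \<epsilon>) = c ^ DIM(real ^ 'n) * (\<integral>z. ?f (x + c *\<^sub>R z) \<partial>lborel)"
    unfolding trunc_def using c by (intro integral_affine) measurable
  also have "(\<lambda>z. ?f (x + c *\<^sub>R z)) = (\<lambda>z. c powr - s * (indicator (- ball y \<epsilon>) z * (h (x + c *\<^sub>R z) * ker y z)))"
  proof
    fix z
    have "x + c *\<^sub>R z \<in> ball (x + c *\<^sub>R y) (c * \<epsilon>) \<longleftrightarrow> z \<in> ball y \<epsilon>"
      unfolding mem_ball dist_norm nrm using c by simp
    moreover have "ker (x + c *\<^sub>R y) (x + c *\<^sub>R z) = c powr - s * ker y z"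
      unfolding nrm by (rule powr_mult)
    ultimately show "?f (x + c *\<^sub>R z) = c powr - s * (indicator (- ball y \<epsilon>) z * (h (x + c *\<^sub>R z) * ker y z))"
      by (simp add: indicator_def)
  qed
  also have "c ^ DIM(real ^ 'n) * (\<integral>z. c powr - s * (indicator (- ball y \<epsilon>) z * (h (x + c *\<^sub>R z) * ker y z)) \<partial>lborel)
      = (c powr real CARD('n) * c powr - s) * trunc (\<lambda>z. h (x + c *\<^sub>R z)) y \<epsilon>"
    using c by (simp add: trunc_def powr_realpow)
  also have "c powr real CARD('n) * c powr - s = c powr (- 2 * \<sigma>)"
    by (simp add: powr_add[symmetric] s_def)
  finally show ?thesis .
qed

lemma PV_affine:
  assumes h: "Lint h" and c: "c > 0" and PV: "PV h (x + c *\<^sub>R y) l"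
  shows "PV (\<lambda>z. h (x + c *\<^sub>R z)) y (c powr (2 * \<sigma>) * l)"
proof -
  have "((\<lambda>\<epsilon>. trunc h (x + c *\<^sub>R y) (c * \<epsilon>)) \<longlongrightarrow> l) (at_right 0)"
    using PV unfolding PV_def by (rule filterlim_compose) (intro filterlim_scale_at_right c)
  then have "((\<lambda>\<epsilon>. c powr (2 * \<sigma>) * trunc h (x + c *\<^sub>R y) (c * \<epsilon>)) \<longlongrightarrow> c powr (2 * \<sigma>) * l) (at_right 0)"
    by (rule tendsto_mult_left)
  moreover have "c powr (2 * \<sigma>) * trunc h (x + c *\<^sub>R y) (c * \<epsilon>) = trunc (\<lambda>z. h (x + c *\<^sub>R z)) y \<epsilon>" for \<epsilon>
    using c by (simp add: trunc_affine[OF h c] powr_minus)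
  ultimately show ?thesis
    by (simp add: PV_def)
qed

lemma Lint_affine:
  assumes h: "Lint h" and c: "c > 0"
  shows "Lint (\<lambda>z. h (x + c *\<^sub>R z))"
proof -
  note [measurable] = Lint_measurable[OF h]
  have bound: "1 + norm (x + c *\<^sub>R z) powr s \<le> (1 + (norm x + c) powr s * 2 powr s) * (1 + norm z powr s)" for z :: "real ^ 'n"
  proof -
    have "norm (x + c *\<^sub>R z) \<le> norm x + c * norm z"
      using c norm_triangle_ineq[of x "c *\<^sub>R z"] by simp
    also have "\<dots> \<le> (norm x + c) * max 1 (norm z)"
    proof -
      have "norm x * 1 \<le> norm x * max 1 (norm z)"
        by (rule mult_left_mono) simp_all
      moreover have "c * norm z \<le> c * max 1 (norm z)"
        using c by (intro mult_left_mono) simp_all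
      ultimately show ?thesis
        unfolding distrib_right by linarith
    qed
    finally have "norm (x + c *\<^sub>R z) powr s \<le> ((norm x + c) * max 1 (norm z)) powr s"
      using s_pos by (intro powr_mono2) auto
    also have "\<dots> = (norm x + c) powr s * max 1 (norm z) powr s"
      by (rule powr_mult)
    also have "max 1 (norm z) powr s \<le> 1 + norm z powr s"
      by (auto simp: max_def)
    finally have 1: "norm (x + c *\<^sub>R z) powr s \<le> (norm x + c) powr s * (1 + norm z powr s)"
      by (simp add: mult_left_mono)
    have "2 powr s \<ge> (1::real)"
      using s_pos by (simp add: ge_one_powr_ge_zero)
    then have "(norm x + c) powr s * (1 + norm z powr s) \<le> (norm x + c) powr s * 2 powr s * (1 + norm z powr s)"
      using mult_right_mono[of 1 "2 powr s" "(norm x + c) powr s * (1 + norm z powr s)"] by (simp add: ac_simps)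
    with 1 show ?thesis
      by (simp add: algebra_simps) (smt (verit) powr_ge_zero)
  qed
  define B where "B = 1 + (norm x + c) powr s * 2 powr s"
  have "integrable lborel (\<lambda>z. h (x + c *\<^sub>R z) / (1 + norm (x + c *\<^sub>R z) powr s))"
    using h c unfolding Lint_def by (subst integrable_affine_iff[where f = "\<lambda>z. h z / (1 + norm z powr s)"]) auto
  then have "integrable lborel (\<lambda>z. B * (h (x + c *\<^sub>R z) / (1 + norm (x + c *\<^sub>R z) powr s)))"
    by (rule integrable_mult_right)
  then show ?thesis
    unfolding Lint_def
  proof (rule Bochner_Integration.integrable_bound)
    show "AE z in lborel. norm (h (x + c *\<^sub>R z) / (1 + norm z powr s)) \<le> norm (B * (h (x + c *\<^sub>R z) / (1 + norm (x + c *\<^sub>R z) powr s)))"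
    proof (intro AE_I2)
      fix z :: "real ^ 'n"
      have "1 / (1 + norm z powr s) \<le> B / (1 + norm (x + c *\<^sub>R z) powr s)"
        using bound[of z] weight_pos[of z] weight_pos[of "x + c *\<^sub>R z"] by (simp add: B_def field_simps)
      then have "\<bar>h (x + c *\<^sub>R z)\<bar> * (1 / (1 + norm z powr s)) \<le> \<bar>h (x + c *\<^sub>R z)\<bar> * (B / (1 + norm (x + c *\<^sub>R z) powr s))"
        by (intro mult_left_mono) auto
      moreover have "B > 0"
        unfolding B_def by (intro add_pos_nonneg) auto
      ultimately show "norm (h (x + c *\<^sub>R z) / (1 + norm z powr s)) \<le> norm (B * (h (x + c *\<^sub>R z) / (1 + norm (x + c *\<^sub>R z) powr s)))"
        using weight_pos[of z] weight_pos[of "x + c *\<^sub>R z"] by (simp add: abs_mult ac_simps)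
    qed
  qed measurable
qed

lemma differentiable_norm_powr:
  fixes z :: "real ^ 'n"
  assumes "z \<noteq> 0"
  shows "(\<lambda>z. norm z powr b) differentiable (at z)"
proof -
  have "(norm has_derivative (\<lambda>h. sgn z \<bullet> h)) (at z)"
    using has_derivative_norm[OF assms] by (simp add: inner_commute)
  moreover have "((\<lambda>t. t powr b) has_derivative (*) (b * norm z powr (b - 1))) (at (norm z))"
    using assms by (simp add: has_real_derivative_powr flip: has_field_derivative_def)
  ultimately show ?thesis
    unfolding differentiable_def by (blast dest: has_derivative_compose)
qed

lemma differentiable_kelvin:
  assumes "z \<noteq> 0" "u differentiable (at (inversion z))"
  shows "kelvin u differentiable (at z)"
proof -
  have "inversion differentiable (at z)"
    using inversion_has_derivative[OF assms(1)] by (auto simp: differentiable_def)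
  then have "(\<lambda>z. u (inversion z)) differentiable (at z)"
    using assms(2) differentiable_chain_at[of inversion z u] by (simp add: o_def)
  then show ?thesis
    unfolding kelvin_def[abs_def] using differentiable_norm_powr[OF assms(1)] by (intro differentiable_mult) auto
qed

section \<open>The fundamental solution and the Kelvin transform of a principal value\<close>

definition fund :: "real ^ 'n \<Rightarrow> real" where "fund z = norm z powr - a"

lemma fund_eq_kelvin: "fund = kelvin (\<lambda>z. 1)"
  by (auto simp: fund_def kelvin_def)

lemma Lint_fund: "Lint fund"
  unfolding fund_eq_kelvin by (intro Lint_kelvin Lint_const)

text \<open>Here \<open>inversion y = y\<close>, and off the origin the Kelvin transform of
  \<open>1 - fund\<close> is its negative. Inverting the truncated integral therefore gives minus
  the integral over the distorted domain. Both truncations agree in the limit, so twice the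
  truncated integral tends to 0, and no integral has to be evaluated.\<close>

lemma PV_fund_unit:
  assumes y: "norm y = 1"
  shows "PV (\<lambda>z. 1 - fund z) y 0"
proof -
  have y0: "y \<noteq> 0" and invy: "inversion y = y"
    using y by (auto simp: inversion_def)
  let ?h = "\<lambda>z. 1 - fund z"
  have Lh: "Lint ?h"
    by (intro Lint_diff Lint_const Lint_fund)
  have "fund differentiable (at y)"
    unfolding fund_def[abs_def] by (intro differentiable_norm_powr y0)
  then have lip: "lipschitz_at ?h y"
    by (intro differentiable_imp_lipschitz_at differentiable_diff) auto
  have kel: "kelvin ?h z = - ?h z" if "z \<noteq> 0" for z
  proof -
    have "norm z powr - a * norm (inversion z) powr - a = 1"
      using that by (simp add: powr_mult[symmetric])
    then show ?thesis
      by (simp add: kelvin_def fund_def right_diff_distrib)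
  qed
  have pt: "indicator (- E) z * (kelvin ?h z * ker y z) = - (indicator (- E) z * (?h z * ker y z))"
    if "z \<noteq> 0" for z and E :: "(real ^ 'n) set"
    unfolding kel[OF that] mult_minus_left mult_minus_right ..
  let ?D = "\<lambda>\<epsilon>. inv_ball y (\<epsilon> / (norm y)\<^sup>2)"
  have "trunc ?h y \<epsilon> = - (\<integral>z. indicator (- ?D \<epsilon>) z * (?h z * ker y z) \<partial>lborel)" for \<epsilon>
  proof -
    note [measurable] = Lint_measurable[OF Lh] Lint_measurable[OF Lint_kelvin[OF Lh]]
    have [measurable]: "- ?D \<epsilon> \<in> sets borel"
      by measurable
    have "trunc ?h (inversion y) \<epsilon> = norm y powr s *
       (\<integral>z. indicator (- inv_ball y \<epsilon>) z * (kelvin ?h z * ker y z) \<partial>lborel)"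
      by (rule trunc_inversion[OF Lh y0])
    then have "trunc ?h y \<epsilon> = (\<integral>z. indicator (- ?D \<epsilon>) z * (kelvin ?h z * ker y z) \<partial>lborel)"
      using y by (simp add: invy)
    also have "\<dots> = (\<integral>z. - (indicator (- ?D \<epsilon>) z * (?h z * ker y z)) \<partial>lborel)"
    proof (intro integral_cong_AE)
      show "AE z in lborel. indicator (- ?D \<epsilon>) z * (kelvin ?h z * ker y z) = - (indicator (- ?D \<epsilon>) z * (?h z * ker y z))"
        using AE_lborel_singleton[of 0] by eventually_elim (rule pt)
    qed measurable
    finally show ?thesis by simp
  qed
  then have *: "(\<integral>z. indicator (- ?D \<epsilon>) z * (?h z * ker y z) \<partial>lborel) = - trunc ?h y \<epsilon>" for \<epsilon>
    by (simp only: minus_minus)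
  have "((\<lambda>\<epsilon>. (\<integral>z. indicator (- ?D \<epsilon>) z * (?h z * ker y z) \<partial>lborel) - trunc ?h y \<epsilon>) \<longlongrightarrow> 0) (at_right 0)"
    using y by (intro trunc_inversion_tendsto[OF Lh _ lip y0]) (simp add: fund_def)
  then have "((\<lambda>\<epsilon>. - (1 / 2) * (- trunc ?h y \<epsilon> - trunc ?h y \<epsilon>)) \<longlongrightarrow> - (1 / 2) * 0) (at_right 0)"
    unfolding * by (rule tendsto_mult_left)
  moreover have "- (1 / 2) * (- trunc ?h y \<epsilon> - trunc ?h y \<epsilon>) = trunc ?h y \<epsilon>" for \<epsilon>
    by (simp add: field_simps)
  ultimately show ?thesis
    unfolding PV_def by (simp only: mult_zero_right)
qed

lemma PV_fund:
  assumes y: "y \<noteq> 0"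
  shows "PV (\<lambda>z. fund y - fund z) y 0"
proof -
  define c where "c = 1 / norm y"
  have c: "c > 0"
    using y by (simp add: c_def)
  have "PV (\<lambda>z. 1 - fund z) (0 + c *\<^sub>R y) 0"
    using y by (intro PV_fund_unit) (simp add: c_def)
  then have "PV (\<lambda>z. 1 - fund (0 + c *\<^sub>R z)) y (c powr (2 * \<sigma>) * 0)"
    by (intro PV_affine c Lint_diff Lint_const Lint_fund)
  then have "PV (\<lambda>z. fund y * (1 - fund (0 + c *\<^sub>R z))) y (fund y * (c powr (2 * \<sigma>) * 0))"
    by (rule PV_cmult)
  moreover have "fund y * (1 - fund (0 + c *\<^sub>R z)) = fund y - fund z" for z
    using y by (simp add: fund_def c_def powr_mult powr_divide powr_minus field_simps)
  ultimately show ?thesis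
    by simp
qed

lemma PV_fund_at:
  assumes y: "y \<noteq> q"
  shows "PV (\<lambda>z. fund (y - q) - fund (z - q)) y 0"
proof -
  have "PV (\<lambda>z. fund (y - q) - fund z) (- q + 1 *\<^sub>R y) 0"
    using PV_fund[of "y - q"] y by simp
  then have "PV (\<lambda>z. fund (y - q) - fund (- q + 1 *\<^sub>R z)) y (1 powr (2 * \<sigma>) * 0)"
    by (intro PV_affine Lint_diff Lint_const Lint_fund) auto
  then show ?thesis
    by simp
qed

lemma Lint_fund_at: "Lint (\<lambda>z. fund (z - q))"
  using Lint_affine[OF Lint_fund, of 1 "- q"] by simp

text \<open>The Kelvin transform of \<open>u (inversion y) - u z\<close> is not a difference of
  Kelvin transforms, since constants are not preserved. The discrepancy is the constant
  \<open>u (inversion y)\<close> times \<open>fund y - fund z\<close>, whose principal value is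
  0.\<close>

lemma kelvin_PV:
  assumes u: "Lint u" "u differentiable (at (inversion y))" and y: "y \<noteq> 0"
    and PV: "PV (\<lambda>z. u (inversion y) - u z) (inversion y) l"
  shows "PV (\<lambda>z. kelvin u y - kelvin u z) y (norm y powr - s * l)"
proof -
  let ?h = "\<lambda>z. u (inversion y) - u z"
  have Lh: "Lint ?h"
    by (intro Lint_diff Lint_const u)
  have "?h differentiable (at (inversion y))"
    using u by (intro differentiable_diff) auto
  then have "lipschitz_at (kelvin ?h) y"
    by (intro differentiable_imp_lipschitz_at differentiable_kelvin y)
  then have 1: "PV (kelvin ?h) y (norm y powr - s * l)"
    using y by (intro PV_kelvin Lh PV) auto
  have 2: "PV (\<lambda>z. u (inversion y) * (fund y - fund z)) y (u (inversion y) * 0)"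
    by (intro PV_cmult PV_fund y)
  have "PV (\<lambda>z. kelvin ?h z + u (inversion y) * (fund y - fund z)) y (norm y powr - s * l + u (inversion y) * 0)"
    by (intro PV_add 1 2 Lint_kelvin Lh Lint_cmult Lint_diff Lint_const Lint_fund)
  moreover have "kelvin ?h z + u (inversion y) * (fund y - fund z) = kelvin u y - kelvin u z" for z
    by (simp add: kelvin_def fund_def algebra_simps)
  ultimately show ?thesis
    by simp
qed

end

section \<open>Maximum principles\<close>

lemma AE_lborel_open_obtain:
  fixes S :: "'a::euclidean_space set"
  assumes "AE z in lborel. P z" "open S" "S \<noteq> {}"
  obtains z where "z \<in> S" "P z"
proof -
  have "\<not> S \<subseteq> {z. \<not> P z}"
  proof
    assume *: "S \<subseteq> {z. \<not> P z}"
    obtain N where N: "N \<in> null_sets lborel" "{z. \<not> P z} \<subseteq> N"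
      using assms(1) by (auto simp: eventually_ae_filter)
    then have "S \<in> null_sets lborel"
      using * assms(2) by (intro null_sets_subset[OF N(1)]) auto
    then have "negligible S"
      by (simp add: negligible_iff_null_sets null_sets_completionI)
    then show False
      using assms(2,3) open_not_negligible by blast
  qed
  then show thesis
    using that by blast
qed

lemma AE_lborel_not_in_finite:
  "finite N \<Longrightarrow> AE z in lborel. z \<notin> N" for N :: "'a::euclidean_space set"
  by (intro AE_not_in) (simp add: finite_imp_null_set_lborel)

lemma integral_lborel_pos:
  fixes f :: "'a::euclidean_space \<Rightarrow> real"
  assumes "integrable lborel f" "AE z in lborel. f z \<ge> 0" "open S" "S \<noteq> {}" "\<And>z. z \<in> S - N \<Longrightarrow> f z > 0" "finite N"
  shows "(\<integral>z. f z \<partial>lborel) > 0"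
proof (rule ccontr)
  assume "\<not> ?thesis"
  moreover have "(\<integral>z. f z \<partial>lborel) \<ge> 0"
    using assms(2) by (rule integral_nonneg_AE)
  ultimately have "(\<integral>z. f z \<partial>lborel) = 0"
    by simp
  then have "AE z in lborel. f z = 0"
    using integral_nonneg_eq_0_iff_AE[OF assms(1,2)] by simp
  moreover have "AE z in lborel. z \<notin> N"
    using assms(6) by (rule AE_lborel_not_in_finite)
  ultimately have "AE z in lborel. f z = 0 \<and> z \<notin> N"
    by eventually_elim simp
  then obtain z where "z \<in> S" "f z = 0 \<and> z \<notin> N"
    using assms(3,4) by (rule AE_lborel_open_obtain)
  then show False
    using assms(5)[of z] by auto
qed

context frac
begin

text \<open>For centres in the half ball the kernel stays away from its pole by \<rho>/2, uniformly,
  which supplies one dominating function for all of them.\<close>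

lemma continuous_on_far_integral:
  assumes w: "Lint w" and S: "S \<in> sets borel" and \<rho>: "\<rho> > 0" "\<And>z. z \<in> S \<Longrightarrow> dist q z \<ge> \<rho>"
  shows "continuous_on (ball q (\<rho> / 2)) (\<lambda>y. \<integral>z. indicator S z * (w z * ker y z) \<partial>lborel)"
proof (rule continuous_on_sequentiallyI)
  fix u y assume u: "\<forall>n. u n \<in> ball q (\<rho> / 2)" "y \<in> ball q (\<rho> / 2)" "u \<longlonglongrightarrow> y"
  note [measurable] = Lint_measurable[OF w] S
  define C where "C = (1 / (\<rho> / 2)) powr s + ((norm q + \<rho>) / (\<rho> / 2) + 1) powr s"
  have far: "norm (x - z) \<ge> \<rho> / 2" if "x \<in> ball q (\<rho> / 2)" "z \<in> S" for x z
    using \<rho>(2)[OF that(2)] that(1) dist_triangle[of q z x] by (simp add: dist_norm)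
  have bound: "ker x z \<le> C / (1 + norm z powr s)" if x: "x \<in> ball q (\<rho> / 2)" and z: "z \<in> S" for x z
  proof -
    have "norm x \<le> norm q + \<rho>"
      using x \<rho>(1) norm_triangle_ineq4[of q "q - x"] by (simp add: dist_norm)
    then have "(norm x / (\<rho> / 2) + 1) powr s \<le> ((norm q + \<rho>) / (\<rho> / 2) + 1) powr s"
      using \<rho>(1) s_pos by (intro powr_mono2 add_mono divide_right_mono) auto
    then have "((1 / (\<rho> / 2)) powr s + (norm x / (\<rho> / 2) + 1) powr s) / (1 + norm z powr s) \<le> C / (1 + norm z powr s)"
      unfolding C_def using weight_pos[of z] by (intro divide_right_mono add_mono) auto
    then show ?thesis
      using ker_le_weight[of "\<rho> / 2" x z] \<rho>(1) far[OF x z] by simp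
  qed
  show "(\<lambda>n. \<integral>z. indicator S z * (w z * ker (u n) z) \<partial>lborel) \<longlonglongrightarrow> (\<integral>z. indicator S z * (w z * ker y z) \<partial>lborel)"
  proof (rule integral_dominated_convergence[where w = "\<lambda>z. C * \<bar>w z / (1 + norm z powr s)\<bar>"])
    show "integrable lborel (\<lambda>z. C * \<bar>w z / (1 + norm z powr s)\<bar>)"
      using w unfolding Lint_def by (intro integrable_mult_right integrable_abs)
    show "AE z in lborel. (\<lambda>n. indicator S z * (w z * ker (u n) z)) \<longlonglongrightarrow> indicator S z * (w z * ker y z)"
    proof (intro AE_I2)
      fix z
      show "(\<lambda>n. indicator S z * (w z * ker (u n) z)) \<longlonglongrightarrow> indicator S z * (w z * ker y z)"
      proof (cases "z \<in> S")
        case True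
        then have "norm (y - z) \<noteq> 0"
          using far[OF u(2) True] \<rho>(1) by auto
        then show ?thesis
          using u(3) by (intro tendsto_intros) auto
      qed simp
    qed
    fix n
    show "AE z in lborel. norm (indicator S z * (w z * ker (u n) z)) \<le> C * \<bar>w z / (1 + norm z powr s)\<bar>"
    proof (intro AE_I2)
      fix z
      show "norm (indicator S z * (w z * ker (u n) z)) \<le> C * \<bar>w z / (1 + norm z powr s)\<bar>"
      proof (cases "z \<in> S")
        case True
        have "\<bar>w z\<bar> * ker (u n) z \<le> \<bar>w z\<bar> * (C / (1 + norm z powr s))"
          using u(1) True by (intro mult_left_mono bound) auto
        then show ?thesis
          using True weight_pos[of z] by (simp add: abs_mult ac_simps)
      qed (simp add: C_def)
    qed
  qed measurable
qed

text \<open>The operator applied to \<open>w\<close> is nonnegative near \<open>q\<close>, but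
  \<open>w\<close> may change sign outside the ball. Adding a small multiple of the fundamental
  solution with pole \<open>q\<close> forces a minimum to be attained without changing the principal
  value. At a low minimum close to \<open>q\<close>, the positive exterior mass of \<open>w\<close>
  would make that principal value negative. The bound does not depend on the small multiple, which
  then tends to 0.\<close>

lemma singular_lower_bound:
  assumes w: "Lint w" and \<rho>: "\<rho> > 0"
    and cont: "continuous_on (cball q \<rho> - {q}) w"
    and pos: "\<And>z. z \<in> cball q \<rho> - {q} \<Longrightarrow> w z > 0"
    and super: "\<And>y. y \<in> ball q \<rho> - {q} \<Longrightarrow> \<exists>l\<ge>0. PV (\<lambda>z. w y - w z) y l"
    and mass: "(\<integral>z. indicator (- ball q \<rho>) z * (w z * ker q z) \<partial>lborel) > 0"
  shows "\<exists>r>0. \<exists>c>0. \<forall>z\<in>ball q r - {q}. c \<le> w z"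
proof -
  let ?E = "- ball q \<rho>"
  define I where "I f y = (\<integral>z. indicator ?E z * (f z * ker y z) \<partial>lborel)" for f and y :: "real ^ 'n"
  define m where "m = I w q"
  define k where "k = I (\<lambda>z. 1) q + 1"
  have m: "m > 0"
    using mass by (simp add: m_def I_def)
  have "I (\<lambda>z. 1) q \<ge> 0"
    unfolding I_def by (intro integral_nonneg_AE) auto
  then have k: "k > 0"
    by (simp add: k_def)
  have cI: "continuous_on (ball q (\<rho> / 2)) (I f)" if "Lint f" for f
    unfolding I_def by (rule continuous_on_far_integral[OF that _ \<rho>]) (auto simp: not_less)
  \<comment> \<open>Halving \<open>m\<close> and adding 1 in \<open>k\<close> leave strict room at
    \<open>q\<close>, so both bounds persist nearby by continuity.\<close>
  obtain r where r: "0 < r" "r \<le> \<rho> / 2" and Iw: "\<And>y. y \<in> ball q r \<Longrightarrow> I w y > m / 2"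
    and I1: "\<And>y. y \<in> ball q r \<Longrightarrow> I (\<lambda>z. 1) y < k"
  proof -
    have op: "open (ball q (\<rho> / 2) \<inter> I w -` {m / 2<..})" "open (ball q (\<rho> / 2) \<inter> I (\<lambda>z. 1) -` {..<k})"
      by (intro continuous_open_preimage cI w Lint_const open_ball open_greaterThan open_lessThan)+
    have mem: "q \<in> (ball q (\<rho> / 2) \<inter> I w -` {m / 2<..}) \<inter> (ball q (\<rho> / 2) \<inter> I (\<lambda>z. 1) -` {..<k})"
      using m \<rho> by (simp add: m_def k_def)
    then obtain e where e: "e > 0" "ball q e \<subseteq> (ball q (\<rho> / 2) \<inter> I w -` {m / 2<..}) \<inter> (ball q (\<rho> / 2) \<inter> I (\<lambda>z. 1) -` {..<k})"
      using open_contains_ball[of "(ball q (\<rho> / 2) \<inter> I w -` {m / 2<..}) \<inter> (ball q (\<rho> / 2) \<inter> I (\<lambda>z. 1) -` {..<k})"] op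
      by (metis open_Int)
    show thesis
      by (rule that[of "min e (\<rho> / 2)"]) (use e \<rho> in auto)
  qed
  have cpt: "compact (cball q \<rho> - ball q t)" for t
    by (intro compact_diff) auto
  obtain m1 where m1: "m1 > 0" "\<And>z. z \<in> cball q \<rho> - ball q r \<Longrightarrow> m1 \<le> w z"
  proof (cases "cball q \<rho> - ball q r = {}")
    case True
    show ?thesis
      by (rule that[of 1]) (simp, use True in blast)
  next
    case False
    have "continuous_on (cball q \<rho> - ball q r) w"
      using cont r by (rule_tac continuous_on_subset) auto
    then obtain z0 where z0: "z0 \<in> cball q \<rho> - ball q r" "\<forall>z\<in>cball q \<rho> - ball q r. w z0 \<le> w z"
      using continuous_attains_inf[OF cpt False] by blast
    show ?thesis
      using z0 r by (intro that[of "w z0"] pos) auto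
  qed
  \<comment> \<open>\<open>m1\<close> excludes a minimum below \<open>c\<close> away from
    \<open>q\<close>, and \<open>m / 2 / k\<close> excludes one close to \<open>q\<close>.\<close>
  define c where "c = min m1 (m / 2 / k)"
  have c: "c > 0"
    using m1 m k by (simp add: c_def)
  have key: "c \<le> w z1 + \<epsilon> * fund (z1 - q)" if z1: "z1 \<in> ball q r - {q}" and \<epsilon>: "\<epsilon> > 0" for z1 \<epsilon>
  proof (rule ccontr)
    define h where "h z = w z + \<epsilon> * fund (z - q)" for z
    assume "\<not> c \<le> w z1 + \<epsilon> * fund (z1 - q)"
    then have hz1: "h z1 < c"
      by (simp add: h_def)
    have b0: "fund z \<ge> 0" for z
      by (simp add: fund_def)
    have Lh: "Lint h"
      unfolding h_def by (intro Lint_add Lint_cmult Lint_fund_at w)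
    \<comment> \<open>Within distance \<open>(c / \<epsilon>) powr (- 1 / a)\<close> of
      \<open>q\<close> the added multiple of the fundamental solution alone is at least
      \<open>c\<close>. The other bound keeps \<open>z1\<close> outside the removed ball.\<close>
    define \<delta> where "\<delta> = min (dist q z1) ((c / \<epsilon>) powr (- 1 / a))"
    have \<delta>: "\<delta> > 0"
      using z1 c \<epsilon> by (auto simp: \<delta>_def dist_commute)
    have near: "h z > h z1" if "z \<in> ball q \<delta> - {q}" for z
    proof -
      have "norm (z - q) < (c / \<epsilon>) powr (- 1 / a)" "norm (z - q) > 0"
        using that by (auto simp: \<delta>_def dist_norm norm_minus_commute)
      then have "((c / \<epsilon>) powr (- 1 / a)) powr - a \<le> norm (z - q) powr - a"
        using a_pos by (intro powr_mono2') auto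
      then have "c / \<epsilon> \<le> fund (z - q)"
        using a_pos c \<epsilon> by (simp add: fund_def powr_powr)
      then have "c \<le> \<epsilon> * fund (z - q)"
        using \<epsilon> by (simp add: field_simps)
      moreover have "w z > 0"
      proof (rule pos)
        have "\<delta> \<le> r"
          using z1 by (auto simp: \<delta>_def)
        then show "z \<in> cball q \<rho> - {q}"
          using that r \<rho> by auto
      qed
      ultimately show ?thesis
        using hz1 by (simp add: h_def)
    qed
    have z1in: "z1 \<in> cball q \<rho> - ball q \<delta>"
      using z1 r \<rho> by (auto simp: \<delta>_def)
    have "continuous_on (cball q \<rho> - ball q \<delta>) h"
      unfolding h_def fund_def using cont \<delta>
      by (intro continuous_intros) (auto elim: continuous_on_subset)
    then obtain y0 where y0: "y0 \<in> cball q \<rho> - ball q \<delta>" "\<And>z. z \<in> cball q \<rho> - ball q \<delta> \<Longrightarrow> h y0 \<le> h z"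
      using continuous_attains_inf[OF cpt, of \<delta> h] z1in by blast
    have hy0: "h y0 < c"
      using y0(2)[OF z1in] hz1 by simp
    have min: "h y0 \<le> h z" if "z \<in> cball q \<rho> - {q}" for z
      using y0(2)[of z] near[of z] y0(2)[OF z1in] that by (cases "z \<in> ball q \<delta>") auto
    have y0q: "y0 \<noteq> q"
      using y0(1) \<delta> by auto
    have wle: "w z \<le> h z" for z
      using b0[of "z - q"] \<epsilon> by (simp add: h_def)
    have "y0 \<in> ball q r"
    proof (rule ccontr)
      assume "y0 \<notin> ball q r"
      then have "m1 \<le> w y0"
        using m1 y0(1) by auto
      then show False
        using hy0 wle[of y0] by (simp add: c_def)
    qed
    then have y0r: "y0 \<in> ball q \<rho> - {q}"
      using y0q r \<rho> by auto
    have hpos: "h y0 > 0"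
      using pos[of y0] y0r wle[of y0] by auto
    obtain l where l: "l \<ge> 0" "PV (\<lambda>z. w y0 - w z) y0 l"
      using super[OF y0r] by blast
    have PVh: "PV (\<lambda>z. (w y0 - w z) + \<epsilon> * (fund (y0 - q) - fund (z - q))) y0 (l + \<epsilon> * 0)"
      using y0q by (intro PV_add l PV_cmult PV_fund_at Lint_diff Lint_cmult Lint_const w Lint_fund_at)
    have PVh: "PV (\<lambda>z. h y0 - h z) y0 l"
      using PVh by (simp add: h_def algebra_simps)
    have "l \<le> h y0 * I (\<lambda>z. 1) y0 - I w y0"
    proof (rule tendsto_upperbound[OF PVh[unfolded PV_def]])
      have "\<forall>\<^sub>F \<delta>' in at_right 0. 0 < \<delta>' \<and> \<delta>' < \<rho> - dist q y0"
        using y0r by (auto simp: eventually_at_right_field intro!: exI[of _ "\<rho> - dist q y0"])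
      then show "\<forall>\<^sub>F \<delta>' in at_right 0. trunc (\<lambda>z. h y0 - h z) y0 \<delta>' \<le> h y0 * I (\<lambda>z. 1) y0 - I w y0"
      proof eventually_elim
        case (elim \<delta>')
        have far: "norm (y0 - z) \<ge> \<delta>'" if "z \<in> ?E" for z
          using that elim dist_triangle[of q z y0] by (simp add: dist_norm not_less)
        have int: "integrable lborel (\<lambda>z. indicator ?E z * (f z * ker y0 z))" if "Lint f" for f
          using elim far by (intro Lint_mult_ker[OF that, where e=\<delta>']) auto
        have "trunc (\<lambda>z. h y0 - h z) y0 \<delta>' \<le> (\<integral>z. indicator ?E z * ((h y0 - h z) * ker y0 z) \<partial>lborel)"
          unfolding trunc_def
        proof (rule integral_mono_AE)
          show "integrable lborel (\<lambda>z. indicator (- ball y0 \<delta>') z * ((h y0 - h z) * ker y0 z))"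
            using elim by (intro integrable_trunc Lint_diff Lint_const Lh) auto
          show "integrable lborel (\<lambda>z. indicator ?E z * ((h y0 - h z) * ker y0 z))"
            by (intro int Lint_diff Lint_const Lh)
          show "AE z in lborel. indicator (- ball y0 \<delta>') z * ((h y0 - h z) * ker y0 z) \<le> indicator ?E z * ((h y0 - h z) * ker y0 z)"
            using AE_lborel_singleton[of q]
          proof eventually_elim
            case (elim z)
            show ?case
            proof (cases "z \<in> ?E")
              case True
              then have "z \<in> - ball y0 \<delta>'"
                using far[OF True] by (simp add: dist_norm)
              then show ?thesis
                using True by simp
            next
              case False
              then have "(h y0 - h z) * ker y0 z \<le> 0"
                using elim min[of z] by (intro mult_nonpos_nonneg) auto
              then show ?thesis
                using False by (auto simp: indicator_def)
            qed
          qed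
        qed
        also have "\<dots> = (\<integral>z. h y0 * (indicator ?E z * (1 * ker y0 z)) - indicator ?E z * (h z * ker y0 z) \<partial>lborel)"
          by (intro Bochner_Integration.integral_cong) (auto simp: algebra_simps)
        also have "\<dots> = h y0 * I (\<lambda>z. 1) y0 - I h y0"
          unfolding I_def using int[OF Lint_const, of 1] int[OF Lh] by simp
        finally have "trunc (\<lambda>z. h y0 - h z) y0 \<delta>' \<le> h y0 * I (\<lambda>z. 1) y0 - I h y0" .
        moreover have "I w y0 \<le> I h y0"
          unfolding I_def by (intro integral_mono int w Lh mult_left_mono mult_right_mono wle) auto
        ultimately show ?case
          by simp
      qed
    qed simp
    also have "h y0 * I (\<lambda>z. 1) y0 \<le> h y0 * k"
      using hpos I1[OF \<open>y0 \<in> ball q r\<close>] by (intro mult_left_mono) auto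
    finally have "m / 2 < h y0 * k"
      using l(1) Iw[OF \<open>y0 \<in> ball q r\<close>] by simp
    then have "m / 2 / k < h y0"
      using k by (simp add: field_simps)
    then show False
      using hy0 by (simp add: c_def)
  qed
  have "c \<le> w z" if z: "z \<in> ball q r - {q}" for z
  proof (rule field_le_epsilon)
    fix e :: real assume e: "e > 0"
    have f: "fund (z - q) > 0"
      using z by (simp add: fund_def)
    show "c \<le> w z + e"
      using key[OF z, of "e / fund (z - q)"] e f by simp
  qed
  then show ?thesis
    using r(1) c by blast
qed

text \<open>For \<open>z \<noteq> 0\<close> this is |z|^(-s) times
  \<open>ker y (inversion z)\<close>, the kernel at the mirror point with its conformal factor.
  Expanding the square makes the formula meaningful at \<open>z = 0\<close> as well.\<close>

definition ker_refl :: "real ^ 'n \<Rightarrow> real ^ 'n \<Rightarrow> real" where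
  "ker_refl y z = (1 - 2 * (z \<bullet> y) + (norm z)\<^sup>2 * (norm y)\<^sup>2) powr (- s / 2)"

lemma ker_eq: "ker y z = ((norm (y - z))\<^sup>2) powr (- s / 2)"
proof (cases "y = z")
  case False
  then have "(norm (y - z))\<^sup>2 = norm (y - z) powr 2"
    by simp
  then show ?thesis
    by (simp only: powr_powr) simp
qed simp

text \<open>For two points of the open unit ball both factors on the right are positive, so the
  reflected distance exceeds the true one; the positivity of the kernel difference rests on
  this.\<close>

lemma refl_dist_diff:
  "1 - 2 * (z \<bullet> y) + (norm z)\<^sup>2 * (norm y)\<^sup>2 - (norm (y - z))\<^sup>2 = (1 - (norm z)\<^sup>2) * (1 - (norm y)\<^sup>2)"
  for y z :: "'a::real_inner"
  by (simp add: power2_norm_eq_inner inner_diff_left inner_diff_right inner_commute algebra_simps)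

text \<open>Consequently the reflected kernel has no pole in the unit ball and is bounded there for
  each fixed \<open>y\<close>.\<close>

lemma refl_dist_ge:
  fixes y z :: "'a::real_inner"
  assumes "norm z \<le> 1" "norm y < 1"
  shows "1 - 2 * (z \<bullet> y) + (norm z)\<^sup>2 * (norm y)\<^sup>2 \<ge> (1 - norm y)\<^sup>2"
proof -
  have "norm z * norm y \<le> 1 * norm y"
    using assms by (intro mult_right_mono) auto
  then have "(1 - norm y)\<^sup>2 \<le> (1 - norm z * norm y)\<^sup>2"
    using assms by (intro power_mono) auto
  also have "\<dots> = 1 - 2 * (norm z * norm y) + (norm z)\<^sup>2 * (norm y)\<^sup>2"
    by (simp add: power2_diff power_mult_distrib)
  also have "\<dots> \<le> 1 - 2 * (z \<bullet> y) + (norm z)\<^sup>2 * (norm y)\<^sup>2"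
    using norm_cauchy_schwarz[of z y] by simp
  finally show ?thesis .
qed

lemma ker_refl_nonneg: "ker_refl y z \<ge> 0"
  by (simp add: ker_refl_def)

lemma ker_refl_le:
  assumes "norm z \<le> 1" "norm y < 1"
  shows "ker_refl y z \<le> ((1 - norm y)\<^sup>2) powr (- s / 2)"
  unfolding ker_refl_def using refl_dist_ge[OF assms] assms s_pos
  by (intro powr_mono2') auto

lemma ker_refl_less:
  assumes "norm z < 1" "norm y < 1" "y \<noteq> z"
  shows "ker_refl y z < ker y z"
proof -
  have "(norm z)\<^sup>2 < 1" "(norm y)\<^sup>2 < 1"
    using assms by (auto simp: power_less_one_iff abs_square_less_1)
  then have "(1 - (norm z)\<^sup>2) * (1 - (norm y)\<^sup>2) > 0"
    by (intro mult_pos_pos) auto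
  then show ?thesis
    unfolding ker_refl_def ker_eq using refl_dist_diff[of z y] assms s_pos
    by (intro powr_less_mono2_neg) auto
qed

lemma measurable_ker_refl [measurable]: "ker_refl y \<in> borel_measurable borel"
  unfolding ker_refl_def by measurable

lemma integrable_ker_refl:
  assumes W: "Lint W" and S: "S \<in> sets borel" "S \<subseteq> ball 0 1" and y: "norm y < 1"
  shows "integrable lborel (\<lambda>z. indicator S z * (W z * ker_refl y z))"
proof -
  let ?C = "((1 - norm y)\<^sup>2) powr (- s / 2)"
  have "integrable lborel (\<lambda>z. W z * (indicator S z * ker_refl y z))"
  proof (rule Lint_mult_bounded[OF W])
    show "(\<lambda>z. indicator S z * ker_refl y z) \<in> borel_measurable borel"
      using S(1) by measurable
    fix z
    show "\<bar>indicator S z * ker_refl y z\<bar> \<le> ?C * 2 / (1 + norm z powr s)"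
    proof (cases "z \<in> S")
      case True
      then have z: "norm z < 1"
        using S(2) by auto
      then have "norm z powr s \<le> 1 powr s"
        using s_pos by (intro powr_mono2) auto
      then have "1 \<le> 2 / (1 + norm z powr s)"
        using weight_pos[of z] by (simp add: field_simps)
      then have "?C * 1 \<le> ?C * (2 / (1 + norm z powr s))"
        by (intro mult_left_mono) auto
      then show ?thesis
        using True ker_refl_le[of z y] z y ker_refl_nonneg[of y z] by simp
    qed (use weight_pos[of z] in \<open>simp add: less_imp_le\<close>)
  qed
  then show ?thesis
    by (simp add: ac_simps)
qed

lemma shrinking_integral:
  fixes f :: "'a::euclidean_space \<Rightarrow> real"
  assumes f: "integrable lborel f"
  shows "(\<lambda>n. \<integral>z. indicator (ball y (1 / real (Suc n))) z * f z \<partial>lborel) \<longlonglongrightarrow> 0"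
proof -
  have [measurable]: "f \<in> borel_measurable lborel"
    using f by (rule borel_measurable_integrable)
  have "(\<lambda>n. \<integral>z. indicator (ball y (1 / real (Suc n))) z * f z \<partial>lborel) \<longlonglongrightarrow> (\<integral>z. 0 \<partial>(lborel :: 'a measure))"
  proof (rule integral_dominated_convergence[where w = "\<lambda>z. \<bar>f z\<bar>"])
    show "AE z in lborel. (\<lambda>n. indicator (ball y (1 / real (Suc n))) z * f z) \<longlonglongrightarrow> 0"
      using AE_lborel_singleton[of y]
    proof eventually_elim
      case (elim z)
      have "(\<lambda>n. 1 / real (Suc n)) \<longlonglongrightarrow> 0"
        by (rule lim_1_over_real_power[of 1, simplified, THEN LIMSEQ_Suc])
      then have "\<forall>\<^sub>F n in sequentially. 1 / real (Suc n) < dist y z"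
        using elim by (intro order_tendstoD) auto
      then have "\<forall>\<^sub>F n in sequentially. indicator (ball y (1 / real (Suc n))) z * f z = 0"
        by eventually_elim simp
      then show ?case
        by (rule tendsto_eventually)
    qed
  qed (use f in \<open>auto simp: indicator_def abs_mult\<close>)
  then show ?thesis
    by simp
qed

text \<open>The inversion exchanges ball and exterior. The exponents -2n from the Jacobian and
  \<open>a\<close> from antisymmetry add up to -s, exactly the factor contained in
  \<open>ker_refl\<close>. On the sphere itself antisymmetry forces \<open>W\<close> to
  vanish.\<close>

lemma antisym_exterior:
  assumes W: "Lint W" and anti: "\<And>z. z \<noteq> 0 \<Longrightarrow> W (inversion z) = - (norm z powr a * W z)" and y: "norm y < 1"
  shows "(\<integral>z. indicator (- ball 0 1) z * (W z * ker y z) \<partial>lborel) = - (\<integral>z. indicator (ball 0 1) z * (W z * ker_refl y z) \<partial>lborel)"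
proof -
  note [measurable] = Lint_measurable[OF W]
  let ?f = "\<lambda>z. indicator (- ball 0 1) z * (W z * ker y z)"
  have f: "?f \<in> borel_measurable borel"
    by measurable
  have "(\<integral>z. ?f z \<partial>lborel) = (\<integral>z. norm z powr (- 2 * real CARD('n)) * ?f (inversion z) \<partial>lborel)"
    by (rule integral_inversion[OF f, symmetric])
  also have "\<dots> = (\<integral>z. - (indicator (ball 0 1) z * (W z * ker_refl y z)) \<partial>lborel)"
  proof (rule integral_cong_AE)
    show "AE z in lborel. norm z powr (- 2 * real CARD('n)) * ?f (inversion z) = - (indicator (ball 0 1) z * (W z * ker_refl y z))"
      using AE_lborel_singleton[of 0]
    proof eventually_elim
      case (elim z)
      consider "norm z > 1" | "norm z = 1" | "norm z < 1"
        by linarith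
      then show ?case
      proof cases
        case 1
        then show ?thesis
          using elim by (simp add: indicator_def)
      next
        case 2
        then have inv: "inversion z = z"
          by (simp add: inversion_def)
        have "W z = - (1 powr a * W z)"
          using anti[OF elim] unfolding inv 2 .
        then have "W z = 0"
          unfolding powr_one_eq_one by linarith
        then show ?thesis
          unfolding inv by simp
      next
        case 3
        have n0: "norm z > 0"
          using elim by simp
        have "(norm z * norm (y - inversion z))\<^sup>2 = 1 - 2 * (z \<bullet> y) + (norm z)\<^sup>2 * (norm y)\<^sup>2"
        proof -
          have "norm z * norm (y - inversion z) = norm (norm z *\<^sub>R y - z /\<^sub>R norm z)"
          proof -
            have "norm z *\<^sub>R y - z /\<^sub>R norm z = norm z *\<^sub>R (y - inversion z)"
              using n0 by (simp add: inversion_def scaleR_diff_right power2_eq_square divide_inverse)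
            then show ?thesis
              by simp
          qed
          then have "(norm z * norm (y - inversion z))\<^sup>2 = (norm (norm z *\<^sub>R y - z /\<^sub>R norm z))\<^sup>2"
            by simp
          also have "\<dots> = (norm z *\<^sub>R y) \<bullet> (norm z *\<^sub>R y) - 2 * ((norm z *\<^sub>R y) \<bullet> (z /\<^sub>R norm z)) + (z /\<^sub>R norm z) \<bullet> (z /\<^sub>R norm z)"
            unfolding power2_norm_eq_inner by (simp add: inner_diff_left inner_diff_right inner_commute)
          also have "(z /\<^sub>R norm z) \<bullet> (z /\<^sub>R norm z) = 1"
            using n0 by (simp add: power2_norm_eq_inner[symmetric] power2_eq_square)
          also have "(norm z *\<^sub>R y) \<bullet> (z /\<^sub>R norm z) = z \<bullet> y"
            using n0 by (simp add: inner_commute)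
          also have "(norm z *\<^sub>R y) \<bullet> (norm z *\<^sub>R y) = (norm z)\<^sup>2 * (norm y)\<^sup>2"
            unfolding power2_norm_eq_inner[symmetric] by (simp add: power_mult_distrib)
          finally show ?thesis
            by simp
        qed
        \<comment> \<open>\<open>ker_eq\<close> is applied to a vector of prescribed norm and 0, to
          rewrite a power of a nonnegative number as a power of its square.\<close>
        moreover have "(norm z * norm (y - inversion z)) powr - s = ((norm z * norm (y - inversion z))\<^sup>2) powr (- s / 2)"
          using ker_eq[of "(norm z * norm (y - inversion z)) *\<^sub>R axis undefined 1" 0] by (simp add: norm_axis_1)
        ultimately have k: "norm z powr - s * ker y (inversion z) = ker_refl y z"
          by (simp add: powr_mult ker_refl_def)
        have p: "norm z powr (- 2 * real CARD('n)) * norm z powr a = norm z powr - s"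
          using n0 a_plus_s by (simp add: powr_add[symmetric])
        have "norm z powr (- 2 * real CARD('n)) * (W (inversion z) * ker y (inversion z))
            = - (W z * ((norm z powr (- 2 * real CARD('n)) * norm z powr a) * ker y (inversion z)))"
          unfolding anti[OF elim] by (simp only: mult_ac mult_minus_left mult_minus_right)
        also have "\<dots> = - (W z * ker_refl y z)"
          unfolding p k ..
        finally have "norm z powr (- 2 * real CARD('n)) * (W (inversion z) * ker y (inversion z)) = - (W z * ker_refl y z)" .
        moreover have "inversion z \<notin> ball 0 1"
          using 3 n0 by (simp add: field_simps)
        ultimately show ?thesis
          using 3 by simp
      qed
    qed
    show "(\<lambda>z. norm z powr (- 2 * real CARD('n)) * ?f (inversion z)) \<in> borel_measurable lborel"
      using measurable_compose[OF measurable_inversion f] by simp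
    show "(\<lambda>z. - (indicator (ball 0 1) z * (W z * ker_refl y z))) \<in> borel_measurable lborel"
      using measurable_ker_refl[of y]
      by (simp, intro borel_measurable_times borel_measurable_indicator) auto
  qed
  finally show ?thesis
    by simp
qed

definition ext_mass :: "real ^ 'n \<Rightarrow> real" where
  "ext_mass y = (\<integral>z. indicator (- ball 0 1) z * ker y z \<partial>lborel)"

text \<open>Folding the exterior into the ball turns the integrand into -(W z - W y)(ker - ker_refl)
  + W y ker_refl, whose last term is nonpositive, while the constant \<open>W y\<close> in the
  exterior contributes \<open>ext_mass\<close>. The integral on the right avoids a ball about
  \<open>y\<close>, so its convergence near the pole is never at issue; the omitted part has a sign
  that preserves the inequality.\<close>

lemma antisym_PV_le:
  assumes W: "Lint W" and anti: "\<And>z. z \<noteq> 0 \<Longrightarrow> W (inversion z) = - (norm z powr a * W z)" and y: "norm y < 1"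
    and N: "finite N" and min: "\<And>z. z \<in> ball 0 1 - N \<Longrightarrow> W y \<le> W z" and neg: "W y \<le> 0"
    and PV: "PV (\<lambda>z. W y - W z) y l" and d: "d > 0"
  shows "l \<le> W y * ext_mass y - (\<integral>z. indicator (ball 0 1 - ball y d) z * ((W z - W y) * (ker y z - ker_refl y z)) \<partial>lborel)"
proof -
  let ?B = "ball 0 1 :: (real ^ 'n) set"
  \<comment> \<open>The radii keep the truncation ball inside both the unit ball and the ball of
    radius \<open>d\<close>. Eventually they equal 1/(n+1), which is the form of
    \<open>shrinking_integral\<close>.\<close>
  define e where "e n = min (1 / real (Suc n)) (min d (1 - norm y))" for n
  define J where "J = (\<integral>z. indicator (?B - ball y d) z * ((W z - W y) * (ker y z - ker_refl y z)) \<partial>lborel)"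
  define r where "r n = (\<integral>z. indicator (ball y (e n)) z * (indicator ?B z * (W z * ker_refl y z)) \<partial>lborel)" for n
  have e: "e n > 0" "e n \<le> d" "e n \<le> 1 - norm y" "e n \<le> 1 / real (Suc n)" for n
    using d y by (auto simp: e_def)
  have LW: "Lint (\<lambda>z. W y - W z)" "Lint (\<lambda>z. W z - W y)"
    by (intro Lint_diff Lint_const W)+
  have intB: "integrable lborel (\<lambda>z. indicator ?B z * (W z * ker_refl y z))"
    by (rule integrable_ker_refl[OF W _ _ y]) auto
  have le: "trunc (\<lambda>z. W y - W z) y (e n) \<le> W y * ext_mass y - J + r n" for n
  proof -
    let ?D = "ball y (e n)"
    let ?K = "\<integral>z. indicator (?B - ?D) z * ((W y - W z) * ker y z) \<partial>lborel"
    let ?R = "\<integral>z. indicator (?B - ?D) z * (W z * ker_refl y z) \<partial>lborel"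
    have sub: "?D \<subseteq> ?B"
    proof
      fix z assume "z \<in> ?D"
      then have "norm (y - z) < 1 - norm y"
        using e(3)[of n] by (simp add: dist_norm)
      then show "z \<in> ?B"
        using norm_triangle_ineq4[of y "y - z"] by simp
    qed
    have farE: "norm (y - z) \<ge> 1 - norm y" if "z \<in> - ?B" for z
      using that norm_triangle_ineq4[of y "y - z"] by simp
    have iE: "integrable lborel (\<lambda>z. indicator (- ?B) z * (f z * ker y z))" if "Lint f" for f
      using y farE by (intro Lint_mult_ker[OF that, where e="1 - norm y"]) auto
    have iD: "integrable lborel (\<lambda>z. indicator (?B - ball y t) z * (f z * ker y z))" if "Lint f" "t > 0" for f t
      using that by (intro Lint_mult_ker[OF that(1), where e=t]) (auto simp: dist_norm)
    have iR: "integrable lborel (\<lambda>z. indicator S z * (f z * ker_refl y z))" if "Lint f" "S \<in> sets borel" "S \<subseteq> ?B" for f S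
      using integrable_ker_refl[OF that y] .
    have "trunc (\<lambda>z. W y - W z) y (e n) =
       (\<integral>z. indicator (?B - ?D) z * ((W y - W z) * ker y z) + indicator (- ?B) z * ((W y - W z) * ker y z) \<partial>lborel)"
      unfolding trunc_def by (intro Bochner_Integration.integral_cong) (use sub in \<open>auto simp: indicator_def\<close>)
    also have "\<dots> = ?K + (\<integral>z. indicator (- ?B) z * ((W y - W z) * ker y z) \<partial>lborel)"
      by (intro Bochner_Integration.integral_add iD iE LW e)
    also have "(\<integral>z. indicator (- ?B) z * ((W y - W z) * ker y z) \<partial>lborel)
       = (\<integral>z. W y * (indicator (- ?B) z * (1 * ker y z)) - indicator (- ?B) z * (W z * ker y z) \<partial>lborel)"
      by (intro Bochner_Integration.integral_cong) (auto simp: algebra_simps)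
    also have "\<dots> = W y * ext_mass y - (\<integral>z. indicator (- ?B) z * (W z * ker y z) \<partial>lborel)"
      unfolding ext_mass_def using iE[OF Lint_const, of 1] iE[OF W] by simp
    also have "(\<integral>z. indicator (- ?B) z * (W z * ker y z) \<partial>lborel) = - (\<integral>z. indicator ?B z * (W z * ker_refl y z) \<partial>lborel)"
      by (rule antisym_exterior[OF W anti y])
    also have "(\<integral>z. indicator ?B z * (W z * ker_refl y z) \<partial>lborel) =
       (\<integral>z. indicator (?B - ?D) z * (W z * ker_refl y z) + indicator ?D z * (indicator ?B z * (W z * ker_refl y z)) \<partial>lborel)"
      by (intro Bochner_Integration.integral_cong) (use sub in \<open>auto simp: indicator_def\<close>)
    also have "\<dots> = ?R + r n"
      unfolding r_def
    proof (rule Bochner_Integration.integral_add)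
      show "integrable lborel (\<lambda>z. indicator (?B - ?D) z * (W z * ker_refl y z))"
        by (intro iR W) auto
      have "integrable lborel (\<lambda>z. indicator ?D z * (W z * ker_refl y z))"
        by (intro iR W sub) auto
      moreover have "(\<lambda>z. indicator ?D z * (indicator ?B z * (W z * ker_refl y z))) = (\<lambda>z. indicator ?D z * (W z * ker_refl y z))"
        using sub by (auto simp: indicator_def fun_eq_iff)
      ultimately show "integrable lborel (\<lambda>z. indicator ?D z * (indicator ?B z * (W z * ker_refl y z)))"
        by (simp only:)
    qed
    finally have *: "trunc (\<lambda>z. W y - W z) y (e n) = W y * ext_mass y + r n +
       (?K + ?R)"
      by simp
    have "?K + ?R
       = (\<integral>z. indicator (?B - ?D) z * ((W y - W z) * ker y z) + indicator (?B - ?D) z * (W z * ker_refl y z) \<partial>lborel)"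
      by (intro Bochner_Integration.integral_add[symmetric] iD iR LW W e) auto
    also have "\<dots> \<le> (\<integral>z. - (indicator (?B - ball y d) z * ((W z - W y) * (ker y z - ker_refl y z))) \<partial>lborel)"
    proof (rule integral_mono_AE)
      show "integrable lborel (\<lambda>z. indicator (?B - ?D) z * ((W y - W z) * ker y z) + indicator (?B - ?D) z * (W z * ker_refl y z))"
        by (intro Bochner_Integration.integrable_add iD iR LW W e) auto
      have "integrable lborel (\<lambda>z. - (indicator (?B - ball y d) z * ((W z - W y) * ker y z) - indicator (?B - ball y d) z * ((W z - W y) * ker_refl y z)))"
        by (intro integrable_minus Bochner_Integration.integrable_diff iD iR LW W d) auto
      then show "integrable lborel (\<lambda>z. - (indicator (?B - ball y d) z * ((W z - W y) * (ker y z - ker_refl y z))))"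
        by (simp add: algebra_simps)
      have "AE z in lborel. z \<notin> N"
        using N by (rule AE_lborel_not_in_finite)
      then show "AE z in lborel. indicator (?B - ?D) z * ((W y - W z) * ker y z) + indicator (?B - ?D) z * (W z * ker_refl y z)
          \<le> - (indicator (?B - ball y d) z * ((W z - W y) * (ker y z - ker_refl y z)))"
      proof eventually_elim
        case (elim z)
        show ?case
        proof (cases "z \<in> ?B - ?D")
          case True
          then have z: "norm z < 1" "y \<noteq> z"
            using e(1)[of n] by auto
          have ge: "(W z - W y) * (ker y z - ker_refl y z) \<ge> 0"
            using ker_refl_less[OF z(1) y z(2)] min[of z] True elim by (intro mult_nonneg_nonneg) auto
          have "W y * ker_refl y z \<le> 0"
            using neg ker_refl_nonneg by (rule mult_nonpos_nonneg)
          then have "(W y - W z) * ker y z + W z * ker_refl y z \<le> - ((W z - W y) * (ker y z - ker_refl y z))"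
            by (simp add: algebra_simps)
          then show ?thesis
            using True ge by (auto simp: indicator_def)
        next
          case False
          then have "z \<notin> ?B - ball y d"
            using e(2)[of n] by auto
          then show ?thesis
            using False by simp
        qed
      qed
    qed
    also have "\<dots> = - J"
      by (simp add: J_def)
    finally show ?thesis
      using * by simp
  qed
  have e0: "filterlim e (at_right 0) sequentially"
  proof -
    have lim: "(\<lambda>n. 1 / real (Suc n)) \<longlonglongrightarrow> 0"
      by (rule lim_1_over_real_power[of 1, simplified, THEN LIMSEQ_Suc])
    have "e \<longlonglongrightarrow> 0"
    proof (rule tendsto_sandwich[OF _ _ tendsto_const lim])
      show "\<forall>\<^sub>F n in sequentially. 0 \<le> e n"
        using e(1) by (intro always_eventually allI less_imp_le)
      show "\<forall>\<^sub>F n in sequentially. e n \<le> 1 / real (Suc n)"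
        using e(4) by (intro always_eventually allI)
    qed
    then show ?thesis
      using e(1) by (simp add: filterlim_at always_eventually less_imp_neq[THEN not_sym])
  qed
  have lim: "(\<lambda>n. trunc (\<lambda>z. W y - W z) y (e n)) \<longlonglongrightarrow> l"
    using filterlim_compose[OF PV[unfolded PV_def] e0] .
  have r0: "r \<longlonglongrightarrow> 0"
  proof -
    define t where "t = min d (1 - norm y)"
    define n0 where "n0 = nat \<lceil>1 / t\<rceil>"
    have t: "t > 0"
      using d y by (simp add: t_def)
    have "e n = 1 / real (Suc n)" if "n \<ge> n0" for n
    proof -
      have "1 / t \<le> real n"
        using that by (simp add: n0_def nat_le_iff ceiling_le_iff)
      then have "1 / real (Suc n) \<le> t"
        using t by (simp add: field_simps)
      then show ?thesis
        unfolding e_def t_def[symmetric] by (simp only: min_absorb1)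
    qed
    then have "\<forall>\<^sub>F n in sequentially. (\<integral>z. indicator (ball y (1 / real (Suc n))) z * (indicator ?B z * (W z * ker_refl y z)) \<partial>lborel) = r n"
      unfolding eventually_sequentially r_def by (intro exI[of _ n0] allI impI) (simp only:)
    then show ?thesis
      using shrinking_integral[OF intB] by (rule Lim_transform_eventually[rotated])
  qed
  have "(\<lambda>n. W y * ext_mass y - J + r n) \<longlonglongrightarrow> W y * ext_mass y - J + 0"
    by (intro tendsto_intros r0)
  then have "l \<le> W y * ext_mass y - J + 0"
    using le by (intro LIMSEQ_le[OF lim]) auto
  then show ?thesis
    by (simp add: J_def)
qed

definition shell_const :: real where
  "shell_const = unit_ball_vol (real CARD('n)) * 3 powr - s"

lemma shell_const_pos: "shell_const > 0"
  by (simp add: shell_const_def)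

text \<open>With d = 1 - |y|, place a ball of radius d outside the sphere, centred at distance 1 + d
  from the origin in the direction of \<open>y\<close>. Its points are within 3d of
  \<open>y\<close>, which is where \<open>3 powr - s\<close> in \<open>shell_const\<close> comes
  from, and its volume is of order d^n.\<close>

lemma ext_mass_ge:
  assumes y: "norm y < 1"
  shows "shell_const * (1 - norm y) powr (- 2 * \<sigma>) \<le> ext_mass y"
proof -
  define d where "d = 1 - norm y"
  have d: "d > 0"
    using y by (simp add: d_def)
  obtain e where e: "norm e = 1" "y = norm y *\<^sub>R e"
  proof (cases "y = 0")
    case True
    then show ?thesis
      using that[of "axis undefined 1"] by (simp add: norm_axis_1)
  next
    case False
    then show ?thesis
      using that[of "sgn y"] by (simp add: sgn_div_norm)
  qed
  define c where "c = (1 + d) *\<^sub>R e"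
  have inE: "z \<in> - ball 0 1" and near: "norm (y - z) \<le> 3 * d" and ne: "norm (y - z) \<ge> d" if z: "z \<in> ball c d" for z
  proof -
    have zc: "norm (c - z) < d"
      using z by (simp add: dist_norm)
    have "norm c = 1 + d"
      using e d by (simp add: c_def)
    then have z1: "norm z > 1"
      using zc norm_triangle_ineq[of "c - z" z] by simp
    then show "z \<in> - ball 0 1"
      by simp
    show "norm (y - z) \<ge> d"
      using norm_triangle_ineq4[of y "y - z"] z1 by (simp add: d_def)
    have "norm (y - c) = norm ((norm y - (1 + d)) *\<^sub>R e)"
      using e(2) by (metis c_def scaleR_diff_left)
    also have "\<dots> = 2 * d"
      using e d by (simp add: d_def)
    finally show "norm (y - z) \<le> 3 * d"
      using zc norm_triangle_ineq[of "y - c" "c - z"] by simp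
  qed
  have "shell_const * d powr (- 2 * \<sigma>) = (3 * d) powr - s * (unit_ball_vol (real CARD('n)) * d ^ CARD('n))"
  proof -
    have "d powr - s * d ^ CARD('n) = d powr (- 2 * \<sigma>)"
      using d by (simp add: powr_realpow[symmetric] powr_add[symmetric] s_def)
    then show ?thesis
      by (simp add: shell_const_def powr_mult ac_simps)
  qed
  also have "\<dots> = (\<integral>z. (3 * d) powr - s * indicator (ball c d) z \<partial>lborel)"
    using d by (simp add: content_ball)
  also have "\<dots> \<le> ext_mass y"
    unfolding ext_mass_def
  proof (rule integral_mono)
    show "integrable lborel (\<lambda>z. (3 * d) powr - s * indicator (ball c d) z)"
      by (intro integrable_mult_right integrable_real_indicator) (auto simp: emeasure_ball d less_imp_le)
    have "integrable lborel (\<lambda>z. indicator (- ball 0 1) z * (1 * ker y z))"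
    proof (rule Lint_mult_ker[OF Lint_const, where e=d])
      show "norm (y - z) \<ge> d" if "z \<in> - ball 0 1" for z
        using that norm_triangle_ineq4[of y "y - z"] by (simp add: d_def)
    qed (use d in auto)
    then show "integrable lborel (\<lambda>z. indicator (- ball 0 1) z * ker y z)"
      by simp
    fix z
    show "(3 * d) powr - s * indicator (ball c d) z \<le> indicator (- ball 0 1) z * ker y z"
    proof (cases "z \<in> ball c d")
      case True
      have "(3 * d) powr - s \<le> ker y z"
        using near[OF True] ne[OF True] d s_pos by (intro powr_mono2') auto
      then show ?thesis
        using True inE[OF True] by simp
    qed simp
  qed
  finally show ?thesis
    by (simp add: d_def)
qed

end

section \<open>The system in the unit ball\<close>

lemma powr_ge_tangent:
  fixes t p :: real
  assumes "t > 0" "p \<ge> 1"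
  shows "1 + p * (t - 1) \<le> t powr p"
proof -
  have "((\<lambda>x. x powr p) has_real_derivative p) (at 1 within {0<..})"
    by (rule has_field_derivative_at_within) (auto intro!: derivative_eq_intros)
  then have "t powr p - 1 powr p \<ge> p * (t - 1)"
    using assms by (intro convex_on_imp_above_tangent[OF powr_convex[OF assms(2)]]) (auto simp: interior_open)
  then show ?thesis
    by simp
qed

lemma compact_punctured_lower_bound:
  fixes f :: "'a::metric_space \<Rightarrow> real"
  assumes "compact K" and loc: "\<And>q. q \<in> K \<Longrightarrow> \<exists>r>0. \<exists>c>0. \<forall>z\<in>ball q r - N. c \<le> f z"
  shows "\<exists>c>0. \<forall>z\<in>K - N. c \<le> f z"
proof -
  obtain r c where r: "\<And>q. q \<in> K \<Longrightarrow> r q > 0" and c: "\<And>q. q \<in> K \<Longrightarrow> c q > 0"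
    and f: "\<And>q z. q \<in> K \<Longrightarrow> z \<in> ball q (r q) - N \<Longrightarrow> c q \<le> f z"
    using loc by metis
  have "K \<subseteq> (\<Union>q\<in>K. ball q (r q))"
    using r by force
  then obtain Q where Q: "Q \<subseteq> K" "finite Q" "K \<subseteq> (\<Union>q\<in>Q. ball q (r q))"
    using compactE_image[OF assms(1), of K "\<lambda>q. ball q (r q)"] by auto
  \<comment> \<open>The element 1 keeps the minimum defined and positive when the cover is
    empty.\<close>
  define m where "m = Min (insert 1 (c ` Q))"
  have "m > 0"
    using Q c by (auto simp: m_def)
  moreover have "m \<le> f z" if zK: "z \<in> K - N" for z
  proof -
    obtain q where q: "q \<in> Q" "z \<in> ball q (r q)"
      using zK Q(3) by blast
    have "m \<le> c q"
      using q(1) Q(2) by (simp add: m_def)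
    also have "\<dots> \<le> f z"
      using q zK Q(1) by (intro f) auto
    finally show ?thesis .
  qed
  ultimately show ?thesis
    by blast
qed

lemma finite_isolated_ball:
  fixes N :: "'a::metric_space set"
  assumes "finite N" "open U" "q \<in> U"
  shows "\<exists>r>0. cball q r - {q} \<subseteq> U - N"
proof -
  have "open (U - (N - {q}))"
    using assms by (intro open_Diff finite_imp_closed) auto
  then obtain e where "e > 0" "cball q e \<subseteq> U - (N - {q})"
    using assms(3) open_contains_cball by (metis Diff_iff insertI1)
  then show ?thesis
    by (intro exI[of _ e]) auto
qed

context frac
begin

section \<open>The nonlinearity: homogeneity, monotonicity and a one-sided Lipschitz bound\<close>

definition F :: "real \<Rightarrow> real \<Rightarrow> real \<Rightarrow> real \<Rightarrow> real" where
  "F \<alpha> \<beta> x y = \<alpha> * x powr (s / a) + \<beta> * (x powr (2 * \<sigma> / a) * y powr (real CARD('n) / a))"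

text \<open>Homogeneity of degree s/a makes the system conformally invariant: the factor |z|^(-a) of
  the Kelvin transform becomes |z|^(-s), the factor acquired by the principal value.\<close>

lemma F_scale: "F \<alpha> \<beta> (t * x) (t * y) = t powr (s / a) * F \<alpha> \<beta> x y"
proof -
  have "2 * \<sigma> / a + real CARD('n) / a = s / a"
    by (simp add: s_def add_divide_distrib)
  then have "t powr (2 * \<sigma> / a) * t powr (real CARD('n) / a) = t powr (s / a)"
    by (simp add: powr_add[symmetric])
  moreover have "F \<alpha> \<beta> (t * x) (t * y) = \<alpha> * (t powr (s / a) * x powr (s / a)) +
    \<beta> * ((t powr (2 * \<sigma> / a) * t powr (real CARD('n) / a)) * (x powr (2 * \<sigma> / a) * y powr (real CARD('n) / a)))"
    unfolding F_def powr_mult by (simp only: mult_ac)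
  ultimately show ?thesis
    unfolding F_def by (simp only: distrib_left mult_ac)
qed

lemma exps_pos: "s / a > 0" "2 * \<sigma> / a > 0" "real CARD('n) / a > 0"
  using s_pos a_pos \<sigma> by auto

lemma F_mono:
  assumes "0 \<le> x" "x \<le> x'" "0 \<le> y" "y \<le> y'" "\<alpha> \<ge> 0" "\<beta> \<ge> 0"
  shows "F \<alpha> \<beta> x y \<le> F \<alpha> \<beta> x' y'"
  unfolding F_def using assms exps_pos
  by (intro add_mono mult_left_mono mult_mono powr_mono2) auto

lemma F_pos: "x > 0 \<Longrightarrow> \<alpha> > 0 \<Longrightarrow> \<beta> \<ge> 0 \<Longrightarrow> F \<alpha> \<beta> x y > 0"
  unfolding F_def by (intro add_pos_nonneg mult_pos_pos) auto

lemma F_inj_right: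
  assumes "F \<alpha> \<beta> x y = F \<alpha> \<beta> x y'" "x > 0" "y > 0" "y' > 0" "\<beta> > 0"
  shows "y = y'"
proof -
  have "y powr (real CARD('n) / a) = y' powr (real CARD('n) / a)"
    using assms by (simp add: F_def)
  then have "(y powr (real CARD('n) / a)) powr (a / real CARD('n)) = (y' powr (real CARD('n) / a)) powr (a / real CARD('n))"
    by simp
  then show ?thesis
    using assms a_pos by (simp add: powr_powr)
qed

definition lip_coeff :: "real \<Rightarrow> real \<Rightarrow> real \<Rightarrow> real \<Rightarrow> real" where
  "lip_coeff \<alpha> \<beta> x y = (s / a) * F \<alpha> \<beta> x y / min x y"

definition max_lip :: "real \<Rightarrow> real \<Rightarrow> real \<Rightarrow> real \<Rightarrow> real \<Rightarrow> real" where
  "max_lip \<alpha>1 \<alpha>2 \<beta> x y = max (lip_coeff \<alpha>1 \<beta> x y) (lip_coeff \<alpha>2 \<beta> y x)"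

text \<open>Lowering both arguments by at most \<mu> costs no more than scaling them by t = 1 -
  \<mu> / min x' y'. Homogeneity and the tangent of t^(s/a) at 1 then give \<open>lip_coeff\<close>;
  for t at most 0 the left side is nonpositive. The coefficient depends on the primed pair alone, so
  the other pair may be unbounded.\<close>

lemma F_lower:
  assumes pos: "x > 0" "y > 0" "x' > 0" "y' > 0" and \<alpha>: "\<alpha> > 0" "\<beta> > 0" and \<mu>: "\<mu> \<ge> 0"
    and le: "x' - \<mu> \<le> x" "y' - \<mu> \<le> y"
  shows "F \<alpha> \<beta> x' y' - \<mu> * lip_coeff \<alpha> \<beta> x' y' \<le> F \<alpha> \<beta> x y"
proof -
  define m where "m = min x' y'"
  define t where "t = 1 - \<mu> / m"
  have m: "m > 0" "m \<le> x'" "m \<le> y'"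
    using pos by (auto simp: m_def)
  have p: "s / a \<ge> 1"
    using a_lt_s a_pos by simp
  have F': "F \<alpha> \<beta> x' y' > 0" "F \<alpha> \<beta> x y > 0"
    using pos \<alpha> by (auto intro!: F_pos)
  have eq: "F \<alpha> \<beta> x' y' - \<mu> * lip_coeff \<alpha> \<beta> x' y' = (1 + (s / a) * (t - 1)) * F \<alpha> \<beta> x' y'"
    by (simp add: lip_coeff_def m_def[symmetric] t_def algebra_simps)
  show ?thesis
  proof (cases "t > 0")
    case True
    have "t * z \<le> z - \<mu>" if "m \<le> z" for z
    proof -
      have "\<mu> * m \<le> \<mu> * z"
        using that \<mu> by (intro mult_left_mono)
      then have "\<mu> \<le> \<mu> / m * z"
        using m by (simp add: field_simps)
      then show ?thesis
        by (simp add: t_def algebra_simps)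
    qed
    then have txy: "t * x' \<le> x" "t * y' \<le> y"
      using m le by fastforce+
    have "(1 + (s / a) * (t - 1)) * F \<alpha> \<beta> x' y' \<le> t powr (s / a) * F \<alpha> \<beta> x' y'"
      using powr_ge_tangent[OF True p] F' by (intro mult_right_mono) auto
    also have "\<dots> = F \<alpha> \<beta> (t * x') (t * y')"
      by (rule F_scale[symmetric])
    also have "\<dots> \<le> F \<alpha> \<beta> x y"
      using txy True pos \<alpha> by (intro F_mono) auto
    finally show ?thesis
      using eq by simp
  next
    case False
    then have "(s / a) * (t - 1) \<le> 1 * (t - 1)"
      using p by (intro mult_right_mono_neg) auto
    then have "1 + (s / a) * (t - 1) \<le> 0"
      using False by simp
    then have "(1 + (s / a) * (t - 1)) * F \<alpha> \<beta> x' y' \<le> 0"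
      using F' by (intro mult_nonpos_nonneg) auto
    then show ?thesis
      using eq F' by simp
  qed
qed

text \<open>A class closed under Kelvin transforms, dilations and translations, with
  \<open>N\<close> collecting the exceptional points. Differentiability supplies the local Lipschitz
  bound required for transforming principal values.\<close>

definition sol :: "real \<Rightarrow> real \<Rightarrow> real \<Rightarrow> (real ^ 'n) set \<Rightarrow> (real ^ 'n \<Rightarrow> real) \<Rightarrow> (real ^ 'n \<Rightarrow> real) \<Rightarrow> bool" where
  "sol \<alpha>1 \<alpha>2 \<beta> N u v \<longleftrightarrow> \<alpha>1 > 0 \<and> \<alpha>2 > 0 \<and> \<beta> > 0 \<and> finite N \<and> Lint u \<and> Lint v \<and>
     (\<forall>x. x \<notin> N \<longrightarrow> u x > 0 \<and> v x > 0 \<and> u differentiable (at x) \<and> v differentiable (at x) \<and>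
        PV (\<lambda>z. u x - u z) x (F \<alpha>1 \<beta> (u x) (v x)) \<and> PV (\<lambda>z. v x - v z) x (F \<alpha>2 \<beta> (v x) (u x)))"

lemma sol_swap: "sol \<alpha>1 \<alpha>2 \<beta> N u v \<Longrightarrow> sol \<alpha>2 \<alpha>1 \<beta> N v u"
  unfolding sol_def by blast

lemma solD:
  assumes "sol \<alpha>1 \<alpha>2 \<beta> N u v"
  shows "\<alpha>1 > 0" "\<alpha>2 > 0" "\<beta> > 0" "finite N" "Lint u" "Lint v"
    and "x \<notin> N \<Longrightarrow> u x > 0" "x \<notin> N \<Longrightarrow> v x > 0"
    and "x \<notin> N \<Longrightarrow> u differentiable (at x)" "x \<notin> N \<Longrightarrow> v differentiable (at x)"
    and "x \<notin> N \<Longrightarrow> PV (\<lambda>z. u x - u z) x (F \<alpha>1 \<beta> (u x) (v x))"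
    and "x \<notin> N \<Longrightarrow> PV (\<lambda>z. v x - v z) x (F \<alpha>2 \<beta> (v x) (u x))"
  using assms unfolding sol_def by blast+

lemma sol_isCont: "sol \<alpha>1 \<alpha>2 \<beta> N u v \<Longrightarrow> x \<notin> N \<Longrightarrow> isCont u x"
  by (intro differentiable_imp_continuous_within solD)

lemma sol_continuous_on: "sol \<alpha>1 \<alpha>2 \<beta> N u v \<Longrightarrow> S \<inter> N = {} \<Longrightarrow> continuous_on S u"
  by (rule continuous_at_imp_continuous_on) (use sol_isCont in blast)

lemma kelvin_scale_exp:
  assumes "z \<noteq> 0"
  shows "norm z powr - s * F \<alpha> \<beta> (u (inversion z)) (v (inversion z)) = F \<alpha> \<beta> (kelvin u z) (kelvin v z)"
  using a_pos by (simp add: kelvin_def F_scale powr_powr)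

text \<open>The origin joins the exceptional set because it is the image of infinity.\<close>

lemma sol_kelvin:
  assumes S: "sol \<alpha>1 \<alpha>2 \<beta> N u v"
  shows "sol \<alpha>1 \<alpha>2 \<beta> (insert 0 (inversion ` N)) (kelvin u) (kelvin v)"
proof -
  have *: "x \<noteq> 0 \<and> inversion x \<notin> N" if "x \<notin> insert 0 (inversion ` N)" for x
    using that by (metis imageI insertCI inversion_inversion)
  show ?thesis
    unfolding sol_def
  proof (intro conjI allI impI)
    fix x assume "x \<notin> insert 0 (inversion ` N)"
    then have x: "x \<noteq> 0" "inversion x \<notin> N"
      using * by auto
    note D = solD(7-12)[OF S x(2)]
    show "kelvin u x > 0" "kelvin v x > 0"
      using D x by (auto simp: kelvin_def)
    show "kelvin u differentiable (at x)" "kelvin v differentiable (at x)"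
      using D x by (auto intro!: differentiable_kelvin)
    show "PV (\<lambda>z. kelvin u x - kelvin u z) x (F \<alpha>1 \<beta> (kelvin u x) (kelvin v x))"
      unfolding kelvin_scale_exp[OF x(1), symmetric] by (intro kelvin_PV solD[OF S] D x)
    show "PV (\<lambda>z. kelvin v x - kelvin v z) x (F \<alpha>2 \<beta> (kelvin v x) (kelvin u x))"
      unfolding kelvin_scale_exp[OF x(1), symmetric] by (intro kelvin_PV solD[OF S] D x)
  qed (use solD[OF S] in \<open>auto intro: Lint_kelvin\<close>)
qed

text \<open>The amplitude \<open>c powr (a / 2)\<close> is dictated by scaling: the operator
  contributes c^(2\<sigma>), the nonlinearity raises amplitudes to the power s/a, and a/2 +
  2\<sigma> = (a/2)(s/a).\<close>

lemma sol_affine: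
  assumes S: "sol \<alpha>1 \<alpha>2 \<beta> N u v" and c: "c > 0"
  shows "sol \<alpha>1 \<alpha>2 \<beta> ((\<lambda>p. (p - x) /\<^sub>R c) ` N) (\<lambda>z. c powr (a / 2) * u (x + c *\<^sub>R z)) (\<lambda>z. c powr (a / 2) * v (x + c *\<^sub>R z))"
proof -
  have *: "x + c *\<^sub>R z \<notin> N" if "z \<notin> (\<lambda>p. (p - x) /\<^sub>R c) ` N" for z
  proof
    assume "x + c *\<^sub>R z \<in> N"
    then have "(x + c *\<^sub>R z - x) /\<^sub>R c \<in> (\<lambda>p. (p - x) /\<^sub>R c) ` N"
      by (rule imageI)
    then show False
      using that c by simp
  qed
  have PV: "PV (\<lambda>z. c powr (a / 2) * w (x + c *\<^sub>R y) - c powr (a / 2) * w (x + c *\<^sub>R z)) y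
      (F \<alpha> \<beta> (c powr (a / 2) * w (x + c *\<^sub>R y)) (c powr (a / 2) * w' (x + c *\<^sub>R y)))"
    if w: "Lint w" and P: "PV (\<lambda>z. w (x + c *\<^sub>R y) - w z) (x + c *\<^sub>R y) (F \<alpha> \<beta> (w (x + c *\<^sub>R y)) (w' (x + c *\<^sub>R y)))"
    for w w' y \<alpha>
  proof -
    have "PV (\<lambda>z. c powr (a / 2) * (w (x + c *\<^sub>R y) - w (x + c *\<^sub>R z))) y
       (c powr (a / 2) * (c powr (2 * \<sigma>) * F \<alpha> \<beta> (w (x + c *\<^sub>R y)) (w' (x + c *\<^sub>R y))))"
      by (intro PV_cmult PV_affine[OF _ c P] Lint_diff Lint_const w)
    moreover have "c powr (a / 2) * c powr (2 * \<sigma>) = (c powr (a / 2)) powr (s / a)"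
    proof -
      have "a / 2 * (s / a) = s / 2"
        using a_pos by simp
      also have "\<dots> = a / 2 + 2 * \<sigma>"
        by (simp add: a_def s_def field_simps)
      finally show ?thesis
        by (simp add: powr_powr powr_add[symmetric])
    qed
    ultimately show ?thesis
      unfolding F_scale by (simp add: right_diff_distrib mult.assoc[symmetric])
  qed
  have diff: "(\<lambda>z. c powr (a / 2) * w (x + c *\<^sub>R z)) differentiable (at y)"
    if "w differentiable (at (x + c *\<^sub>R y))" for w y
  proof -
    have "(\<lambda>z. x + c *\<^sub>R z) differentiable (at y)"
      by (intro differentiable_add differentiable_const differentiable_scaleR differentiable_ident)
    then have "(\<lambda>z. w (x + c *\<^sub>R z)) differentiable (at y)"
      using that differentiable_chain_at[of "\<lambda>z. x + c *\<^sub>R z" y w] by (simp add: o_def)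
    then show ?thesis
      by (intro differentiable_mult differentiable_const)
  qed
  show ?thesis
    unfolding sol_def
  proof (intro conjI allI impI)
    fix y assume "y \<notin> (\<lambda>p. (p - x) /\<^sub>R c) ` N"
    note D = solD(7-12)[OF S *[OF this]]
    show "c powr (a / 2) * u (x + c *\<^sub>R y) > 0" "c powr (a / 2) * v (x + c *\<^sub>R y) > 0"
      using D c by auto
    show "(\<lambda>z. c powr (a / 2) * u (x + c *\<^sub>R z)) differentiable (at y)"
      "(\<lambda>z. c powr (a / 2) * v (x + c *\<^sub>R z)) differentiable (at y)"
      by (intro diff D)+
  qed (use solD[OF S] * c in \<open>auto intro!: Lint_cmult Lint_affine PV\<close>)
qed

text \<open>Positivity everywhere off \<open>N\<close> supplies the exterior mass for
  \<open>singular_lower_bound\<close>. Applied to Kelvin transforms, it bounds them from below near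
  both exceptional points.\<close>

lemma sol_lower_bound:
  assumes S: "sol \<alpha>1 \<alpha>2 \<beta> N u v"
  shows "\<exists>r>0. \<exists>c>0. \<forall>z\<in>ball q r - N. c \<le> u z"
proof -
  note D = solD[OF S]
  obtain \<rho> where \<rho>: "\<rho> > 0" "cball q \<rho> - {q} \<subseteq> UNIV - N"
    using finite_isolated_ball[OF D(4) open_UNIV, of q] by auto
  have notN: "z \<notin> N" if "z \<in> cball q \<rho> - {q}" for z
    using \<rho>(2) that by auto
  have "\<exists>r>0. \<exists>c>0. \<forall>z\<in>ball q r - {q}. c \<le> u z"
  proof (rule singular_lower_bound[OF D(5) \<rho>(1)])
    show "continuous_on (cball q \<rho> - {q}) u"
      using notN by (intro sol_continuous_on[OF S]) blast
    show "u z > 0" if "z \<in> cball q \<rho> - {q}" for z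
      using notN[OF that] D(7) by blast
    show "\<exists>l\<ge>0. PV (\<lambda>z. u y - u z) y l" if "y \<in> ball q \<rho> - {q}" for y
    proof -
      have "y \<notin> N"
        using notN that by auto
      then show ?thesis
        using D(11)[of y] F_pos[OF D(7)[of y] D(1), of \<beta> "v y"] D(3) by (intro exI conjI) auto
    qed
    show "(\<integral>z. indicator (- ball q \<rho>) z * (u z * ker q z) \<partial>lborel) > 0"
    proof (rule integral_lborel_pos[where S = "- cball q \<rho>" and N = N])
      show "integrable lborel (\<lambda>z. indicator (- ball q \<rho>) z * (u z * ker q z))"
        using \<rho>(1) by (intro integrable_trunc D)
      have "AE z in lborel. z \<notin> N"
        using D(4) by (rule AE_lborel_not_in_finite)
      then show "AE z in lborel. indicator (- ball q \<rho>) z * (u z * ker q z) \<ge> 0"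
        by eventually_elim (intro mult_nonneg_nonneg less_imp_le[OF D(7)], auto)
      have "norm (\<rho> + 1) = norm ((\<rho> + 1) *\<^sub>R (axis undefined 1 :: real ^ 'n))"
        by (simp add: norm_axis_1)
      then have "q + (\<rho> + 1) *\<^sub>R axis undefined 1 \<in> - cball q \<rho>"
        using \<rho>(1) by (simp add: dist_norm norm_axis_1)
      then show "- cball q \<rho> \<noteq> {}"
        by blast
      show "indicator (- ball q \<rho>) z * (u z * ker q z) > 0" if "z \<in> - cball q \<rho> - N" for z
      proof -
        have "u z * ker q z > 0"
          using that \<rho>(1) by (intro mult_pos_pos D(7)) auto
        then show ?thesis
          using that by (auto simp: indicator_def)
      qed
    qed (use D(4) in \<open>auto simp: open_Compl\<close>)
  qed
  then obtain r c where rc: "r > 0" "c > 0" "\<forall>z\<in>ball q r - {q}. c \<le> u z"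
    by blast
  show ?thesis
  proof (cases "q \<in> N")
    case True
    then show ?thesis
      using rc by blast
  next
    case False
    then have "u q > 0"
      using D(7) by blast
    then show ?thesis
      using rc by (intro exI[of _ r] conjI exI[of _ "min c (u q)"]) (auto simp: min_le_iff_disj)
  qed
qed

text \<open>The reflection is normalised to the unit sphere; \<open>p\<close>, the singular point,
  lies outside the unit ball, so that in the ball the Kelvin transforms are singular only at \<open>0\<close>
  and \<open>inversion p\<close>, and \<open>u\<close>, \<open>v\<close> are not singular at all.\<close>

definition usol where
  "usol \<alpha>1 \<alpha>2 \<beta> p u v \<longleftrightarrow> sol \<alpha>1 \<alpha>2 \<beta> {p} u v \<and> norm p > 1"

abbreviation gap :: "(real ^ 'n \<Rightarrow> real) \<Rightarrow> real ^ 'n \<Rightarrow> real" where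
  "gap u z \<equiv> kelvin u z - u z"

abbreviation bad :: "real ^ 'n \<Rightarrow> (real ^ 'n) set" where
  "bad p \<equiv> {0, inversion p}"

abbreviation pball :: "real ^ 'n \<Rightarrow> (real ^ 'n) set" where
  "pball p \<equiv> ball 0 1 - bad p"

lemma usol_swap: "usol \<alpha>1 \<alpha>2 \<beta> p u v \<Longrightarrow> usol \<alpha>2 \<alpha>1 \<beta> p v u"
  unfolding usol_def using sol_swap by blast

lemma gap_inversion:
  assumes "z \<noteq> 0"
  shows "gap u (inversion z) = - (norm z powr a * gap u z)"
proof -
  have "norm z powr a * norm z powr - a = 1"
    using assms by (simp add: powr_minus)
  then have "norm z powr a * kelvin u z = u (inversion z)"
    by (simp add: kelvin_def mult.assoc[symmetric])
  moreover have "kelvin u (inversion z) = norm z powr a * u z"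
    using assms by (simp add: kelvin_def powr_divide powr_minus)
  ultimately show ?thesis
    by (simp add: right_diff_distrib)
qed

context
  fixes \<alpha>1 \<alpha>2 \<beta> p u v
  assumes U: "usol \<alpha>1 \<alpha>2 \<beta> p u v"
begin

lemma Su: "sol \<alpha>1 \<alpha>2 \<beta> {p} u v" and Sk: "sol \<alpha>1 \<alpha>2 \<beta> (bad p) (kelvin u) (kelvin v)" and p1: "norm p > 1"
  using U sol_kelvin[of \<alpha>1 \<alpha>2 \<beta> "{p}" u v] by (auto simp: usol_def)

lemma Lint_gap: "Lint (gap u)"
  by (intro Lint_diff Lint_kelvin solD[OF Su])

lemma isCont_gap:
  assumes "norm z \<le> 1" "z \<notin> bad p"
  shows "isCont (gap u) z"
  using assms p1 by (intro continuous_diff sol_isCont[OF Sk] sol_isCont[OF Su]) auto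

lemma continuous_on_gap:
  assumes "S \<subseteq> cball 0 1 - bad p"
  shows "continuous_on S (gap u)"
  using assms by (intro continuous_at_imp_continuous_on ballI isCont_gap) auto

lemma PV_gap:
  assumes "norm z \<le> 1" "z \<notin> bad p"
  shows "PV (\<lambda>x. gap u z - gap u x) z (F \<alpha>1 \<beta> (kelvin u z) (kelvin v z) - F \<alpha>1 \<beta> (u z) (v z))"
proof -
  have z: "z \<notin> {p}"
    using assms p1 by auto
  have "PV (\<lambda>x. (kelvin u z - kelvin u x) + (- 1) * (u z - u x)) z
     (F \<alpha>1 \<beta> (kelvin u z) (kelvin v z) + (- 1) * F \<alpha>1 \<beta> (u z) (v z))"
    by (intro PV_add PV_cmult solD[OF Sk] solD[OF Su] assms z Lint_diff Lint_cmult Lint_const)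
  then show ?thesis
    by (simp add: algebra_simps)
qed

lemma F_gap_mono:
  assumes "y \<in> ball 0 1" "gap u y \<ge> 0" "gap v y \<ge> 0"
  shows "F \<alpha>1 \<beta> (u y) (v y) \<le> F \<alpha>1 \<beta> (kelvin u y) (kelvin v y)"
proof -
  have "y \<notin> {p}"
    using assms(1) p1 by auto
  then show ?thesis
    using assms solD(1-3)[OF Su] by (intro F_mono less_imp_le[OF solD(7)[OF Su]] less_imp_le[OF solD(8)[OF Su]]) auto
qed

lemma gap_PV_le:
  assumes y: "y \<in> pball p" and min: "\<And>z. z \<in> pball p \<Longrightarrow> gap u y \<le> gap u z" and neg: "gap u y \<le> 0"
    and d: "d > 0"
  shows "F \<alpha>1 \<beta> (kelvin u y) (kelvin v y) - F \<alpha>1 \<beta> (u y) (v y) \<le> gap u y * ext_mass y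
     - (\<integral>z. indicator (ball 0 1 - ball y d) z * ((gap u z - gap u y) * (ker y z - ker_refl y z)) \<partial>lborel)"
  by (rule antisym_PV_le[where N = "bad p", OF Lint_gap gap_inversion _ _ min neg PV_gap d]) (use y in auto)

lemma integrable_gap_ker:
  assumes y: "norm y < 1" and d: "d > 0"
  shows "integrable lborel (\<lambda>z. indicator (ball 0 1 - ball y d) z * ((gap u z - c) * (ker y z - ker_refl y z)))"
proof -
  have L: "Lint (\<lambda>z. gap u z - c)"
    by (intro Lint_diff[OF Lint_gap] Lint_const)
  have "integrable lborel (\<lambda>z. indicator (ball 0 1 - ball y d) z * ((gap u z - c) * ker y z) - indicator (ball 0 1 - ball y d) z * ((gap u z - c) * ker_refl y z))"
    using d y by (intro Bochner_Integration.integrable_diff Lint_mult_ker[OF L, where e=d] integrable_ker_refl L)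
      (auto simp: dist_norm)
  then show ?thesis
    by (simp add: right_diff_distrib)
qed

text \<open>At a zero of the nonnegative difference the system makes the operator nonnegative, by
  monotonicity of \<open>F\<close>. The operator is nonlocal: a positive value anywhere in the ball
  enters with a positive kernel and would make it negative.\<close>

lemma gap_zero_propagates:
  assumes y: "y \<in> pball p" "gap u y = 0"
    and nn: "\<And>z. z \<in> pball p \<Longrightarrow> gap u z \<ge> 0 \<and> gap v z \<ge> 0"
    and z: "z \<in> pball p"
  shows "gap u z = 0"
proof (rule ccontr)
  assume "gap u z \<noteq> 0"
  then have pos: "gap u z > 0"
    using nn[OF z] by simp
  then have zy: "z \<noteq> y"
    using y by auto
  define d where "d = dist z y / 2"
  have d: "d > 0"
    using zy by (simp add: d_def)
  let ?f = "\<lambda>z. indicator (ball 0 1 - ball y d) z * ((gap u z - gap u y) * (ker y z - ker_refl y z))"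
  have "isCont (gap u) z"
    using z by (intro isCont_gap) auto
  then have "\<forall>\<^sub>F x in at z. gap u x > 0"
    using pos unfolding isCont_def by (rule order_tendstoD(1))
  then obtain V where V: "open V" "z \<in> V" "\<forall>x\<in>V. x \<noteq> z \<longrightarrow> gap u x > 0"
    unfolding eventually_at_topological by auto
  have V3: "gap u x > 0" if "x \<in> V" for x
    using V(3) that pos by (cases "x = z") auto
  have y1: "norm y < 1"
    using y by simp
  have "open (V \<inter> (ball 0 1 - cball y d))"
    using V by (intro open_Int open_Diff) auto
  moreover have "z \<in> V \<inter> (ball 0 1 - cball y d)"
    using V z d by (auto simp: d_def dist_commute)
  ultimately have "(\<integral>z. ?f z \<partial>lborel) > 0"
  proof (intro integral_lborel_pos[where S = "V \<inter> (ball 0 1 - cball y d)" and N = "bad p"])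
    show "integrable lborel ?f"
      using y1 d by (rule integrable_gap_ker)
    have "AE z in lborel. z \<notin> bad p"
      by (rule AE_lborel_not_in_finite) simp
    then show "AE z in lborel. ?f z \<ge> 0"
    proof eventually_elim
      case (elim z)
      show ?case
      proof (cases "z \<in> ball 0 1 - ball y d")
        case True
        then have "ker_refl y z < ker y z"
          using y1 d by (intro ker_refl_less) auto
        then show ?thesis
          using True nn[of z] elim y by (intro mult_nonneg_nonneg) auto
      qed simp
    qed
    fix x assume x: "x \<in> V \<inter> (ball 0 1 - cball y d) - bad p"
    then have "ker_refl y x < ker y x"
      using y1 d by (intro ker_refl_less) auto
    then show "?f x > 0"
      using x V3[of x] y d by auto
  qed auto
  moreover have "F \<alpha>1 \<beta> (kelvin u y) (kelvin v y) - F \<alpha>1 \<beta> (u y) (v y) \<le> gap u y * ext_mass y - (\<integral>z. ?f z \<partial>lborel)"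
    using y nn d by (intro gap_PV_le) auto
  moreover have "F \<alpha>1 \<beta> (u y) (v y) \<le> F \<alpha>1 \<beta> (kelvin u y) (kelvin v y)"
    using nn[OF y(1)] y by (intro F_gap_mono) auto
  ultimately show False
    using y by simp
qed

text \<open>If the first difference vanishes identically, its equation compares \<open>F\<close> at
  two second arguments only. Monotonicity gives one inequality and the maximum principle the other;
  strict monotonicity of the coupling then forces equal arguments.\<close>

lemma gap_zero_other:
  assumes eq: "\<And>z. z \<in> pball p \<Longrightarrow> gap u z = 0"
    and nn: "\<And>z. z \<in> pball p \<Longrightarrow> gap v z \<ge> 0"
    and y: "y \<in> pball p"
  shows "gap v y = 0"
proof -
  have yp: "y \<notin> {p}" "y \<notin> bad p" "norm y < 1"
    using y p1 by auto
  let ?f = "\<lambda>z. indicator (ball 0 1 - ball y 1) z * ((gap u z - gap u y) * (ker y z - ker_refl y z))"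
  have "(\<integral>z. ?f z \<partial>lborel) \<ge> 0"
  proof (rule integral_nonneg_AE)
    have "AE z in lborel. z \<notin> bad p"
      by (rule AE_lborel_not_in_finite) simp
    then show "AE z in lborel. ?f z \<ge> 0"
      by eventually_elim (use eq y in \<open>auto simp: indicator_def\<close>)
  qed
  moreover have "F \<alpha>1 \<beta> (kelvin u y) (kelvin v y) - F \<alpha>1 \<beta> (u y) (v y) \<le> gap u y * ext_mass y - (\<integral>z. ?f z \<partial>lborel)"
    using y eq by (intro gap_PV_le) auto
  ultimately have le: "F \<alpha>1 \<beta> (kelvin u y) (kelvin v y) \<le> F \<alpha>1 \<beta> (u y) (v y)"
    using eq[OF y] by simp
  have k: "kelvin u y = u y"
    using eq[OF y] by simp
  have "F \<alpha>1 \<beta> (u y) (v y) \<le> F \<alpha>1 \<beta> (u y) (kelvin v y)"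
    using nn[OF y] solD(1-3,7,8)[OF Su] yp by (intro F_mono) (auto simp: less_imp_le)
  then have "F \<alpha>1 \<beta> (u y) (kelvin v y) = F \<alpha>1 \<beta> (u y) (v y)"
    using le k by simp
  then have "kelvin v y = v y"
    by (rule F_inj_right) (intro solD[OF Su] solD(8)[OF Sk] yp)+
  then show ?thesis
    by simp
qed

text \<open>The difficulty is the exterior mass, as the difference is negative on part of the
  complement. Antisymmetry converts the part outside the unit ball into a reflected integral. What
  remains is a positive integral against the kernel difference, minus a reflected integral over a
  small ball about \<open>q\<close>.\<close>

lemma gap_lower_bound:
  assumes pos: "\<And>z. z \<in> pball p \<Longrightarrow> gap u z > 0" and nn: "\<And>z. z \<in> pball p \<Longrightarrow> gap v z \<ge> 0"
    and q: "norm q < 1"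
  shows "\<exists>r>0. \<exists>c>0. \<forall>z\<in>ball q r - {q}. c \<le> gap u z"
proof -
  obtain \<rho>0 where \<rho>0: "\<rho>0 > 0" "cball q \<rho>0 - {q} \<subseteq> pball p"
    using finite_isolated_ball[of "bad p" "ball 0 1" q] q by auto
  let ?B = "ball 0 1 :: (real ^ 'n) set"
  let ?K = "\<lambda>S. \<integral>z. indicator S z * (gap u z * ker q z) \<partial>lborel"
  let ?R = "\<lambda>S. \<integral>z. indicator S z * (gap u z * ker_refl q z) \<partial>lborel"
  let ?r = "\<lambda>t. \<integral>z. indicator (ball q t) z * (indicator ?B z * (gap u z * ker_refl q z)) \<partial>lborel"
  let ?f = "\<lambda>z. indicator (?B - ball q \<rho>0) z * (gap u z * (ker q z - ker_refl q z))"
  \<comment> \<open>Fixed at the radius \<rho>0; by positivity of the integrand it remains a lower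
    bound for every smaller radius.\<close>
  define m where "m = (\<integral>z. ?f z \<partial>lborel)"
  have ball_sub: "cball q \<rho>0 \<subseteq> ?B"
    using \<rho>0(2) q by auto
  have nonempty: "?B - cball q \<rho>0 \<noteq> {}"
  proof
    assume "?B - cball q \<rho>0 = {}"
    then have "cball q \<rho>0 = ?B"
      using ball_sub by auto
    then have "closed ?B"
      by (metis closed_cball)
    then have "?B = {} \<or> ?B = UNIV"
      using clopen open_ball by blast
    then show False
      using bounded_ball[of "0 :: real ^ 'n" 1] not_bounded_UNIV by (metis centre_in_ball empty_iff zero_less_one)
  qed
  have kk: "ker q z - ker_refl q z > 0" if "z \<in> ?B" "z \<noteq> q" for z
    using that q by (simp add: ker_refl_less)
  have AEbad: "AE z in lborel. z \<notin> bad p"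
    by (rule AE_lborel_not_in_finite) simp
  have m: "m > 0"
    unfolding m_def
  proof (rule integral_lborel_pos[where S = "?B - cball q \<rho>0" and N = "bad p"])
    show "integrable lborel ?f"
      using integrable_gap_ker[OF q \<rho>0(1), of 0] by simp
    show "AE z in lborel. ?f z \<ge> 0"
      using AEbad
    proof eventually_elim
      case (elim z)
      show ?case
      proof (cases "z \<in> ?B - ball q \<rho>0")
        case True
        then have "gap u z * (ker q z - ker_refl q z) > 0"
          using elim \<rho>0(1) by (intro mult_pos_pos pos kk) auto
        then show ?thesis
          using True by simp
      qed simp
    qed
    show "?f z > 0" if "z \<in> ?B - cball q \<rho>0 - bad p" for z
    proof -
      have "gap u z * (ker q z - ker_refl q z) > 0"
        using that \<rho>0(1) by (intro mult_pos_pos pos kk) auto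
      then show ?thesis
        using that by (auto simp: indicator_def)
    qed
  qed (use nonempty in \<open>auto simp: open_Diff\<close>)
  have intB: "integrable lborel (\<lambda>z. indicator ?B z * (gap u z * ker_refl q z))"
    by (rule integrable_ker_refl[OF Lint_gap _ _ q]) auto
  have "\<forall>\<^sub>F n in sequentially. ?r (1 / real (Suc n)) < m"
    using shrinking_integral[OF intB, of q] m by (rule order_tendstoD)
  moreover have "\<forall>\<^sub>F n in sequentially. 1 / real (Suc n) < \<rho>0"
    using lim_1_over_real_power[of 1, simplified, THEN LIMSEQ_Suc] \<rho>0(1) by (rule order_tendstoD)
  ultimately have "\<forall>\<^sub>F n in sequentially. 1 / real (Suc n) < \<rho>0 \<and> ?r (1 / real (Suc n)) < m"
    by eventually_elim auto
  then obtain n where "1 / real (Suc n) < \<rho>0" "?r (1 / real (Suc n)) < m"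
    unfolding eventually_sequentially by blast
  \<comment> \<open>The reflected kernel is integrable against the difference, so its share on a
    small enough ball drops below \<open>m\<close>.\<close>
  then obtain \<rho> where \<rho>: "0 < \<rho>" "\<rho> < \<rho>0" and small: "?r \<rho> < m"
    using that[of "1 / real (Suc n)"] by (metis divide_pos_pos of_nat_0_less_iff zero_less_Suc zero_less_one)
  have sub: "z \<in> pball p" if "z \<in> cball q \<rho> - {q}" for z
  proof -
    have "z \<in> cball q \<rho>0 - {q}"
      using that \<rho>(2) by auto
    then show ?thesis
      using \<rho>0(2) by blast
  qed
  have subB: "ball q \<rho> \<subseteq> ?B"
    using ball_sub \<rho>(2) by (meson ball_subset_cball subset_ball order_trans less_imp_le)
  show ?thesis
  proof (rule singular_lower_bound[OF Lint_gap \<rho>(1)])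
    show "continuous_on (cball q \<rho> - {q}) (gap u)"
      using sub by (intro continuous_on_gap) fastforce
    show "gap u z > 0" if "z \<in> cball q \<rho> - {q}" for z
      using pos sub[OF that] by blast
    show "\<exists>l\<ge>0. PV (\<lambda>z. gap u y - gap u z) y l" if y': "y \<in> ball q \<rho> - {q}" for y
    proof -
      have y: "y \<in> pball p"
        using sub[of y] y' by auto
      have "PV (\<lambda>x. gap u y - gap u x) y (F \<alpha>1 \<beta> (kelvin u y) (kelvin v y) - F \<alpha>1 \<beta> (u y) (v y))"
        using y by (intro PV_gap) auto
      moreover have "F \<alpha>1 \<beta> (u y) (v y) \<le> F \<alpha>1 \<beta> (kelvin u y) (kelvin v y)"
        using pos[OF y] nn[OF y] y by (intro F_gap_mono) auto
      ultimately show ?thesis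
        by (intro exI conjI) auto
    qed
    have iE: "integrable lborel (\<lambda>z. indicator (- ?B) z * (gap u z * ker q z))"
    proof (rule Lint_mult_ker[OF Lint_gap, where e = "1 - norm q"])
      show "norm (q - z) \<ge> 1 - norm q" if "z \<in> - ball 0 1" for z
        using that norm_triangle_ineq4[of q "q - z"] by simp
    qed (use q in auto)
    have iD: "integrable lborel (\<lambda>z. indicator (?B - ball q \<rho>) z * (gap u z * ker q z))"
      by (rule Lint_mult_ker[OF Lint_gap _ \<rho>(1)]) (auto simp: dist_norm)
    have iR: "integrable lborel (\<lambda>z. indicator (?B - ball q \<rho>) z * (gap u z * ker_refl q z))"
      by (rule integrable_ker_refl[OF Lint_gap _ _ q]) auto
    have iS: "integrable lborel (\<lambda>z. indicator (ball q \<rho>) z * (indicator ?B z * (gap u z * ker_refl q z)))"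
    proof -
      have "integrable lborel (\<lambda>z. indicator (ball q \<rho>) z * (gap u z * ker_refl q z))"
        by (rule integrable_ker_refl[OF Lint_gap _ subB q]) auto
      moreover have "(\<lambda>z. indicator (ball q \<rho>) z * (indicator ?B z * (gap u z * ker_refl q z))) = (\<lambda>z. indicator (ball q \<rho>) z * (gap u z * ker_refl q z))"
        using subB by (auto simp: indicator_def fun_eq_iff)
      ultimately show ?thesis
        by (simp only:)
    qed
    have "?K (- ball q \<rho>)
      = (\<integral>z. indicator (?B - ball q \<rho>) z * (gap u z * ker q z) + indicator (- ?B) z * (gap u z * ker q z) \<partial>lborel)"
      by (intro Bochner_Integration.integral_cong) (use subB in \<open>auto simp: indicator_def\<close>)
    also have "\<dots> = ?K (?B - ball q \<rho>) + ?K (- ?B)"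
      by (intro Bochner_Integration.integral_add iD iE)
    also have "?K (- ?B) = - ?R ?B"
      by (rule antisym_exterior[OF Lint_gap gap_inversion q])
    also have "?R ?B
      = (\<integral>z. indicator (?B - ball q \<rho>) z * (gap u z * ker_refl q z) + indicator (ball q \<rho>) z * (indicator ?B z * (gap u z * ker_refl q z)) \<partial>lborel)"
      by (intro Bochner_Integration.integral_cong) (use subB in \<open>auto simp: indicator_def\<close>)
    also have "\<dots> = ?R (?B - ball q \<rho>) + ?r \<rho>"
      by (intro Bochner_Integration.integral_add iR iS)
    finally have *: "?K (- ball q \<rho>) =
       (?K (?B - ball q \<rho>) - ?R (?B - ball q \<rho>))
       - ?r \<rho>"
      by simp
    have "m \<le> (\<integral>z. indicator (?B - ball q \<rho>) z * (gap u z * ker q z) - indicator (?B - ball q \<rho>) z * (gap u z * ker_refl q z) \<partial>lborel)"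
      unfolding m_def
    proof (rule integral_mono_AE)
      show "integrable lborel ?f"
        using integrable_gap_ker[OF q \<rho>0(1), of 0] by simp
      show "integrable lborel (\<lambda>z. indicator (?B - ball q \<rho>) z * (gap u z * ker q z) - indicator (?B - ball q \<rho>) z * (gap u z * ker_refl q z))"
        by (intro Bochner_Integration.integrable_diff iD iR)
      show "AE z in lborel. ?f z \<le> indicator (?B - ball q \<rho>) z * (gap u z * ker q z) - indicator (?B - ball q \<rho>) z * (gap u z * ker_refl q z)"
        using AEbad
      proof eventually_elim
        case (elim z)
        show ?case
        proof (cases "z \<in> ?B - ball q \<rho>")
          case True
          then have "gap u z * (ker q z - ker_refl q z) \<ge> 0"
            using elim \<rho>(1) by (intro less_imp_le[OF mult_pos_pos] pos kk) auto
          then show ?thesis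
            using True \<rho>(2) by (auto simp: indicator_def right_diff_distrib)
        next
          case False
          then show ?thesis
            using \<rho>(2) by (auto simp: indicator_def)
        qed
      qed
    qed
    also have "\<dots> = ?K (?B - ball q \<rho>) - ?R (?B - ball q \<rho>)"
      by (intro Bochner_Integration.integral_diff iD iR)
    finally show "?K (- ball q \<rho>) > 0"
      using * small by simp
  qed
qed

text \<open>At a minimum common to both differences each argument of \<open>F\<close> has dropped by
  at most -\<open>gap u y\<close>, so \<open>F_lower\<close> bounds the loss by
  \<open>lip_coeff\<close> times that amount. The exterior mass multiplies the same negative number,
  and cancelling it reverses the inequality.\<close>

lemma no_negative_minimum:
  assumes y: "y \<in> pball p"
    and min: "\<And>z. z \<in> pball p \<Longrightarrow> gap u y \<le> gap u z \<and> gap u y \<le> gap v z"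
    and neg: "gap u y < 0"
  shows "shell_const * (1 - norm y) powr (- 2 * \<sigma>) \<le> lip_coeff \<alpha>1 \<beta> (u y) (v y)"
proof -
  have yp: "y \<notin> {p}" "y \<notin> bad p" "norm y < 1"
    using y p1 by auto
  let ?f = "\<lambda>z. indicator (ball 0 1 - ball y 1) z * ((gap u z - gap u y) * (ker y z - ker_refl y z))"
  have "(\<integral>z. ?f z \<partial>lborel) \<ge> 0"
  proof (rule integral_nonneg_AE)
    have "AE z in lborel. z \<notin> bad p"
      by (rule AE_lborel_not_in_finite) simp
    then show "AE z in lborel. ?f z \<ge> 0"
    proof eventually_elim
      case (elim z)
      show ?case
      proof (cases "z \<in> ball 0 1 - ball y 1")
        case True
        then have "ker_refl y z < ker y z"
          using yp by (intro ker_refl_less) auto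
        then show ?thesis
          using True min[of z] elim by (intro mult_nonneg_nonneg) auto
      qed simp
    qed
  qed
  moreover have "F \<alpha>1 \<beta> (kelvin u y) (kelvin v y) - F \<alpha>1 \<beta> (u y) (v y) \<le> gap u y * ext_mass y - (\<integral>z. ?f z \<partial>lborel)"
    using y min neg by (intro gap_PV_le) auto
  moreover have "F \<alpha>1 \<beta> (u y) (v y) + gap u y * lip_coeff \<alpha>1 \<beta> (u y) (v y) \<le> F \<alpha>1 \<beta> (kelvin u y) (kelvin v y)"
  proof -
    have "F \<alpha>1 \<beta> (u y) (v y) - (- gap u y) * lip_coeff \<alpha>1 \<beta> (u y) (v y) \<le> F \<alpha>1 \<beta> (kelvin u y) (kelvin v y)"
      using min[OF y] neg by (intro F_lower solD[OF Su] solD[OF Sk] yp) auto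
    then show ?thesis
      by (simp only: mult_minus_left diff_minus_eq_add)
  qed
  ultimately have "gap u y * lip_coeff \<alpha>1 \<beta> (u y) (v y) \<le> gap u y * ext_mass y"
    by linarith
  then have "ext_mass y \<le> lip_coeff \<alpha>1 \<beta> (u y) (v y)"
    using neg by (subst (asm) mult_le_cancel_left_neg) auto
  then show ?thesis
    using ext_mass_ge[OF yp(3)] by linarith
qed

end

text \<open>Minimising the smaller of the two differences yields a minimum common to both; whichever
  component attains it contradicts \<open>no_negative_minimum\<close>, up to exchanging roles. The
  unit sphere may belong to \<open>C\<close>, for compactness, because both differences vanish on
  it.\<close>

lemma narrow_region:
  assumes U: "usol \<alpha>1 \<alpha>2 \<beta> p u v"
    and C: "compact C" "C \<subseteq> cball 0 1 - bad p"
    and coeff: "\<And>y. y \<in> C \<Longrightarrow> norm y < 1 \<Longrightarrow>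
       max_lip \<alpha>1 \<alpha>2 \<beta> (u y) (v y)
         < shell_const * (1 - norm y) powr (- 2 * \<sigma>)"
    and out: "\<And>z. z \<in> pball p - C \<Longrightarrow> gap u z \<ge> 0 \<and> gap v z \<ge> 0"
    and z: "z \<in> pball p"
  shows "gap u z \<ge> 0 \<and> gap v z \<ge> 0"
proof (rule ccontr)
  define g where "g z = min (gap u z) (gap v z)" for z
  assume "\<not> ?thesis"
  then have gz: "g z < 0"
    by (auto simp: g_def)
  have zC: "z \<in> C"
  proof (rule ccontr)
    assume "z \<notin> C"
    then have "gap u z \<ge> 0 \<and> gap v z \<ge> 0"
      using z by (intro out) blast
    then show False
      using gz by (auto simp: g_def min_def split: if_splits)
  qed
  have V: "usol \<alpha>2 \<alpha>1 \<beta> p v u"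
    using U by (rule usol_swap)
  have "continuous_on C g"
    unfolding g_def using C(2) by (intro continuous_on_min continuous_on_gap[OF U] continuous_on_gap[OF V])
  then obtain y where y: "y \<in> C" "\<And>x. x \<in> C \<Longrightarrow> g y \<le> g x"
    using continuous_attains_inf[OF C(1), of g] zC by blast
  have gy: "g y < 0"
    using y(2)[OF zC] gz by simp
  have min: "g y \<le> g x" if "x \<in> pball p" for x
    using y(2)[of x] out[of x] that gy by (cases "x \<in> C") (auto simp: g_def)
  have "norm y \<noteq> 1"
  proof
    assume "norm y = 1"
    then have "inversion y = y"
      by (simp add: inversion_def)
    then have "gap u y = 0" "gap v y = 0"
      using \<open>norm y = 1\<close> by (auto simp: kelvin_def)
    then show False
      using gy by (simp add: g_def)
  qed
  then have y1: "norm y < 1"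
    using y(1) C(2) by force
  have yB: "y \<in> pball p"
    using y(1) y1 C(2) by auto
  show False
  proof (cases "gap u y \<le> gap v y")
    case True
    then have "shell_const * (1 - norm y) powr (- 2 * \<sigma>) \<le> lip_coeff \<alpha>1 \<beta> (u y) (v y)"
      using min gy by (intro no_negative_minimum[OF U yB]) (auto simp: g_def)
    then show False
      using coeff[OF y(1) y1] unfolding max_lip_def by linarith
  next
    case False
    then have "shell_const * (1 - norm y) powr (- 2 * \<sigma>) \<le> lip_coeff \<alpha>2 \<beta> (v y) (u y)"
      using min gy by (intro no_negative_minimum[OF V yB]) (auto simp: g_def)
    then show False
      using coeff[OF y(1) y1] unfolding max_lip_def by linarith
  qed
qed

end

section \<open>Moving the spheres\<close>

lemma continuous_ball_bdd_above:
  fixes w :: "'a::euclidean_space \<Rightarrow> real"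
  assumes "continuous_on (ball 0 r) w" "R < r"
  shows "\<exists>M. \<forall>y\<in>cball 0 R. w y \<le> M"
proof -
  have "continuous_on (cball 0 R) w"
    using assms(2) by (intro continuous_on_subset[OF assms(1)]) auto
  then have "bounded (w ` cball 0 R)"
    by (intro compact_imp_bounded compact_continuous_image) auto
  then obtain M where M: "\<forall>x\<in>w ` cball 0 R. norm x \<le> M"
    unfolding bounded_iff by blast
  have "w y \<le> M" if "y \<in> cball 0 R" for y
  proof -
    have "norm (w y) \<le> M"
      using M that by blast
    then show ?thesis
      unfolding real_norm_def by linarith
  qed
  then show ?thesis
    by blast
qed

context frac
begin

section \<open>Spheres of arbitrary radius about the origin, with the singularity at
  \<open>p\<close>\<close>

definition dil :: "real \<Rightarrow> (real ^ 'n \<Rightarrow> real) \<Rightarrow> real ^ 'n \<Rightarrow> real" where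
  "dil lam u z = lam powr (a / 2) * u (lam *\<^sub>R z)"

lemma usol_dil:
  assumes S: "sol \<alpha>1 \<alpha>2 \<beta> {p} u v" and l: "0 < lam" "lam < norm p"
  shows "usol \<alpha>1 \<alpha>2 \<beta> (p /\<^sub>R lam) (dil lam u) (dil lam v)"
  using sol_affine[OF S l(1), of 0] l unfolding usol_def dil_def[abs_def]
  by (simp add: field_simps)

lemma inversion_scaleR: "inversion (c *\<^sub>R z) = inversion z /\<^sub>R c"
  by (cases "c = 0") (simp_all add: inversion_def power_mult_distrib power2_eq_square[of c])

lemma gap_dil:
  assumes z: "z \<noteq> 0" and l: "lam > 0"
  shows "gap (dil lam u) (lam *\<^sub>R z) = lam powr (- a / 2) * (kelvin u z - lam powr a * u (lam\<^sup>2 *\<^sub>R z))"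
proof -
  have 1: "lam powr - a * lam powr (a / 2) = lam powr (- a / 2)" "lam powr (- a / 2) * lam powr a = lam powr (a / 2)"
    by (simp_all add: powr_add[symmetric])
  have "kelvin (dil lam u) (lam *\<^sub>R z) = (lam powr - a * lam powr (a / 2)) * kelvin u z"
    using l by (simp add: kelvin_def dil_def inversion_scaleR powr_mult)
  moreover have "dil lam u (lam *\<^sub>R z) = (lam powr (- a / 2) * lam powr a) * u (lam\<^sup>2 *\<^sub>R z)"
    unfolding 1 by (simp add: dil_def power2_eq_square)
  ultimately show ?thesis
    unfolding 1(1) by (simp only: right_diff_distrib mult.assoc)
qed

lemma lip_coeff_dil:
  assumes l: "lam > 0" and pos: "u (lam *\<^sub>R y) > 0" "v (lam *\<^sub>R y) > 0"
  shows "lip_coeff \<alpha> \<beta> (dil lam u y) (dil lam v y) = lam powr (2 * \<sigma>) * lip_coeff \<alpha> \<beta> (u (lam *\<^sub>R y)) (v (lam *\<^sub>R y))"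
proof -
  define t where "t = lam powr (a / 2)"
  have t: "t > 0"
    using l by (simp add: t_def)
  have "t powr (s / a) = lam powr (s / 2)"
    using a_pos by (simp add: t_def powr_powr)
  also have "s / 2 = 2 * \<sigma> + a / 2"
    by (simp add: s_def a_def field_simps)
  finally have e: "t powr (s / a) = lam powr (2 * \<sigma>) * t"
    by (simp add: powr_add t_def)
  have m: "min (t * x) (t * y) = t * min x y" for x y
    using t by (simp add: min_mult_distrib_left)
  show ?thesis
    using t pos unfolding dil_def t_def[symmetric] lip_coeff_def F_scale m e by simp
qed

text \<open>The outer point \<open>inversion z\<close> is fixed, and its mirror image in the sphere
  of radius \<open>lam\<close> is lam^2 z. The side that may be singular thus does not depend on
  \<open>lam\<close>.\<close>

abbreviation refl_le :: "(real ^ 'n \<Rightarrow> real) \<Rightarrow> real \<Rightarrow> real ^ 'n \<Rightarrow> bool" where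
  "refl_le u lam z \<equiv> lam powr a * u (lam\<^sup>2 *\<^sub>R z) \<le> kelvin u z"

definition reflected_le :: "real ^ 'n \<Rightarrow> (real ^ 'n \<Rightarrow> real) \<Rightarrow> (real ^ 'n \<Rightarrow> real) \<Rightarrow> real \<Rightarrow> bool" where
  "reflected_le p u v lam \<longleftrightarrow> (\<forall>z\<in>ball 0 (1 / lam) - bad p.
     refl_le u lam z \<and> refl_le v lam z)"

lemma ball_bad_scale:
  assumes l: "lam > 0"
  shows "lam *\<^sub>R z \<in> pball (p /\<^sub>R lam) \<longleftrightarrow> z \<in> ball 0 (1 / lam) - bad p"
proof -
  have "lam *\<^sub>R z = inversion (p /\<^sub>R lam) \<longleftrightarrow> z = inversion p"
    using l by (simp add: inversion_scaleR)
  then show ?thesis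
    using l by (auto simp: field_simps)
qed

lemma gap_dil_nonneg_iff:
  assumes "z \<noteq> 0" "lam > 0"
  shows "gap (dil lam u) (lam *\<^sub>R z) \<ge> 0 \<longleftrightarrow> refl_le u lam z"
  unfolding gap_dil[OF assms] using assms by (simp add: zero_le_mult_iff)

lemma reflected_le_iff:
  assumes l: "lam > 0"
  shows "reflected_le p u v lam \<longleftrightarrow> (\<forall>y\<in>pball (p /\<^sub>R lam). gap (dil lam u) y \<ge> 0 \<and> gap (dil lam v) y \<ge> 0)"
proof
  assume *: "reflected_le p u v lam"
  show "\<forall>y\<in>pball (p /\<^sub>R lam). gap (dil lam u) y \<ge> 0 \<and> gap (dil lam v) y \<ge> 0"
  proof
    fix y assume y: "y \<in> pball (p /\<^sub>R lam)"
    define z where "z = y /\<^sub>R lam"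
    have yz: "y = lam *\<^sub>R z"
      using l by (simp add: z_def)
    have "z \<in> ball 0 (1 / lam) - bad p"
      using y unfolding yz ball_bad_scale[OF l] .
    then show "gap (dil lam u) y \<ge> 0 \<and> gap (dil lam v) y \<ge> 0"
      using * l unfolding yz reflected_le_def by (subst (1 2) gap_dil_nonneg_iff) auto
  qed
next
  assume *: "\<forall>y\<in>pball (p /\<^sub>R lam). gap (dil lam u) y \<ge> 0 \<and> gap (dil lam v) y \<ge> 0"
  show "reflected_le p u v lam"
    unfolding reflected_le_def
  proof
    fix z assume z: "z \<in> ball 0 (1 / lam) - bad p"
    then have "lam *\<^sub>R z \<in> pball (p /\<^sub>R lam)"
      unfolding ball_bad_scale[OF l] .
    then have "gap (dil lam u) (lam *\<^sub>R z) \<ge> 0 \<and> gap (dil lam v) (lam *\<^sub>R z) \<ge> 0"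
      using * by blast
    moreover have "z \<noteq> 0"
      using z by simp
    ultimately show "refl_le u lam z \<and> refl_le v lam z"
      using gap_dil_nonneg_iff[OF _ l] by blast
  qed
qed

text \<open>\<open>d\<close> is the width, in the original scale, of a shell in which the exterior
  mass beats a coefficient bounded by \<open>A\<close>. The 2 in \<open>k\<close> makes the
  inequality strict.\<close>

lemma thin_width:
  fixes A :: real
  assumes "A > 0"
  obtains d where "d > 0" "d powr (2 * \<sigma>) * A < shell_const"
proof
  define k where "k = shell_const / (2 * A)"
  have k: "k > 0"
    using assms shell_const_pos by (simp add: k_def)
  then show "k powr (1 / (2 * \<sigma>)) > 0"
    by simp
  have "(k powr (1 / (2 * \<sigma>))) powr (2 * \<sigma>) = k"
    using \<sigma> k by (simp add: powr_powr)
  then show "(k powr (1 / (2 * \<sigma>))) powr (2 * \<sigma>) * A < shell_const"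
    using assms shell_const_pos by (simp add: k_def)
qed

context
  fixes \<alpha>1 \<alpha>2 \<beta> p u v
  assumes S: "sol \<alpha>1 \<alpha>2 \<beta> {p} u v" and p0: "p \<noteq> 0"
begin

lemma continuous_on_ball_u: "continuous_on (ball 0 (norm p)) u" "continuous_on (ball 0 (norm p)) v"
  using sol_continuous_on[OF S, of "ball 0 (norm p)"] sol_continuous_on[OF sol_swap[OF S], of "ball 0 (norm p)"]
  by auto

lemma lip_coeff_bounded:
  assumes "R < norm p"
  shows "\<exists>A>0. \<forall>y\<in>cball 0 R. max_lip \<alpha>1 \<alpha>2 \<beta> (u y) (v y) \<le> A"
proof -
  let ?g = "\<lambda>y. max_lip \<alpha>1 \<alpha>2 \<beta> (u y) (v y)"
  obtain R' where R': "R < R'" "R' < norm p"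
    using dense[OF assms] by blast
  have sub: "ball 0 R' \<subseteq> ball 0 (norm p)"
    using R' by auto
  have c: "continuous_on (ball 0 R') u" "continuous_on (ball 0 R') v"
    using continuous_on_ball_u sub by (auto elim: continuous_on_subset)
  have "y \<notin> {p}" if "y \<in> ball 0 R'" for y
    using that R' by auto
  then have pos: "u y > 0" "v y > 0" if "y \<in> ball 0 R'" for y
    using solD(7,8)[OF S] that by blast+
  have nz: "u y \<noteq> 0" "v y \<noteq> 0" "min (u y) (v y) \<noteq> 0" "min (v y) (u y) \<noteq> 0" if "y \<in> ball 0 R'" for y
    using pos[OF that] by (auto simp: min_def)
  have "continuous_on (ball 0 R') ?g"
    unfolding max_lip_def lip_coeff_def F_def
    by (intro continuous_intros c ballI nz)
  then obtain A where A: "\<forall>y\<in>cball 0 R. ?g y \<le> A"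
    using continuous_ball_bdd_above[OF _ R'(1)] by blast
  then have "\<forall>y\<in>cball 0 R. ?g y \<le> max A 1"
    by (meson le_max_iff_disj)
  moreover have "max A 1 > 0"
    by simp
  ultimately show ?thesis
    by blast
qed

text \<open>The reflection inequality has to be checked only for |z| < \<rho>. The rest of the ball
  is a shell of width at most \<open>d\<close> in the original scale, to which
  \<open>narrow_region\<close> applies. The bound 1/|p| < \<rho> puts both exceptional points into
  the inner part.\<close>

lemma reflected_le_criterion:
  assumes R: "R < norm p" and A: "\<forall>y\<in>cball 0 R. max_lip \<alpha>1 \<alpha>2 \<beta> (u y) (v y) \<le> A" "A > 0"
    and d: "d powr (2 * \<sigma>) * A < shell_const" "d > 0"
    and l: "0 < lam" "lam \<le> R" and \<rho>: "1 / norm p < \<rho>" and thin: "lam * (1 - lam * \<rho>) \<le> d"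
    and inner: "\<And>z. z \<in> ball 0 \<rho> - bad p \<Longrightarrow> refl_le u lam z \<and> refl_le v lam z"
  shows "reflected_le p u v lam"
  unfolding reflected_le_iff[OF l(1)]
proof
  fix y assume y: "y \<in> pball (p /\<^sub>R lam)"
  have lp: "lam < norm p"
    using l R by simp
  have \<rho>0: "\<rho> > 0"
    using \<rho> by (smt (verit) divide_nonneg_nonneg norm_ge_zero)
  let ?C = "cball 0 1 - ball 0 (lam * \<rho>) :: (real ^ 'n) set"
  show "gap (dil lam u) y \<ge> 0 \<and> gap (dil lam v) y \<ge> 0"
  proof (rule narrow_region[OF usol_dil[OF S l(1) lp] _ _ _ _ y])
    show "compact ?C"
      by (intro compact_diff) auto
    have "norm (inversion (p /\<^sub>R lam)) < lam * \<rho>"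
      using mult_strict_left_mono[OF \<rho> l(1)] l by (simp add: field_simps)
    then show "?C \<subseteq> cball 0 1 - bad (p /\<^sub>R lam)"
      using \<rho>0 l by auto
  next
    fix y assume yC: "y \<in> ?C" and y1: "norm y < 1"
    have ly: "lam *\<^sub>R y \<in> cball 0 R"
      using l y1 mult_mono[of lam R "norm y" 1] by simp
    then have "lam *\<^sub>R y \<notin> {p}"
      using R by auto
    then have pos: "u (lam *\<^sub>R y) > 0" "v (lam *\<^sub>R y) > 0"
      using solD(7,8)[OF S] by blast+
    have w: "0 < 1 - norm y" "lam * (1 - norm y) \<le> d"
    proof -
      have "lam * (1 - norm y) \<le> lam * (1 - lam * \<rho>)"
        using yC l by (intro mult_left_mono) auto
      then show "lam * (1 - norm y) \<le> d"
        using thin by simp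
    qed (use y1 in simp)
    \<comment> \<open>The factor lam^(2\<sigma>) gained by \<open>lip_coeff\<close> under dilation
      turns 1 - |y| into the distance to the sphere in the original scale.\<close>
    have "lam powr (2 * \<sigma>) * (1 - norm y) powr (2 * \<sigma>) = (lam * (1 - norm y)) powr (2 * \<sigma>)"
      by (simp add: powr_mult)
    also have "\<dots> \<le> d powr (2 * \<sigma>)"
      using w l \<sigma> by (intro powr_mono2) auto
    finally have "lam powr (2 * \<sigma>) * (1 - norm y) powr (2 * \<sigma>) * A \<le> d powr (2 * \<sigma>) * A"
      using A(2) by (intro mult_right_mono) auto
    also have "\<dots> < shell_const"
      by (rule d(1))
    finally have "lam powr (2 * \<sigma>) * A < shell_const * (1 - norm y) powr (- 2 * \<sigma>)"
      using w(1) by (simp add: powr_minus field_simps)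
    moreover have "max_lip \<alpha>1 \<alpha>2 \<beta> (dil lam u y) (dil lam v y) \<le> lam powr (2 * \<sigma>) * A"
    proof -
      have "lip_coeff \<alpha>1 \<beta> (u (lam *\<^sub>R y)) (v (lam *\<^sub>R y)) \<le> A" "lip_coeff \<alpha>2 \<beta> (v (lam *\<^sub>R y)) (u (lam *\<^sub>R y)) \<le> A"
        using A(1) ly unfolding max_lip_def by (metis max.bounded_iff)+
      then show ?thesis
        unfolding max_lip_def lip_coeff_dil[of lam u y v, OF l(1) pos] lip_coeff_dil[of lam v y u, OF l(1) pos(2,1)]
        by (intro max.boundedI mult_left_mono) auto
    qed
    ultimately show "max_lip \<alpha>1 \<alpha>2 \<beta> (dil lam u y) (dil lam v y) < shell_const * (1 - norm y) powr (- 2 * \<sigma>)"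
      by (rule order.strict_trans1[rotated])
  next
    fix y assume y: "y \<in> pball (p /\<^sub>R lam) - ?C"
    define z where "z = y /\<^sub>R lam"
    have yz: "y = lam *\<^sub>R z"
      using l by (simp add: z_def)
    have zb: "z \<in> ball 0 (1 / lam) - bad p"
      using y ball_bad_scale[OF l(1), of z p] unfolding yz by blast
    moreover have "norm z < \<rho>"
    proof -
      have "norm y < lam * \<rho>"
        using y by auto
      then show ?thesis
        using l unfolding yz by simp
    qed
    ultimately have "refl_le u lam z \<and> refl_le v lam z"
      by (intro inner) auto
    moreover have "z \<noteq> 0"
      using zb by auto
    ultimately show "gap (dil lam u) y \<ge> 0 \<and> gap (dil lam v) y \<ge> 0"
      unfolding yz using gap_dil_nonneg_iff[OF _ l(1)] by blast
  qed
qed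

text \<open>On a fixed ball the Kelvin transforms have a positive lower bound, while the moving term
  carries lam^a times a bounded value and becomes smaller. The remaining shell has width at most
  \<open>lam\<close>.\<close>

lemma reflected_le_start: "\<exists>lam0>0. \<forall>lam. 0 < lam \<and> lam < lam0 \<longrightarrow> reflected_le p u v lam"
proof -
  define R where "R = norm p / 2"
  have R: "0 < R" "R < norm p"
    using p0 by (auto simp: R_def)
  obtain A where A: "A > 0" "\<forall>y\<in>cball 0 R. max_lip \<alpha>1 \<alpha>2 \<beta> (u y) (v y) \<le> A"
    using lip_coeff_bounded[OF R(2)] by blast
  obtain d where d: "d > 0" "d powr (2 * \<sigma>) * A < shell_const"
    using thin_width[OF A(1)] by blast
  have Sk: "sol \<alpha>1 \<alpha>2 \<beta> (bad p) (kelvin u) (kelvin v)"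
    using sol_kelvin[OF S] by simp
  obtain c1 where c1: "c1 > 0" "\<forall>z\<in>cball 0 (1 / R) - bad p. c1 \<le> kelvin u z"
    using compact_punctured_lower_bound[of "cball 0 (1 / R)" "bad p" "kelvin u"] sol_lower_bound[OF Sk] by auto
  obtain c2 where c2: "c2 > 0" "\<forall>z\<in>cball 0 (1 / R) - bad p. c2 \<le> kelvin v z"
    using compact_punctured_lower_bound[of "cball 0 (1 / R)" "bad p" "kelvin v"] sol_lower_bound[OF sol_swap[OF Sk]] by auto
  have "\<exists>M. \<forall>y\<in>cball 0 R. u y \<le> M" "\<exists>M. \<forall>y\<in>cball 0 R. v y \<le> M"
    by (intro continuous_ball_bdd_above[OF _ R(2)] continuous_on_ball_u)+
  then obtain M1 M2 where M: "\<forall>y\<in>cball 0 R. u y \<le> M1" "\<forall>y\<in>cball 0 R. v y \<le> M2"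
    by blast
  define M where "M = max 1 (max M1 M2)"
  define c where "c = min c1 c2"
  have c: "c > 0"
    using c1 c2 by (simp add: c_def)
  have M1: "M > 0"
    by (simp add: M_def)
  \<comment> \<open>\<open>R\<close> keeps the mirror points in the compact ball where
    \<open>u\<close> and \<open>v\<close> are bounded, \<open>d\<close> makes the shell thin, and
    the last bound gives \<open>lam powr a * M \<le> c\<close>.\<close>
  define lam0 where "lam0 = min R (min d ((c / M) powr (1 / a)))"
  have "lam0 > 0"
    using R d c M1 by (simp add: lam0_def)
  moreover have "reflected_le p u v lam" if l: "0 < lam" "lam < lam0" for lam
  proof (rule reflected_le_criterion[OF R(2) A(2,1) d(2,1) l(1)])
    show "lam \<le> R"
      using l by (simp add: lam0_def)
    show "1 / norm p < 1 / R"
      using R by (intro divide_strict_left_mono mult_pos_pos) auto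
    have "lam * (1 - lam * (1 / R)) \<le> lam * 1"
      using l R by (intro mult_left_mono) auto
    also have "lam * 1 \<le> d"
      using l by (simp add: lam0_def)
    finally show "lam * (1 - lam * (1 / R)) \<le> d" .
    fix z assume z: "z \<in> ball 0 (1 / R) - bad p"
    have "lam powr a \<le> ((c / M) powr (1 / a)) powr a"
      using l a_pos by (intro powr_mono2) (auto simp: lam0_def)
    also have "\<dots> = c / M"
      using a_pos c M1 by (simp add: powr_powr)
    finally have lM: "lam powr a * M \<le> c"
      using M1 by (simp add: field_simps)
    have "lam * lam \<le> R * R"
      using l R by (intro mult_mono) (auto simp: lam0_def)
    then have "lam * lam * norm z \<le> R * R * (1 / R)"
      using z R by (rule_tac mult_mono) auto
    then have "norm (lam\<^sup>2 *\<^sub>R z) \<le> R * R * (1 / R)"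
      by (simp add: power2_eq_square)
    then have in_R: "lam\<^sup>2 *\<^sub>R z \<in> cball 0 R"
      using R by simp
    have "lam powr a * u (lam\<^sup>2 *\<^sub>R z) \<le> lam powr a * M" "lam powr a * v (lam\<^sup>2 *\<^sub>R z) \<le> lam powr a * M"
      using M in_R by (auto intro!: mult_left_mono simp: M_def le_max_iff_disj)
    moreover have "c \<le> kelvin u z" "c \<le> kelvin v z"
      using z c1(2) c2(2) by (auto simp: c_def min_le_iff_disj)
    ultimately show "refl_le u lam z \<and> refl_le v lam z"
      using lM by linarith
  qed
  ultimately show ?thesis
    by blast
qed

text \<open>The balls of radius 1/\<mu> shrink as \<mu> grows, so a point admissible for
  \<open>lam\<close> is admissible for every smaller radius, and the inequality passes to the limit
  in its regular term.\<close>

lemma reflected_le_limit: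
  assumes l: "0 < lam" "lam < norm p" and below: "\<And>\<mu>. 0 < \<mu> \<Longrightarrow> \<mu> < lam \<Longrightarrow> reflected_le p u v \<mu>"
  shows "reflected_le p u v lam"
  unfolding reflected_le_def
proof
  fix z assume z: "z \<in> ball 0 (1 / lam) - bad p"
  have nz: "norm (lam\<^sup>2 *\<^sub>R z) < norm p"
  proof -
    have "norm (lam\<^sup>2 *\<^sub>R z) = lam * (lam * norm z)"
      by (simp add: power2_eq_square)
    also have "\<dots> \<le> lam * 1"
      using z l by (intro mult_left_mono) (auto simp: field_simps)
    finally show ?thesis
      using l by simp
  qed
  have lim: "((\<lambda>\<mu>. \<mu> powr a * w (\<mu>\<^sup>2 *\<^sub>R z)) \<longlongrightarrow> lam powr a * w (lam\<^sup>2 *\<^sub>R z)) (at_left lam)"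
    if "continuous_on (ball 0 (norm p)) w" for w
  proof -
    have "isCont w (lam\<^sup>2 *\<^sub>R z)"
      using that nz by (intro continuous_on_interior[of "ball 0 (norm p)"]) auto
    then have "((\<lambda>\<mu>. w (\<mu>\<^sup>2 *\<^sub>R z)) \<longlongrightarrow> w (lam\<^sup>2 *\<^sub>R z)) (at_left lam)"
      by (rule isCont_tendsto_compose) (intro tendsto_intros)
    then show ?thesis
      using l by (intro tendsto_intros) auto
  qed
  have ev: "\<forall>\<^sub>F \<mu> in at_left lam. 0 < \<mu> \<and> \<mu> < lam"
    using l by (auto simp: eventually_at_left_field intro!: exI[of _ 0])
  then have "\<forall>\<^sub>F \<mu> in at_left lam. refl_le u \<mu> z \<and> refl_le v \<mu> z"
  proof eventually_elim
    case (elim \<mu>)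
    then have "1 / lam < 1 / \<mu>"
      by (simp add: field_simps)
    then have "z \<in> ball 0 (1 / \<mu>) - bad p"
      using z by auto
    then show ?case
      using below[of \<mu>] elim unfolding reflected_le_def by blast
  qed
  then have "\<forall>\<^sub>F \<mu> in at_left lam. refl_le u \<mu> z" "\<forall>\<^sub>F \<mu> in at_left lam. refl_le v \<mu> z"
    by (auto elim: eventually_mono)
  then show "refl_le u lam z \<and> refl_le v lam z"
    by (intro conjI tendsto_upperbound[OF lim] continuous_on_ball_u) (auto simp: trivial_limit_at_left_real)
qed

end

text \<open>Equality in the reflection inequality would bound \<open>u\<close> and \<open>v\<close> near the singularity \<open>p\<close>,
  which the reflection moves to a regular point.\<close>

lemma gap_dil_zero_imp_bounded:
  assumes S: "sol \<alpha>1 \<alpha>2 \<beta> {p} u v" and l: "0 < lam" "lam < norm p"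
    and zero: "\<And>y. y \<in> pball (p /\<^sub>R lam) \<Longrightarrow> gap (dil lam u) y = 0"
  shows "\<exists>M. \<exists>r>0. \<forall>x\<in>ball p r - {p}. u x \<le> M"
proof -
  define g where "g x = norm x powr - a * (lam powr a * u (lam\<^sup>2 *\<^sub>R inversion x))" for x
  have p0: "p \<noteq> 0"
    using l by auto
  have "norm (lam\<^sup>2 *\<^sub>R inversion p) < norm p"
  proof -
    have "lam * lam < norm p * norm p"
      using l by (intro mult_strict_mono) auto
    then show ?thesis
      using p0 by (simp add: power2_eq_square field_simps)
  qed
  then have "lam\<^sup>2 *\<^sub>R inversion p \<notin> {p}"
    by (metis singletonD order_less_irrefl)
  then have "isCont u (lam\<^sup>2 *\<^sub>R inversion p)"
    by (rule sol_isCont[OF S])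
  moreover have "isCont inversion p"
    using inversion_has_derivative[OF p0, of UNIV] has_derivative_continuous by blast
  ultimately have "isCont g p"
    unfolding g_def using p0
    by (intro continuous_intros isCont_o2[of p "\<lambda>x. lam\<^sup>2 *\<^sub>R inversion x" u]) auto
  then have "\<forall>\<^sub>F x in at p. g x < g p + 1"
    unfolding isCont_def by (rule order_tendstoD) simp
  then obtain r where r: "r > 0" "\<And>x. x \<noteq> p \<Longrightarrow> dist x p < r \<Longrightarrow> g x < g p + 1"
    unfolding eventually_at by blast
  have "u x \<le> g p + 1" if x: "x \<in> ball p (min r (norm p - lam)) - {p}" for x
  proof -
    have "dist p x < norm p - lam"
      using x by simp
    then have nx: "norm x > lam"
      using norm_triangle_ineq[of "p - x" x] by (simp add: dist_norm)
    then have x0: "x \<noteq> 0"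
      using l by auto
    have "inversion x \<in> ball 0 (1 / lam) - bad p"
      using nx x x0 l by (auto simp: field_simps inversion_eq_iff)
    then have "lam *\<^sub>R inversion x \<in> pball (p /\<^sub>R lam)"
      unfolding ball_bad_scale[OF l(1)] .
    then have "gap (dil lam u) (lam *\<^sub>R inversion x) = 0"
      by (rule zero)
    then have "kelvin u (inversion x) = lam powr a * u (lam\<^sup>2 *\<^sub>R inversion x)"
      using gap_dil[of "inversion x" lam u] x0 l by simp
    then have "norm x powr a * u x = lam powr a * u (lam\<^sup>2 *\<^sub>R inversion x)"
      using x0 by (simp add: kelvin_def powr_divide powr_minus)
    then have "g x = (norm x powr - a * norm x powr a) * u x"
      by (simp add: g_def)
    then have "u x = g x"
      using x0 by (simp add: powr_minus)
    then show ?thesis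
      using r(2)[of x] x by (auto simp: dist_commute)
  qed
  then show ?thesis
    using r(1) l by (intro exI[of _ "g p + 1"] exI[of _ "min r (norm p - lam)"]) auto
qed

context
  fixes \<alpha>1 \<alpha>2 \<beta> p u v
  assumes S: "sol \<alpha>1 \<alpha>2 \<beta> {p} u v" and p0: "p \<noteq> 0"
    and sing: "\<not> (\<exists>M. \<exists>r>0. \<forall>x\<in>ball p r - {p}. u x \<le> M \<and> v x \<le> M)"
begin

text \<open>One zero of one difference makes that difference, and then the other, vanish
  identically. Both components would then be bounded near \<open>p\<close>, contrary to
  \<open>sing\<close>, which excludes a common bound.\<close>

lemma gap_dil_pos:
  assumes l: "0 < lam" "lam < norm p" and le: "reflected_le p u v lam"
    and y: "y \<in> pball (p /\<^sub>R lam)"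
  shows "gap (dil lam u) y > 0 \<and> gap (dil lam v) y > 0"
proof (rule ccontr)
  have U: "usol \<alpha>1 \<alpha>2 \<beta> (p /\<^sub>R lam) (dil lam u) (dil lam v)"
    by (rule usol_dil[OF S l])
  note V = usol_swap[OF U]
  have nn: "gap (dil lam u) z \<ge> 0 \<and> gap (dil lam v) z \<ge> 0" if "z \<in> pball (p /\<^sub>R lam)" for z
    using le that unfolding reflected_le_iff[OF l(1)] by blast
  assume "\<not> ?thesis"
  then consider "gap (dil lam u) y = 0" | "gap (dil lam v) y = 0"
    using nn[OF y] by fastforce
  then have zero: "gap (dil lam u) z = 0 \<and> gap (dil lam v) z = 0" if z: "z \<in> pball (p /\<^sub>R lam)" for z
  proof cases
    case 1
    have u: "gap (dil lam u) z = 0" if "z \<in> pball (p /\<^sub>R lam)" for z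
      using nn that by (intro gap_zero_propagates[OF U y 1]) auto
    then show ?thesis
      using nn z gap_zero_other[OF U] by blast
  next
    case 2
    have v: "gap (dil lam v) z = 0" if "z \<in> pball (p /\<^sub>R lam)" for z
      using nn that by (intro gap_zero_propagates[OF V y 2]) auto
    then show ?thesis
      using nn z gap_zero_other[OF V] by blast
  qed
  obtain M1 r1 where 1: "r1 > 0" "\<forall>x\<in>ball p r1 - {p}. u x \<le> M1"
    using gap_dil_zero_imp_bounded[OF S l] zero by blast
  obtain M2 r2 where 2: "r2 > 0" "\<forall>x\<in>ball p r2 - {p}. v x \<le> M2"
    using gap_dil_zero_imp_bounded[OF sol_swap[OF S] l] zero by blast
  have "\<forall>x\<in>ball p (min r1 r2) - {p}. u x \<le> max M1 M2 \<and> v x \<le> max M1 M2"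
    using 1(2) 2(2) by (auto simp: le_max_iff_disj)
  then show False
    using sing 1(1) 2(1) by (metis min_less_iff_conj)
qed

text \<open>Strict positivity becomes a uniform margin by compactness, even across the exceptional
  points, where \<open>gap_lower_bound\<close> replaces continuity.\<close>

lemma reflected_gap_lower_bound:
  assumes l: "0 < lam" "lam < norm p" and le: "reflected_le p u v lam" and \<rho>: "\<rho> < 1 / lam"
  shows "\<exists>c>0. \<forall>z\<in>cball 0 \<rho> - bad p. c \<le> kelvin u z - lam powr a * u (lam\<^sup>2 *\<^sub>R z)"
proof (rule compact_punctured_lower_bound)
  define f where "f z = kelvin u z - lam powr a * u (lam\<^sup>2 *\<^sub>R z)" for z
  have U: "usol \<alpha>1 \<alpha>2 \<beta> (p /\<^sub>R lam) (dil lam u) (dil lam v)"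
    by (rule usol_dil[OF S l])
  have fgap: "f z = lam powr (a / 2) * gap (dil lam u) (lam *\<^sub>R z)" if "z \<noteq> 0" for z
  proof -
    have "lam powr (a / 2) * lam powr (- a / 2) = 1"
      using l by (simp add: powr_minus)
    then show ?thesis
      unfolding gap_dil[OF that l(1)] f_def mult.assoc[symmetric] by simp
  qed
  fix q :: "real ^ 'n" assume q: "q \<in> cball 0 \<rho>"
  have "norm (lam *\<^sub>R q) < 1"
  proof -
    have "norm q < 1 / lam"
      using q \<rho> by simp
    then show ?thesis
      using l by (simp add: field_simps)
  qed
  then obtain r c where rc: "r > 0" "c > 0" "\<forall>y\<in>ball (lam *\<^sub>R q) r - {lam *\<^sub>R q}. c \<le> gap (dil lam u) y"
    using gap_lower_bound[OF U] gap_dil_pos[OF l le] by (metis less_imp_le)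
  \<comment> \<open>The local bound concerns a punctured ball, so at a regular \<open>q\<close> the
    value at \<open>q\<close> itself is included.\<close>
  define c' where "c' = (if q \<in> bad p then lam powr (a / 2) * c else min (lam powr (a / 2) * c) (f q))"
  have "f q > 0" if "q \<notin> bad p"
  proof -
    have "lam *\<^sub>R q \<in> pball (p /\<^sub>R lam)"
      unfolding ball_bad_scale[OF l(1)] using that q \<rho> by auto
    then have "gap (dil lam u) (lam *\<^sub>R q) > 0"
      using gap_dil_pos[OF l le] by blast
    then show ?thesis
      using that fgap[of q] l by simp
  qed
  then have c': "c' > 0"
    using rc l by (auto simp: c'_def)
  have "c' \<le> f z" if z: "z \<in> ball q (r / lam) - bad p" for z
  proof (cases "z = q")
    case True
    then show ?thesis
      using z by (auto simp: c'_def)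
  next
    case False
    have "norm (lam *\<^sub>R q - lam *\<^sub>R z) = lam * norm (q - z)"
      using l by (simp flip: scaleR_diff_right)
    also have "\<dots> < r"
      using z l by (simp add: dist_norm field_simps)
    finally have "lam *\<^sub>R z \<in> ball (lam *\<^sub>R q) r - {lam *\<^sub>R q}"
      using False l by (simp add: dist_norm)
    then have "c \<le> gap (dil lam u) (lam *\<^sub>R z)"
      using rc(3) by blast
    then have "lam powr (a / 2) * c \<le> f z"
      using z fgap[of z] by (simp add: mult_left_mono)
    then show ?thesis
      by (auto simp: c'_def)
  qed
  then show "\<exists>r>0. \<exists>c>0. \<forall>z\<in>ball q r - bad p. c \<le> kelvin u z - lam powr a * u (lam\<^sup>2 *\<^sub>R z)"
    using rc(1) c' l unfolding f_def by (intro exI[of _ "r / lam"] conjI exI[of _ c'] ballI) auto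
qed simp

end

text \<open>The bound on l2^2 \<rho> keeps all points lam^2 z in the region of continuity, where
  uniform continuity in (lam, z) on a compact set applies.\<close>

lemma dilation_uniform:
  fixes u :: "real ^ 'n \<Rightarrow> real"
  assumes cont: "continuous_on (ball 0 r) u" and l: "0 < l1" "l1 \<le> l2" "l2\<^sup>2 * \<rho> < r" and "c > 0" and \<rho>: "\<rho> > 0"
  shows "\<exists>\<eta>>0. \<forall>lam z. l1 \<le> lam \<and> lam < l1 + \<eta> \<and> lam \<le> l2 \<and> norm z \<le> \<rho> \<longrightarrow>
    lam powr a * u (lam\<^sup>2 *\<^sub>R z) \<le> l1 powr a * u (l1\<^sup>2 *\<^sub>R z) + c"
proof -
  let ?K = "{l1..l2} \<times> cball (0 :: real ^ 'n) \<rho>"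
  define G where "G x = fst x powr a * u ((fst x)\<^sup>2 *\<^sub>R snd x)" for x :: "real \<times> (real ^ 'n)"
  have "(\<lambda>x. (fst x)\<^sup>2 *\<^sub>R snd x) ` ?K \<subseteq> ball 0 r"
  proof
    fix y assume "y \<in> (\<lambda>x. (fst x)\<^sup>2 *\<^sub>R snd x) ` ?K"
    then obtain lam z where y: "y = lam\<^sup>2 *\<^sub>R z" "l1 \<le> lam" "lam \<le> l2" "norm z \<le> \<rho>"
      by auto
    then have "norm y \<le> l2\<^sup>2 * \<rho>"
      using l \<rho> by (auto intro!: mult_mono power_mono)
    then show "y \<in> ball 0 r"
      using l by simp
  qed
  then have "continuous_on ?K G"
    unfolding G_def using l
    by (intro continuous_intros continuous_on_compose2[OF cont]) auto
  moreover have "compact ?K"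
    by (intro compact_Times) auto
  ultimately have "uniformly_continuous_on ?K G"
    by (rule compact_uniformly_continuous)
  then obtain \<eta> where \<eta>: "\<eta> > 0" "\<And>x x'. x \<in> ?K \<Longrightarrow> x' \<in> ?K \<Longrightarrow> dist x' x < \<eta> \<Longrightarrow> dist (G x') (G x) < c"
    unfolding uniformly_continuous_on_def using \<open>c > 0\<close> by metis
  have "lam powr a * u (lam\<^sup>2 *\<^sub>R z) \<le> l1 powr a * u (l1\<^sup>2 *\<^sub>R z) + c"
    if "l1 \<le> lam" "lam < l1 + \<eta>" "lam \<le> l2" "norm z \<le> \<rho>" for lam z
  proof -
    have "dist (G (lam, z)) (G (l1, z)) < c"
      using that l by (intro \<eta>(2)) (auto simp: dist_Pair_Pair dist_real_def)
    then show ?thesis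
      by (simp add: G_def dist_real_def)
  qed
  then show ?thesis
    using \<eta>(1) by blast
qed

text \<open>For |z| up to a radius slightly below 1/lam, the uniform margin absorbs the small change
  of the moving term. The complementary shell stays thin for all slightly larger radii, so the
  criterion covers it.\<close>

lemma reflected_le_continue:
  assumes S: "sol \<alpha>1 \<alpha>2 \<beta> {p} u v" and p0: "p \<noteq> 0"
    and sing: "\<not> (\<exists>M. \<exists>r>0. \<forall>x\<in>ball p r - {p}. u x \<le> M \<and> v x \<le> M)"
    and l: "0 < lam" "lam < norm p" and le: "reflected_le p u v lam"
  shows "\<exists>\<eta>>0. \<forall>\<mu>. lam \<le> \<mu> \<and> \<mu> < lam + \<eta> \<longrightarrow> reflected_le p u v \<mu>"
proof -
  define R where "R = (lam + norm p) / 2"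
  have R: "lam < R" "R < norm p"
    using l by (auto simp: R_def)
  obtain A where A: "A > 0" "\<forall>y\<in>cball 0 R. max_lip \<alpha>1 \<alpha>2 \<beta> (u y) (v y) \<le> A"
    using lip_coeff_bounded[OF S p0 R(2)] by blast
  obtain d where d: "d > 0" "d powr (2 * \<sigma>) * A < shell_const"
    using thin_width[OF A(1)] by blast
  \<comment> \<open>The first bound gives width \<mu> (1 - \<mu>\<rho>) at most \<mu>^2 d', hence at
    most d, for \<mu> up to R; the second keeps \<rho> above 1/|p|.\<close>
  define d' where "d' = min (d / R\<^sup>2) ((1 / lam - 1 / norm p) / 2)"
  have inv: "1 / norm p < 1 / lam"
    using l by (intro divide_strict_left_mono mult_pos_pos) auto
  have R0: "R > 0"
    using R l by simp
  have d': "d' > 0"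
    using d R0 inv by (simp add: d'_def)
  define \<rho> where "\<rho> = 1 / lam - d'"
  have \<rho>: "1 / norm p < \<rho>" "\<rho> < 1 / lam"
  proof -
    have "d' \<le> (1 / lam - 1 / norm p) / 2"
      unfolding d'_def by (rule min.cobounded2)
    then show "1 / norm p < \<rho>"
      unfolding \<rho>_def using inv by argo
    show "\<rho> < 1 / lam"
      using d' by (simp add: \<rho>_def)
  qed
  have \<rho>0: "\<rho> > 0"
    using \<rho>(1) by (smt (verit) divide_nonneg_nonneg norm_ge_zero)
  have sing': "\<not> (\<exists>M. \<exists>r>0. \<forall>x\<in>ball p r - {p}. v x \<le> M \<and> u x \<le> M)"
    using sing by blast
  have le': "reflected_le p v u lam"
    using le unfolding reflected_le_def by blast
  obtain c1 where c1: "c1 > 0" "\<forall>z\<in>cball 0 \<rho> - bad p. c1 \<le> kelvin u z - lam powr a * u (lam\<^sup>2 *\<^sub>R z)"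
    using reflected_gap_lower_bound[OF S p0 sing l le \<rho>(2)] by blast
  obtain c2 where c2: "c2 > 0" "\<forall>z\<in>cball 0 \<rho> - bad p. c2 \<le> kelvin v z - lam powr a * v (lam\<^sup>2 *\<^sub>R z)"
    using reflected_gap_lower_bound[OF sol_swap[OF S] p0 sing' l le' \<rho>(2)] by blast
  \<comment> \<open>The square root gives R1^2 \<rho> at most lam R / lam = R < |p|, so the mirror
    points stay away from the singularity.\<close>
  define R1 where "R1 = min R (sqrt (lam * R))"
  have "lam * lam < lam * R"
    using R l by (intro mult_strict_left_mono)
  then have R1: "lam < R1"
    using R l by (simp add: R1_def real_less_rsqrt power2_eq_square)
  have "R1\<^sup>2 * \<rho> < norm p"
  proof -
    have "R1\<^sup>2 \<le> (sqrt (lam * R))\<^sup>2"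
      using R1 l by (intro power_mono) (auto simp: R1_def)
    also have "\<dots> = lam * R"
      using l R0 by simp
    finally have "R1\<^sup>2 * \<rho> \<le> lam * R * \<rho>"
      using \<rho>0 by (intro mult_right_mono) auto
    also have "\<dots> \<le> lam * R * (1 / lam)"
      using \<rho> l R0 by (intro mult_left_mono) auto
    finally show ?thesis
      using l R by simp
  qed
  note unif = dilation_uniform[OF _ l(1) less_imp_le[OF R1] this _ \<rho>0]
  obtain \<eta>1 where \<eta>1: "\<eta>1 > 0" "\<forall>\<mu> z. lam \<le> \<mu> \<and> \<mu> < lam + \<eta>1 \<and> \<mu> \<le> R1 \<and> norm z \<le> \<rho> \<longrightarrow>
      \<mu> powr a * u (\<mu>\<^sup>2 *\<^sub>R z) \<le> lam powr a * u (lam\<^sup>2 *\<^sub>R z) + c1"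
    using unif[OF continuous_on_ball_u(1)[OF S p0] c1(1)] by blast
  obtain \<eta>2 where \<eta>2: "\<eta>2 > 0" "\<forall>\<mu> z. lam \<le> \<mu> \<and> \<mu> < lam + \<eta>2 \<and> \<mu> \<le> R1 \<and> norm z \<le> \<rho> \<longrightarrow>
      \<mu> powr a * v (\<mu>\<^sup>2 *\<^sub>R z) \<le> lam powr a * v (lam\<^sup>2 *\<^sub>R z) + c2"
    using unif[OF continuous_on_ball_u(2)[OF S p0] c2(1)] by blast
  define \<eta> where "\<eta> = min (R1 - lam) (min \<eta>1 \<eta>2)"
  have "\<eta> > 0"
    using R1 \<eta>1 \<eta>2 by (simp add: \<eta>_def)
  moreover have "reflected_le p u v \<mu>" if m: "lam \<le> \<mu>" "\<mu> < lam + \<eta>" for \<mu>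
  proof (rule reflected_le_criterion[OF S p0 R(2) A(2,1) d(2,1) _ _ \<rho>(1)])
    show m0: "0 < \<mu>"
      using m l by simp
    have mR1: "\<mu> \<le> R1"
      using m by (simp add: \<eta>_def)
    then show mR: "\<mu> \<le> R"
      by (simp add: R1_def)
    show "\<mu> * (1 - \<mu> * \<rho>) \<le> d"
    proof -
      have "1 \<le> \<mu> * (1 / lam)"
        using m l by simp
      then have "1 - \<mu> * \<rho> \<le> \<mu> * d'"
        by (simp add: \<rho>_def right_diff_distrib)
      then have "\<mu> * (1 - \<mu> * \<rho>) \<le> \<mu> * (\<mu> * d')"
        using m0 by (intro mult_left_mono) auto
      also have "\<dots> \<le> R * (R * d')"
        using m0 mR d' by (intro mult_mono) auto
      also have "\<dots> \<le> R * (R * (d / R\<^sup>2))"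
        using R0 by (intro mult_left_mono) (auto simp: d'_def)
      also have "\<dots> = d"
        using R0 by (simp add: power2_eq_square)
      finally show ?thesis .
    qed
    fix z assume z: "z \<in> ball 0 \<rho> - bad p"
    then have z': "z \<in> cball 0 \<rho> - bad p" "norm z \<le> \<rho>"
      by auto
    have "\<mu> powr a * u (\<mu>\<^sup>2 *\<^sub>R z) \<le> lam powr a * u (lam\<^sup>2 *\<^sub>R z) + c1"
      using \<eta>1(2) m mR1 z' by (simp add: \<eta>_def)
    moreover have "\<mu> powr a * v (\<mu>\<^sup>2 *\<^sub>R z) \<le> lam powr a * v (lam\<^sup>2 *\<^sub>R z) + c2"
      using \<eta>2(2) m mR1 z' by (simp add: \<eta>_def)
    ultimately show "refl_le u \<mu> z \<and> refl_le v \<mu> z"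
      using bspec[OF c1(2) z'(1)] bspec[OF c2(2) z'(1)] by linarith
  qed
  ultimately show ?thesis
    by blast
qed

text \<open>The infimum of the failing radii is positive by the start, admissible by the limit, and
  then no infimum by the continuation.\<close>

lemma reflected_le_all:
  assumes S: "sol \<alpha>1 \<alpha>2 \<beta> {p} u v" and p0: "p \<noteq> 0"
    and sing: "\<not> (\<exists>M. \<exists>r>0. \<forall>x\<in>ball p r - {p}. u x \<le> M \<and> v x \<le> M)"
    and l: "0 < lam" "lam < norm p"
  shows "reflected_le p u v lam"
proof (rule ccontr)
  assume fail: "\<not> reflected_le p u v lam"
  define X where "X = {\<mu>. 0 < \<mu> \<and> \<not> reflected_le p u v \<mu>}"
  define m where "m = Inf X"
  have X: "lam \<in> X" "bdd_below X"
    using fail l by (auto simp: X_def intro!: bdd_belowI[of _ 0])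
  obtain lam0 where lam0: "lam0 > 0" "\<forall>lam. 0 < lam \<and> lam < lam0 \<longrightarrow> reflected_le p u v lam"
    using reflected_le_start[OF S p0] by blast
  have "lam0 \<le> m"
    unfolding m_def using X lam0 by (intro cInf_greatest) (auto simp: X_def not_less[symmetric])
  then have m0: "m > 0"
    using lam0 by simp
  have m_le: "m \<le> \<mu>" if "\<mu> \<in> X" for \<mu>
    unfolding m_def using X(2) that by (rule cInf_lower[rotated])
  have mp: "m < norm p"
    using m_le[OF X(1)] l by simp
  have below: "reflected_le p u v \<mu>" if "0 < \<mu>" "\<mu> < m" for \<mu>
    using m_le[of \<mu>] that by (auto simp: X_def)
  have "reflected_le p u v m"
    by (rule reflected_le_limit[OF S p0 m0 mp below])
  then obtain \<eta> where \<eta>: "\<eta> > 0" "\<forall>\<mu>. m \<le> \<mu> \<and> \<mu> < m + \<eta> \<longrightarrow> reflected_le p u v \<mu>"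
    using reflected_le_continue[OF S p0 sing m0 mp] by blast
  have "m + \<eta> \<le> \<mu>" if "\<mu> \<in> X" for \<mu>
  proof (rule ccontr)
    assume "\<not> m + \<eta> \<le> \<mu>"
    then have "reflected_le p u v \<mu>"
      using \<eta>(2) m_le[OF that] by simp
    then show False
      using that by (simp add: X_def)
  qed
  then have "m + \<eta> \<le> Inf X"
    using X(1) by (intro cInf_greatest) auto
  then show False
    using \<eta>(1) by (simp add: m_def)
qed

section \<open>Radial monotonicity from spheres of growing radius\<close>

lemma sol_decreasing:
  assumes S: "sol \<alpha>1 \<alpha>2 \<beta> {0} u v"
    and sing: "\<not> (\<exists>M. \<exists>r>0. \<forall>x\<in>ball 0 r - {0}. u x \<le> M \<and> v x \<le> M)"
    and y: "y1 \<noteq> 0" "y2 \<noteq> 0" "norm y1 \<le> norm y2"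
  shows "u y2 \<le> u y1"
proof (cases "y1 = y2")
  case False
  define L where "L = norm (y2 - y1)"
  define e where "e = (y2 - y1) /\<^sub>R L"
  have L: "L > 0"
    using False by (simp add: L_def)
  have e: "norm e = 1" "y2 - L *\<^sub>R e = y1"
    using L by (auto simp: e_def L_def)
  \<comment> \<open>This is where |y1| \<le> |y2| enters. It yields |x|^2 > t^2 + tL = lam^2 below,
    so the origin lies outside the chosen sphere.\<close>
  have ye: "2 * (y2 \<bullet> e) \<ge> L"
  proof -
    have "L * (2 * (y2 \<bullet> e)) = 2 * (y2 \<bullet> (y2 - y1))"
      using L by (simp add: e_def)
    also have "\<dots> = (norm y2)\<^sup>2 - (norm y1)\<^sup>2 + L\<^sup>2"
      by (simp add: L_def power2_norm_eq_inner inner_diff_left inner_diff_right inner_commute)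
    also have "\<dots> \<ge> L * L"
      using y(3) by (simp add: power2_eq_square power_mono mult_mono)
    finally show ?thesis
      using L by simp
  qed
  have step: "u y2 \<le> ((t + L) / t) powr (a / 2) * u y1" if t: "t > 0" for t
  proof -
    \<comment> \<open>The points \<open>y1\<close>, \<open>y2\<close>, \<open>x\<close> lie on one
      line with |x - y2| = t and |x - y1| = t + L, so the sphere whose squared radius is the product
      exchanges \<open>y1\<close> and \<open>y2\<close>. Relative to \<open>x\<close>,
      \<open>inversion z\<close> is \<open>y1\<close> and lam^2 z is \<open>y2\<close>.\<close>
    define x where "x = y2 + t *\<^sub>R e"
    define lam where "lam = sqrt (t * (t + L))"
    define z where "z = (- t / lam\<^sup>2) *\<^sub>R e"
    have l2: "lam\<^sup>2 = t * (t + L)"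
      using t L by (simp add: lam_def)
    have l0: "lam > 0"
      using t L by (simp add: lam_def)
    have tl: "t < lam"
      using t L by (simp add: lam_def real_less_rsqrt power2_eq_square)
    have "(norm x)\<^sup>2 = (norm y2)\<^sup>2 + 2 * t * (y2 \<bullet> e) + t\<^sup>2"
      using e(1) unfolding x_def power2_norm_eq_inner
      by (simp add: inner_add_left inner_add_right inner_commute power2_eq_square norm_eq_1)
    moreover have "t * (2 * (y2 \<bullet> e)) \<ge> t * L"
      using t ye by (intro mult_left_mono) auto
    moreover have "(norm y2)\<^sup>2 > 0"
      using y by simp
    ultimately have "lam\<^sup>2 < (norm x)\<^sup>2"
      unfolding l2 by (simp add: algebra_simps power2_eq_square)
    then have lx: "lam < norm x"
      by (rule power2_less_imp_less) simp
    then have x0: "- x \<noteq> 0"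
      using l0 by auto
    have Sx: "sol \<alpha>1 \<alpha>2 \<beta> {- x} (\<lambda>z. u (x + z)) (\<lambda>z. v (x + z))"
      using sol_affine[OF S, of 1 x] by simp
    have "\<not> (\<exists>M. \<exists>r>0. \<forall>z\<in>ball (- x) r - {- x}. u (x + z) \<le> M \<and> v (x + z) \<le> M)"
    proof
      assume "\<exists>M. \<exists>r>0. \<forall>z\<in>ball (- x) r - {- x}. u (x + z) \<le> M \<and> v (x + z) \<le> M"
      then obtain M r where M: "r > 0" "\<And>z. z \<in> ball (- x) r - {- x} \<Longrightarrow> u (x + z) \<le> M \<and> v (x + z) \<le> M"
        by blast
      have "u w \<le> M \<and> v w \<le> M" if "w \<in> ball 0 r - {0}" for w
      proof -
        have "w - x \<in> ball (- x) r - {- x}"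
          using that by (auto simp: dist_norm)
        then show ?thesis
          using M(2)[of "w - x"] by simp
      qed
      then show False
        using sing M(1) by blast
    qed
    then have "reflected_le (- x) (\<lambda>z. u (x + z)) (\<lambda>z. v (x + z)) lam"
      using lx by (intro reflected_le_all[OF Sx x0 _ l0]) auto
    moreover have nz: "norm z = t / lam\<^sup>2"
      using t l0 e(1) by (simp add: z_def)
    moreover have "t / lam\<^sup>2 < 1 / lam"
      using tl l0 by (simp add: power2_eq_square field_simps)
    moreover have iz: "x + inversion z = y1"
    proof -
      have "inversion z = - (lam\<^sup>2 / t) *\<^sub>R e"
      proof -
        have "inversion e = e"
          by (simp add: inversion_def e(1))
        then show ?thesis
          unfolding z_def inversion_scaleR using t l0 by simp
      qed
      also have "lam\<^sup>2 / t = t + L"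
        using t by (simp add: l2)
      finally have iz: "inversion z = - (t + L) *\<^sub>R e" .
      show ?thesis
        unfolding x_def iz e(2)[symmetric] by (simp add: algebra_simps)
    qed
    moreover have "z \<noteq> 0"
      using nz t l0 by auto
    moreover have "z \<noteq> inversion (- x)"
      using iz y(1) by (metis add.right_inverse inversion_inversion)
    ultimately have "lam powr a * u (x + lam\<^sup>2 *\<^sub>R z) \<le> kelvin (\<lambda>z. u (x + z)) z"
      unfolding reflected_le_def by auto
    moreover have "x + lam\<^sup>2 *\<^sub>R z = y2"
      using l0 by (simp add: x_def z_def)
    ultimately have le: "lam powr a * u y2 \<le> (t / lam\<^sup>2) powr - a * u y1"
      using iz nz by (simp add: kelvin_def)
    have "(t / lam\<^sup>2) powr - a = lam powr a * (lam / t) powr a"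
    proof -
      have "(t / lam\<^sup>2) powr - a = (lam\<^sup>2 / t) powr a"
        using t l0 by (simp add: powr_minus powr_divide)
      also have "lam\<^sup>2 / t = lam * (lam / t)"
        by (simp add: power2_eq_square)
      finally show ?thesis
        by (simp only: powr_mult)
    qed
    then have "lam powr a * u y2 \<le> lam powr a * ((lam / t) powr a * u y1)"
      using le by (simp only: mult.assoc)
    then have "u y2 \<le> (lam / t) powr a * u y1"
      using l0 by (subst (asm) mult_le_cancel_left_pos) auto
    also have "(lam / t) powr a = ((t + L) / t) powr (a / 2)"
    proof -
      have "(lam / t)\<^sup>2 = (t + L) / t"
        using t by (simp add: power_divide l2) (simp add: power2_eq_square)
      moreover have "(lam / t) powr a = ((lam / t) powr 2) powr (a / 2)"
        by (simp add: powr_powr)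
      ultimately show ?thesis
        using l0 t by simp
    qed
    finally show ?thesis .
  qed
  \<comment> \<open>The conformal factor (1 + L/t)^(a/2) tends to 1 as the centre recedes to
    infinity.\<close>
  have "((\<lambda>t. L / t) \<longlongrightarrow> 0) at_top"
    by (rule tendsto_divide_0[OF tendsto_const filterlim_at_top_imp_at_infinity[OF filterlim_ident]])
  then have "((\<lambda>t. (1 + L / t) powr (a / 2) * u y1) \<longlongrightarrow> (1 + 0) powr (a / 2) * u y1) at_top"
    by (intro tendsto_intros) auto
  moreover have "\<forall>\<^sub>F t in at_top. u y2 \<le> (1 + L / t) powr (a / 2) * u y1"
    using eventually_gt_at_top[of 0]
  proof eventually_elim
    case (elim t)
    then show ?case
      using step[OF elim] by (simp add: add_divide_distrib)
  qed
  ultimately have "u y2 \<le> (1 + 0) powr (a / 2) * u y1"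
    by (intro tendsto_lowerbound) auto
  then show ?thesis
    by simp
qed simp

end


section \<open>From the stated hypotheses to the class \<open>sol\<close>\<close>

lemma (in frac) Lint_if_L_sigma:
  fixes u :: "real ^ 'n \<Rightarrow> real"
  assumes u: "u \<in> L_sigma \<sigma>" and cont: "continuous_on (- {0}) u"
  shows "Lint u"
proof -
  \<comment> \<open>\<open>L_sigma\<close> provides only Lebesgue measurability; continuity off one
    point upgrades it to Borel measurability.\<close>
  have [measurable]: "u \<in> borel_measurable borel"
    using cont by (intro borel_measurable_continuous_countable_exceptions[of "{0}"]) auto
  have "integrable lebesgue (\<lambda>x. \<bar>u x\<bar> / (1 + norm x powr s))"
    using u by (simp add: L_sigma_def s_def)
  then have "integrable lborel (\<lambda>x. \<bar>u x\<bar> / (1 + norm x powr s))"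
    by (subst (asm) integrable_completion) simp_all
  then show ?thesis
    unfolding Lint_def
    by (rule Bochner_Integration.integrable_bound) (auto simp: abs_mult less_imp_le[OF weight_pos])
qed

lemma C2_on_differentiable:
  assumes "C2_on S u" "x \<in> S"
  shows "u differentiable (at x)"
  using assms unfolding C2_on_def differentiable_def by blast

lemma Limsup_le_of_bounded_near:
  fixes u :: "'a::metric_space \<Rightarrow> real"
  assumes "r > 0" "\<And>x. x \<in> ball p r - {p} \<Longrightarrow> u x \<le> M"
  shows "Limsup (at p) (\<lambda>x. ereal (u x)) \<le> ereal M"
proof (rule Limsup_bounded)
  show "\<forall>\<^sub>F x in at p. ereal (u x) \<le> ereal M"
    unfolding eventually_at using assms by (intro exI[of _ r]) (auto simp: dist_commute)
qed

theorem theorem1p2: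
  fixes u v :: "real ^ 'n \<Rightarrow> real" and \<sigma> \<alpha>1 \<alpha>2 \<beta> n :: real
  defines "n \<equiv> real CARD('n)"
  assumes "CARD('n) \<ge> 3"
    and "0 < \<sigma>" and "\<sigma> < 1"
    and "\<alpha>1 > 0" and "\<alpha>2 > 0" and "\<beta> > 0"
    and "C2_on (UNIV - {0}) u" and "u \<in> L_sigma \<sigma>"
    and "C2_on (UNIV - {0}) v" and "v \<in> L_sigma \<sigma>"
    and "\<And>x. x \<noteq> 0 \<Longrightarrow> u x > 0" and "\<And>x. x \<noteq> 0 \<Longrightarrow> v x > 0"
    and "\<And>x. x \<noteq> 0 \<Longrightarrow> has_frac_laplacian \<sigma> u x
           (\<alpha>1 * u x powr ((n + 2 * \<sigma>) / (n - 2 * \<sigma>)) +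
            \<beta> * u x powr (2 * \<sigma> / (n - 2 * \<sigma>)) * v x powr (n / (n - 2 * \<sigma>)))"
    and "\<And>x. x \<noteq> 0 \<Longrightarrow> has_frac_laplacian \<sigma> v x
           (\<alpha>2 * v x powr ((n + 2 * \<sigma>) / (n - 2 * \<sigma>)) +
            \<beta> * v x powr (2 * \<sigma> / (n - 2 * \<sigma>)) * u x powr (n / (n - 2 * \<sigma>)))"
    and "Limsup (at 0) (\<lambda>x. ereal (u x)) + Limsup (at 0) (\<lambda>x. ereal (v x)) = \<infinity>"
  shows "radially_symmetric u \<and> radially_nonincreasing u \<and>
         radially_symmetric v \<and> radially_nonincreasing v"
proof -
  interpret frac \<sigma> "n - 2 * \<sigma>" "n + 2 * \<sigma>" "TYPE('n)"
    by unfold_locales (use assms(2-4) in \<open>simp_all add: n_def\<close>)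
  \<comment> \<open>Dividing the equations by the normalising constant turns them into equations for
    \<open>PV\<close> with positive coefficients \<alpha>1/k, \<alpha>2/k and \<beta>/k.\<close>
  define k where "k = frac_const CARD('n) \<sigma>"
  have k: "k > 0"
    unfolding k_def by (rule frac_const_pos[OF \<sigma>])
  have diff: "u differentiable (at x)" "v differentiable (at x)" if "x \<noteq> 0" for x
    using that by (auto intro: C2_on_differentiable[OF assms(8)] C2_on_differentiable[OF assms(10)])
  have "continuous_on (- {0}) u" "continuous_on (- {0}) v"
    by (rule continuous_at_imp_continuous_on, use diff differentiable_imp_continuous_within in blast)+
  then have L: "Lint u" "Lint v"
    using assms(9,11) by (auto intro: Lint_if_L_sigma)
  have F_div: "F (\<alpha> / k) (\<beta> / k) x y = (\<alpha> * x powr ((n + 2 * \<sigma>) / (n - 2 * \<sigma>)) +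
     \<beta> * x powr (2 * \<sigma> / (n - 2 * \<sigma>)) * y powr (n / (n - 2 * \<sigma>))) / k" for \<alpha> x y
    unfolding F_def n_def[symmetric] by (simp add: add_divide_distrib mult.assoc)
  have S: "sol (\<alpha>1 / k) (\<alpha>2 / k) (\<beta> / k) {0} u v"
    unfolding sol_def F_div
    using assms(5-7,12-15) k diff L by (simp add: has_frac_iff_PV[symmetric] k_def)
  have sing: "\<not> (\<exists>M. \<exists>r>0. \<forall>x\<in>ball 0 r - {0}. u x \<le> M \<and> v x \<le> M)"
  proof
    assume "\<exists>M. \<exists>r>0. \<forall>x\<in>ball 0 r - {0}. u x \<le> M \<and> v x \<le> M"
    then obtain M r where "r > 0" "\<forall>x\<in>ball 0 r - {0}. u x \<le> M \<and> v x \<le> M"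
      by blast
    then have "Limsup (at 0) (\<lambda>x. ereal (u x)) \<le> ereal M" "Limsup (at 0) (\<lambda>x. ereal (v x)) \<le> ereal M"
      by (auto intro!: Limsup_le_of_bounded_near)
    then have "\<infinity> \<le> ereal M + ereal M"
      unfolding assms(16)[symmetric] by (rule add_mono)
    then show False
      by simp
  qed
  have sing': "\<not> (\<exists>M. \<exists>r>0. \<forall>x\<in>ball 0 r - {0}. v x \<le> M \<and> u x \<le> M)"
    using sing by blast
  have "u y \<le> u x" "v y \<le> v x" if "x \<noteq> 0" "y \<noteq> 0" "norm x \<le> norm y" for x y
    using that by (auto intro: sol_decreasing[OF S sing] sol_decreasing[OF sol_swap[OF S] sing'])
  then show ?thesis
    unfolding radially_symmetric_def radially_nonincreasing_def by (auto intro!: antisym)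
qed

end
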